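(* Let $G$ be a tubular group whose underlying graph $\Gamma$ has $\chi(\Gamma) = 0$. Then $G$ is virtually special if and only if it is balanced.
   Context: A tubular group is the fundamental group of a non-empty finite graph of groups $(\mathcal{G},\Gamma)$ where all vertex groups are free abelian of rank $2$ and all edge groups are infinite cyclic; $\Gamma$ is its underlying graph. A group is virtually special if it has a finite index subgroup which embeds in a finitely generated right angled Artin group. A group $G$ is balanced if for every infinite order element $g \in G$ and all $k,l \in \mathbb{Z}\setminus\{0\}$, if $g^k$ is conjugate to $g^l$ in $G$ then $l = \pm k$. Graphs are in the sense of Serre: a graph $\Gamma$ has a vertex set $V\Gamma$, an edge set $E\Gamma$, an inversion map $e \mapsto \overline{e}$ on $E\Gamma$ with $\overline{e} \ne e$ and $\overline{\overline{e}} = e$, and incidence maps $\alpha,\omega: E\Gamma \to V\Gamma$ with $\omega(\overline{e}) = \alpha(e)$. The Euler characteristic of a finite graph is $\chi(\Gamma) = |V\Gamma| - \frac12 |E\Gamma|$. An orientation is a decomposition $E\Gamma = E\Gamma^+ \sqcup E\Gamma^-$ with $E\Gamma^- = \{\overline{e} \mid e \in E\Gamma^+\}$. A finite graph of groups $(\mathcal{G},\Gamma)$ consists of a non-empty finite connected graph $\Gamma$, vertex groups $G_v$ ($v \in V\Gamma$), edge groups $G_e$ ($e \in E\Gamma$) with $G_e = G_{\overline{e}}$, and monomorphisms $\alpha_e: G_e \to G_{\alpha(e)}$ ($e \in E\Gamma$); put $\omega_e := \alpha_{\overline{e}}: G_e \to G_{\omega(e)}$. Given a maximal tree $T$ in $\Gamma$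 and an orientation, its fundamental group is the group generated by all $G_v$, $v \in V\Gamma$, and free letters $t_e$, $e \in E\Gamma^+$, subject to the relations of the vertex groups, $t_e\, \omega_e(a)\, t_e^{-1} = \alpha_e(a)$ for all $e \in E\Gamma^+$, $a \in G_e$, and $t_f = 1$ for all $f \in ET \cap E\Gamma^+$; up to isomorphism it does not depend on the choices. *)

theory Defs
  imports "HOL-Algebra.Free_Abelian_Groups" "HOL-Algebra.Multiplicative_Group" "Graph_Theory.Graph_Theory"
begin

section \<open>Groups given by generators and relations\<close>

text \<open>The letter \<open>(x, True)\<close> stands for the generator \<open>x\<close>, the letter \<open>(x, False)\<close> for its formal
  inverse; a relation is a pair of words that are to become equal.\<close>

type_synonym 'x gword = "('x \<times> bool) list"

definition gwords :: "'x set \<Rightarrow> 'x gword set" where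
  "gwords X = lists (X \<times> UNIV)"

inductive pres_eq :: "'x set \<Rightarrow> ('x gword \<times> 'x gword) set \<Rightarrow> 'x gword \<Rightarrow> 'x gword \<Rightarrow> bool"
  for X R where
  refl: "w \<in> gwords X \<Longrightarrow> pres_eq X R w w"
| sym: "pres_eq X R u v \<Longrightarrow> pres_eq X R v u"
| trans: "pres_eq X R u v \<Longrightarrow> pres_eq X R v w \<Longrightarrow> pres_eq X R u w"
| cancel: "u \<in> gwords X \<Longrightarrow> v \<in> gwords X \<Longrightarrow> x \<in> X \<Longrightarrow>
    pres_eq X R (u @ [(x, b), (x, \<not> b)] @ v) (u @ v)"
| relation: "u \<in> gwords X \<Longrightarrow> v \<in> gwords X \<Longrightarrow> r \<in> gwords X \<Longrightarrow> s \<in> gwords X \<Longrightarrow> (r, s) \<in> R \<Longrightarrow>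
    pres_eq X R (u @ r @ v) (u @ s @ v)"

definition pres_class :: "'x set \<Rightarrow> ('x gword \<times> 'x gword) set \<Rightarrow> 'x gword \<Rightarrow> 'x gword set" where
  "pres_class X R w = {w'. pres_eq X R w w'}"

definition presented_group :: "'x set \<Rightarrow> ('x gword \<times> 'x gword) set \<Rightarrow> 'x gword set monoid" where
  "presented_group X R =
     \<lparr>carrier = pres_class X R ` gwords X,
      monoid.mult = (\<lambda>A B. \<Union>u\<in>A. \<Union>v\<in>B. pres_class X R (u @ v)),
      one = pres_class X R []\<rparr>"

lemma gwords_append [simp]: "u @ v \<in> gwords X \<longleftrightarrow> u \<in> gwords X \<and> v \<in> gwords X"
  by (auto simp: gwords_def)

lemma gwords_Nil [simp]: "[] \<in> gwords X"
  by (simp add: gwords_def)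

lemma gwords_Cons [simp]: "(x, b) # w \<in> gwords X \<longleftrightarrow> x \<in> X \<and> w \<in> gwords X"
  by (auto simp: gwords_def)

lemma pres_eq_gwords:
  assumes "pres_eq X R u v"
  shows "u \<in> gwords X" and "v \<in> gwords X"
  using assms by (induction rule: pres_eq.induct) auto

lemma pres_eq_context:
  assumes "pres_eq X R u v" and "p \<in> gwords X" and "q \<in> gwords X"
  shows "pres_eq X R (p @ u @ q) (p @ v @ q)"
  using assms
proof (induction rule: pres_eq.induct)
  case (refl w)
  then show ?case by (intro pres_eq.refl) auto
next
  case (sym u v)
  then show ?case by (blast intro: pres_eq.sym)
next
  case (trans u v w)
  then show ?case by (blast intro: pres_eq.trans)
next
  case (cancel u v x b)
  then show ?case
    using pres_eq.cancel[of "p @ u" X "v @ q" x R b] by simp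
next
  case (relation u v r s)
  then show ?case
    using pres_eq.relation[of "p @ u" X "v @ q" r s R] by simp
qed

lemma pres_eq_append:
  assumes "pres_eq X R u u'" and "pres_eq X R v v'"
  shows "pres_eq X R (u @ v) (u' @ v')"
proof -
  have "pres_eq X R (u @ v) (u' @ v)"
    using pres_eq_context[OF assms(1), of "[]" v] pres_eq_gwords[OF assms(2)] by simp
  moreover have "pres_eq X R (u' @ v) (u' @ v')"
    using pres_eq_context[OF assms(2), of u' "[]"] pres_eq_gwords[OF assms(1)] by simp
  ultimately show ?thesis by (rule pres_eq.trans)
qed

lemma pres_class_eq_iff:
  assumes "u \<in> gwords X"
  shows "pres_class X R u = pres_class X R v \<longleftrightarrow> pres_eq X R u v"
  using assms unfolding pres_class_def
  by (auto intro: pres_eq.refl pres_eq.sym pres_eq.trans)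

lemma presented_group_mult:
  assumes "u \<in> gwords X" and "v \<in> gwords X"
  shows "pres_class X R u \<otimes>\<^bsub>presented_group X R\<^esub> pres_class X R v = pres_class X R (u @ v)"
  using assms unfolding presented_group_def pres_class_def
  by (auto intro: pres_eq.refl pres_eq.trans pres_eq_append)

definition gword_inv :: "'x gword \<Rightarrow> 'x gword" where
  "gword_inv w = rev (map (\<lambda>(x, b). (x, \<not> b)) w)"

lemma gword_inv_in: "w \<in> gwords X \<Longrightarrow> gword_inv w \<in> gwords X"
  by (auto simp: gwords_def gword_inv_def)

lemma gword_inv_left:
  assumes "w \<in> gwords X"
  shows "pres_eq X R (gword_inv w @ w) []"
  using assms
proof (induction w)
  case Nil
  then show ?case by (simp add: gword_inv_def pres_eq.refl)
next
  case (Cons a w)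
  obtain x b where a: "a = (x, b)" by (cases a)
  with Cons.prems have x: "x \<in> X" and w: "w \<in> gwords X" by auto
  have "pres_eq X R (gword_inv w @ [(x, \<not> b), (x, \<not> \<not> b)] @ w) (gword_inv w @ w)"
    by (intro pres_eq.cancel gword_inv_in x w)
  then show ?case
    using Cons.IH[OF w] by (simp add: a gword_inv_def) (blast intro: pres_eq.trans)
qed

lemma group_presented_group: "group (presented_group X R)"
proof (rule groupI)
  let ?P = "presented_group X R"
  have car: "carrier ?P = pres_class X R ` gwords X" and one: "\<one>\<^bsub>?P\<^esub> = pres_class X R []"
    by (simp_all add: presented_group_def)
  show "\<one>\<^bsub>?P\<^esub> \<in> carrier ?P" by (auto simp: car one)
  fix A B assume A: "A \<in> carrier ?P" and B: "B \<in> carrier ?P"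
  from A B show "A \<otimes>\<^bsub>?P\<^esub> B \<in> carrier ?P"
    by (auto simp: car presented_group_mult)
  from A show "\<one>\<^bsub>?P\<^esub> \<otimes>\<^bsub>?P\<^esub> A = A"
    by (auto simp: car one presented_group_mult)
  from A obtain w where w: "w \<in> gwords X" "A = pres_class X R w" by (auto simp: car)
  have "pres_class X R (gword_inv w) \<otimes>\<^bsub>?P\<^esub> A = \<one>\<^bsub>?P\<^esub>"
    using w gword_inv_left[OF w(1)]
    by (simp add: one presented_group_mult gword_inv_in pres_class_eq_iff)
  moreover have "pres_class X R (gword_inv w) \<in> carrier ?P"
    using w gword_inv_in by (auto simp: car)
  ultimately show "\<exists>B\<in>carrier ?P. B \<otimes>\<^bsub>?P\<^esub> A = \<one>\<^bsub>?P\<^esub>" by blast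
  fix C assume "C \<in> carrier ?P"
  with A B show "A \<otimes>\<^bsub>?P\<^esub> B \<otimes>\<^bsub>?P\<^esub> C = A \<otimes>\<^bsub>?P\<^esub> (B \<otimes>\<^bsub>?P\<^esub> C)"
    by (auto simp: car presented_group_mult)
qed


section \<open>Virtually special groups and balanced groups\<close>

definition simplicial_graph :: "'x set \<Rightarrow> ('x \<times> 'x) set \<Rightarrow> bool" where
  "simplicial_graph X E \<longleftrightarrow> E \<subseteq> X \<times> X \<and> sym E \<and> irrefl E"

definition raag :: "'x set \<Rightarrow> ('x \<times> 'x) set \<Rightarrow> 'x gword set monoid" where
  "raag X E = presented_group X
     {([(x, True), (y, True)], [(y, True), (x, True)]) | x y. (x, y) \<in> E}"

definition fin_gen_group :: "('g, 'm) monoid_scheme \<Rightarrow> bool" where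
  "fin_gen_group G \<longleftrightarrow> (\<exists>S. finite S \<and> S \<subseteq> carrier G \<and> generate G S = carrier G)"

text \<open>A right-angled Artin group is finitely generated only if its defining graph is finite, so
  defining graphs with vertices in \<^typ>\<open>nat\<close> cover all finitely generated ones up to isomorphism.\<close>

definition virtually_special :: "('g, 'm) monoid_scheme \<Rightarrow> bool" where
  "virtually_special G \<longleftrightarrow>
     (\<exists>H. subgroup H G \<and> finite (rcosets\<^bsub>G\<^esub> H) \<and>
        (\<exists>(X :: nat set) E. simplicial_graph X E \<and> fin_gen_group (raag X E) \<and>
           mon (G\<lparr>carrier := H\<rparr>) (raag X E) \<noteq> {}))"

text \<open>\<^const>\<open>group.ord\<close> is \<open>0\<close> exactly on the elements of infinite order.\<close>

definition balanced :: "('g, 'm) monoid_scheme \<Rightarrow> bool" where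
  "balanced G \<longleftrightarrow>
     (\<forall>g\<in>carrier G. group.ord G g = 0 \<longrightarrow>
        (\<forall>k l :: int. k \<noteq> 0 \<longrightarrow> l \<noteq> 0 \<longrightarrow>
           (\<exists>h\<in>carrier G. h \<otimes>\<^bsub>G\<^esub> (g [^]\<^bsub>G\<^esub> k) \<otimes>\<^bsub>G\<^esub> inv\<^bsub>G\<^esub> h = g [^]\<^bsub>G\<^esub> l) \<longrightarrow>
           l = k \<or> l = - k))"


section \<open>Graphs in the sense of Serre\<close>

text \<open>A graph in the sense of Serre is a \<^locale>\<open>bidirected_digraph\<close>: \<^const>\<open>tail\<close> is \<open>\<alpha>\<close>,
  \<^const>\<open>head\<close> is \<open>\<omega>\<close>, and the second parameter is the inversion of edges, which that locale extends
  by the identity outside the edge set.\<close>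

definition euler_char :: "('v, 'e) pre_digraph \<Rightarrow> rat" where
  "euler_char \<Gamma> = of_nat (card (verts \<Gamma>)) - of_nat (card (arcs \<Gamma>)) / 2"

definition orientation :: "('v, 'e) pre_digraph \<Rightarrow> ('e \<Rightarrow> 'e) \<Rightarrow> 'e set \<Rightarrow> bool" where
  "orientation \<Gamma> ei Ep \<longleftrightarrow> Ep \<union> ei ` Ep = arcs \<Gamma> \<and> Ep \<inter> ei ` Ep = {}"

text \<open>The library predicate \<^const>\<open>tree\<close> excludes directed cycles, which is wrong here: every edge
  \<open>e\<close> gives the directed cycle \<open>[e, ei e]\<close>, and choosing only one edge from each pair would admit
  acyclic digraphs that are not trees.  A circuit is a cycle other than such a back-and-forth path.\<close>

definition serre_circuit :: "('v, 'e) pre_digraph \<Rightarrow> ('e \<Rightarrow> 'e) \<Rightarrow> 'e list \<Rightarrow> bool" where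
  "serre_circuit T ei p \<longleftrightarrow> pre_digraph.cycle T p \<and> (\<forall>e. p \<noteq> [e, ei e])"

definition serre_tree :: "('e \<Rightarrow> 'e) \<Rightarrow> ('v, 'e) pre_digraph \<Rightarrow> bool" where
  "serre_tree ei T \<longleftrightarrow> ei ` arcs T \<subseteq> arcs T \<and> connected T \<and> (\<nexists>p. serre_circuit T ei p)"

definition maximal_tree :: "('v, 'e) pre_digraph \<Rightarrow> ('e \<Rightarrow> 'e) \<Rightarrow> ('v, 'e) pre_digraph \<Rightarrow> bool" where
  "maximal_tree \<Gamma> ei T \<longleftrightarrow> pre_digraph.max_subgraph \<Gamma> (serre_tree ei) T"


section \<open>Graphs of groups and tubular groups\<close>

record ('v, 'e, 'a, 'b) graph_of_groups =
  ugraph :: "('v, 'e) pre_digraph"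
  einv :: "'e \<Rightarrow> 'e"
  vgroup :: "'v \<Rightarrow> 'a monoid"
  egroup :: "'e \<Rightarrow> 'b monoid"
  emono :: "'e \<Rightarrow> 'b \<Rightarrow> 'a"

text \<open>\<^term>\<open>emono \<G> e\<close> is the monomorphism \<open>\<alpha>\<^sub>e\<close>, hence \<^term>\<open>emono \<G> (einv \<G> e)\<close> is \<open>\<omega>\<^sub>e\<close>.  The
  predicate \<^const>\<open>connected\<close> requires a vertex.\<close>

definition finite_graph_of_groups :: "('v, 'e, 'a, 'b) graph_of_groups \<Rightarrow> bool" where
  "finite_graph_of_groups \<G> \<longleftrightarrow>
     bidirected_digraph (ugraph \<G>) (einv \<G>) \<and> fin_digraph (ugraph \<G>) \<and> connected (ugraph \<G>) \<and>
     (\<forall>v\<in>verts (ugraph \<G>). group (vgroup \<G> v)) \<and>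
     (\<forall>e\<in>arcs (ugraph \<G>). group (egroup \<G> e) \<and> egroup \<G> (einv \<G> e) = egroup \<G> e \<and>
        emono \<G> e \<in> mon (egroup \<G> e) (vgroup \<G> (tail (ugraph \<G>) e)))"

text \<open>Tagging the elements of a vertex group by the vertex makes the vertex groups disjoint.\<close>

datatype ('v, 'e, 'a) gog_generator = VertexElt 'v 'a | StableLetter 'e

definition fundamental_group ::
  "('v, 'e, 'a, 'b) graph_of_groups \<Rightarrow> ('v, 'e) pre_digraph \<Rightarrow> 'e set \<Rightarrow>
     ('v, 'e, 'a) gog_generator gword set monoid" where
  "fundamental_group \<G> T Ep = presented_group
     ({VertexElt v g | v g. v \<in> verts (ugraph \<G>) \<and> g \<in> carrier (vgroup \<G> v)} \<union> StableLetter ` Ep)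
     ({([(VertexElt v g, True), (VertexElt v h, True)], [(VertexElt v (g \<otimes>\<^bsub>vgroup \<G> v\<^esub> h), True)])
        | v g h. v \<in> verts (ugraph \<G>) \<and> g \<in> carrier (vgroup \<G> v) \<and> h \<in> carrier (vgroup \<G> v)} \<union>
      {([(StableLetter e, True), (VertexElt (head (ugraph \<G>) e) (emono \<G> (einv \<G> e) a), True),
           (StableLetter e, False)],
         [(VertexElt (tail (ugraph \<G>) e) (emono \<G> e a), True)])
        | e a. e \<in> Ep \<and> a \<in> carrier (egroup \<G> e)} \<union>
      {([(StableLetter e, True)], []) | e. e \<in> arcs T \<inter> Ep})"

definition tubular_graph_of_groups :: "('v, 'e, 'a, 'b) graph_of_groups \<Rightarrow> bool" where
  "tubular_graph_of_groups \<G> \<longleftrightarrow> finite_graph_of_groups \<G> \<and>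
     (\<forall>v\<in>verts (ugraph \<G>). vgroup \<G> v \<cong> free_Abelian_group {..<2::nat}) \<and>
     (\<forall>e\<in>arcs (ugraph \<G>). cyclic_group (egroup \<G> e) \<and> infinite (carrier (egroup \<G> e)))"

text \<open>\<^term>\<open>is_tubular_group G \<G>\<close>: \<open>G\<close> is a tubular group, presented as such by \<open>\<G>\<close>, with underlying
  graph \<^term>\<open>ugraph \<G>\<close>.\<close>

definition is_tubular_group :: "'g monoid \<Rightarrow> ('v, 'e, 'a, 'b) graph_of_groups \<Rightarrow> bool" where
  "is_tubular_group G \<G> \<longleftrightarrow> group G \<and> tubular_graph_of_groups \<G> \<and>
     (\<exists>T Ep. maximal_tree (ugraph \<G>) (einv \<G>) T \<and> orientation (ugraph \<G>) (einv \<G>) Ep \<and>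
        G \<cong> fundamental_group \<G> T Ep)"

end

theory Submission
  imports Defs "HOL-Library.Product_Plus"
begin

text \<open>
  A right-angled Artin group acts on functions on words by \<open>x \<mapsto> 1 + x\<close> with \<open>x\<^sup>2 = 0\<close>.  The action is
  faithful and unipotent, so a relation \<open>b a\<^sup>K b\<inverse> = a\<^sup>L\<close> with \<open>a \<noteq> 1\<close> forces \<open>K = L\<close>; passing to a finite
  index subgroup, virtually special groups are balanced.

  Conversely, \<open>\<chi> = 0\<close> means that exactly one edge \<open>e\<^sub>0\<close> lies outside the maximal tree, and it identifies
  two elements \<open>x\<close>, \<open>y\<close> of the tree product \<open>P\<close>.  All vertex groups embed into the rational abelianization
  \<open>V\<close> of \<open>P\<close>, and if the images of \<open>x\<close> and \<open>y\<close> are parallel, then \<open>x\<close> and \<open>y\<close> have a common power in \<open>P\<close>.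
  For balanced \<open>G\<close> the images are therefore independent or equal up to sign, so some linear involution of
  \<open>V\<close> swaps them.  Finitely many integral linear forms on \<open>V\<close>, permuted by that involution, map the vertex
  groups to a lattice \<open>L\<close>, and \<open>G\<close> to a semidirect product of a right-angled Artin group \<open>A\<close> with
  \<open>L \<rtimes> \<int>/2\<close>.  Here \<open>A\<close> has commuting generators for the forms and stable letters for the edges, a stable
  letter commuting with the forms that do not vanish on its edge group.  At each end of each edge some form
  vanishes exactly along the edge group, up to roots, whence a reduced path in the graph of groups maps to a word without cancellation.
  A subgroup of finite index of \<open>L \<rtimes> \<int>/2\<close> acts trivially on \<open>A\<close>, and its preimage in \<open>G\<close> embeds in \<open>A\<close>.
\<close>

section \<open>Conjugated powers and maps out of presented groups\<close>

section \<open>Powers and conjugation\<close>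

text \<open>The obstacle on the constructive side is that the projection of \<open>W\<close> to its
  right-angled Artin factor is not a homomorphism, while a subgroup of finite index has to embed
  into that factor alone. The lattice is therefore recorded twice: as a word in the generators
  \<open>Zg\<close>, and as an element acting on \<open>A\<close>. The acting copy only permutes
  finitely many generators, so the projection is multiplicative once that permutation is trivial;
  the copy inside \<open>A\<close> keeps lattice elements from being lost.

  A form that vanishes along an edge group cannot tell the edge vector from its roots, which would
  permit unwanted cancellation. Hence each stable letter occurs in copies indexed by residues modulo
  \<open>N\<close>, the value of a normalized form on every edge vector. Each form lives on two
  sheets, so that the involution exchanging the end vectors of the extra edge becomes a permutation
  of generators. Finally, the stable letters of tree edges are trivial in the group but not in
  \<open>W\<close>; the map to \<open>W\<close> exists only after conjugating the vertex lattices by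
  a potential on the tree.\<close>

lemma (in group) conj_int_pow:
  fixes n :: int
  assumes "h \<in> carrier G" "x \<in> carrier G"
  shows "(h \<otimes> x \<otimes> inv h) [^] n = h \<otimes> x [^] n \<otimes> inv h"
proof -
  have "(\<lambda>x. h \<otimes> x \<otimes> inv h) \<in> hom G G"
  proof (rule homI)
    fix x y assume "x \<in> carrier G" "y \<in> carrier G"
    moreover from this have "y \<otimes> inv h = inv h \<otimes> (h \<otimes> (y \<otimes> inv h))"
      using assms(1) by (simp add: m_assoc [symmetric])
    ultimately show "h \<otimes> (x \<otimes> y) \<otimes> inv h = h \<otimes> x \<otimes> inv h \<otimes> (h \<otimes> y \<otimes> inv h)"
      using assms(1) by (simp add: m_assoc)
  qed (use assms(1) in simp)
  then interpret h: group_hom G G "\<lambda>x. h \<otimes> x \<otimes> inv h"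
    by unfold_locales
  show ?thesis using h.hom_int_pow [OF assms(2)] by simp
qed

lemma (in group) int_pow_commute:
  fixes n m :: int
  assumes "x \<in> carrier G" "y \<in> carrier G" "x \<otimes> y = y \<otimes> x"
  shows "x [^] n \<otimes> y [^] m = y [^] m \<otimes> x [^] n"
proof -
  have one: "a [^] k \<otimes> b = b \<otimes> a [^] k" if "a \<in> carrier G" "b \<in> carrier G" "a \<otimes> b = b \<otimes> a" for a b and k :: int
  proof -
    have "b \<otimes> a \<otimes> inv b = a" using that by (metis inv_solve_right m_closed)
    then have "b \<otimes> a [^] k \<otimes> inv b = a [^] k" using conj_int_pow [OF that(2,1), of k] by simp
    then show ?thesis using that by (metis int_pow_closed inv_solve_right m_closed)
  qed
  show ?thesis using one [of x "y [^] m" n] one [of y x m] assms by simp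
qed


section \<open>Homomorphisms out of presented groups\<close>

definition word_eval :: "('g, 'm) monoid_scheme \<Rightarrow> ('x \<Rightarrow> 'g) \<Rightarrow> 'x gword \<Rightarrow> 'g" where
  "word_eval K h w = foldr (\<lambda>(x, b) a. (if b then h x else inv\<^bsub>K\<^esub> (h x)) \<otimes>\<^bsub>K\<^esub> a) w \<one>\<^bsub>K\<^esub>"

lemma word_eval_simps [simp]:
  "word_eval K h [] = \<one>\<^bsub>K\<^esub>"
  "word_eval K h ((x, b) # w) = (if b then h x else inv\<^bsub>K\<^esub> (h x)) \<otimes>\<^bsub>K\<^esub> word_eval K h w"
  by (auto simp: word_eval_def)

lemma (in group) word_eval_closed [simp]:
  "h \<in> X \<rightarrow> carrier G \<Longrightarrow> w \<in> gwords X \<Longrightarrow> word_eval G h w \<in> carrier G"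
proof (induction w)
  case (Cons l w)
  then show ?case by (cases l) (auto simp: Pi_iff)
qed auto

lemma (in group) word_eval_append:
  "h \<in> X \<rightarrow> carrier G \<Longrightarrow> u \<in> gwords X \<Longrightarrow> v \<in> gwords X \<Longrightarrow>
     word_eval G h (u @ v) = word_eval G h u \<otimes> word_eval G h v"
proof (induction u)
  case (Cons l u)
  then have "word_eval G h u \<in> carrier G" "word_eval G h v \<in> carrier G"
    by (cases l; auto)+
  with Cons show ?case by (cases l) (auto simp: Pi_iff m_assoc)
qed auto

lemma (in group) word_eval_pres_eq:
  assumes "pres_eq X R u v"
    and h: "h \<in> X \<rightarrow> carrier G"
    and rel: "\<And>r s. (r, s) \<in> R \<Longrightarrow> r \<in> gwords X \<Longrightarrow> s \<in> gwords X \<Longrightarrow> word_eval G h r = word_eval G h s"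
  shows "word_eval G h u = word_eval G h v"
  using assms(1)
proof (induction rule: pres_eq.induct)
  case (cancel u v x b)
  have "h x \<in> carrier G" using h cancel by auto
  moreover have "word_eval G h v \<in> carrier G" using h cancel by auto
  ultimately have "word_eval G h ([(x, b), (x, \<not> b)] @ v) = word_eval G h v"
    by (cases b) (simp_all add: m_assoc [symmetric])
  then show ?case
    using h cancel by (simp only: word_eval_append [OF h] gwords_append gwords_Cons gwords_Nil)
next
  case (relation u v r s)
  then show ?case
    using h rel [of r s] by (simp only: word_eval_append [OF h] gwords_append)
qed auto

text \<open>Functions on classes are defined below at a representative picked by
  \<open>SOME\<close>; invariance under \<open>pres_eq\<close> then gives their value at every
  word.\<close>

lemma pres_class_some:
  assumes "w \<in> gwords X" and "\<And>v. pres_eq X R w v \<Longrightarrow> f w = f v"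
  shows "f (SOME v. v \<in> pres_class X R w) = f w"
proof -
  have "w \<in> pres_class X R w" using assms(1) by (simp add: pres_class_def pres_eq.refl)
  then have "(SOME v. v \<in> pres_class X R w) \<in> pres_class X R w" by (rule someI)
  then show ?thesis using assms(2) by (simp add: pres_class_def)
qed

text \<open>Von Dyck's theorem, with the values on all words recorded.\<close>

lemma (in group) presented_group_hom:
  assumes h: "h \<in> X \<rightarrow> carrier G"
    and rel: "\<And>r s. (r, s) \<in> R \<Longrightarrow> r \<in> gwords X \<Longrightarrow> s \<in> gwords X \<Longrightarrow> word_eval G h r = word_eval G h s"
  obtains \<phi> where "\<phi> \<in> hom (presented_group X R) G"
    and "\<And>w. w \<in> gwords X \<Longrightarrow> \<phi> (pres_class X R w) = word_eval G h w"
proof -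
  define \<phi> where "\<phi> A = word_eval G h (SOME w. w \<in> A)" for A
  have \<phi>: "\<phi> (pres_class X R w) = word_eval G h w" if "w \<in> gwords X" for w
    unfolding \<phi>_def using that word_eval_pres_eq [OF _ h rel] by (intro pres_class_some) blast+
  moreover have "\<phi> \<in> hom (presented_group X R) G"
  proof (rule homI)
    fix A B assume "A \<in> carrier (presented_group X R)" "B \<in> carrier (presented_group X R)"
    then obtain u v where "A = pres_class X R u" "B = pres_class X R v" "u \<in> gwords X" "v \<in> gwords X"
      by (auto simp: presented_group_def)
    then show "\<phi> (A \<otimes>\<^bsub>presented_group X R\<^esub> B) = \<phi> A \<otimes> \<phi> B"
      by (simp add: presented_group_mult \<phi> word_eval_append [OF h])
  qed (auto simp: presented_group_def \<phi> word_eval_closed [OF h])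
  ultimately show ?thesis using that by blast
qed

lemma presented_group_carrier: "carrier (presented_group X R) = pres_class X R ` gwords X"
  by (simp add: presented_group_def)

lemma presented_group_one: "\<one>\<^bsub>presented_group X R\<^esub> = pres_class X R []"
  by (simp add: presented_group_def)

lemma presented_group_letter_inv:
  assumes "x \<in> X"
  shows "inv\<^bsub>presented_group X R\<^esub> (pres_class X R [(x, True)]) = pres_class X R [(x, False)]"
proof -
  interpret group "presented_group X R" by (rule group_presented_group)
  have "pres_class X R [(x, False)] \<otimes>\<^bsub>presented_group X R\<^esub> pres_class X R [(x, True)] = \<one>\<^bsub>presented_group X R\<^esub>"
    using assms pres_eq.cancel [of "[]" X "[]" x R False]
    by (simp add: presented_group_mult presented_group_one pres_class_eq_iff)
  then show ?thesis
    using assms by (intro inv_equality) (auto simp: presented_group_carrier)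
qed

lemma presented_group_Cons:
  assumes "x \<in> X" "w \<in> gwords X"
  shows "pres_class X R ((x, b) # w) =
    (if b then pres_class X R [(x, True)] else inv\<^bsub>presented_group X R\<^esub> (pres_class X R [(x, True)]))
      \<otimes>\<^bsub>presented_group X R\<^esub> pres_class X R w"
  using presented_group_mult [of "[(x, b)]" X w R] assms by (cases b) (simp_all add: presented_group_letter_inv)

lemma presented_group_induct [consumes 1, case_names one gen inv_gen]:
  assumes "a \<in> carrier (presented_group X R)"
    and "P \<one>\<^bsub>presented_group X R\<^esub>"
    and "\<And>x a. x \<in> X \<Longrightarrow> a \<in> carrier (presented_group X R) \<Longrightarrow> P a \<Longrightarrow>
           P (pres_class X R [(x, True)] \<otimes>\<^bsub>presented_group X R\<^esub> a)"
    and "\<And>x a. x \<in> X \<Longrightarrow> a \<in> carrier (presented_group X R) \<Longrightarrow> P a \<Longrightarrow>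
           P (inv\<^bsub>presented_group X R\<^esub> (pres_class X R [(x, True)]) \<otimes>\<^bsub>presented_group X R\<^esub> a)"
  shows "P a"
proof -
  obtain w where w: "w \<in> gwords X" "a = pres_class X R w"
    using assms(1) by (auto simp: presented_group_carrier)
  from w(1) have "P (pres_class X R w)"
  proof (induction w)
    case Nil
    then show ?case using assms(2) by (simp add: presented_group_one)
  next
    case (Cons l w)
    then show ?case
      using assms(3,4) [of _ "pres_class X R w"]
      by (cases l) (auto simp: presented_group_Cons [of _ X w] presented_group_carrier)
  qed
  with w(2) show ?thesis by simp
qed


section \<open>Why right-angled Artin groups admit no unbalanced relation\<close>

section \<open>A unipotent representation of right-angled Artin groups\<close>

definition raag_rels :: "('x \<times> 'x) set \<Rightarrow> ('x gword \<times> 'x gword) set" where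
  "raag_rels E = {([(x, True), (y, True)], [(y, True), (x, True)]) | x y. (x, y) \<in> E}"

lemma raag_altdef: "raag X E = presented_group X (raag_rels E)"
  by (simp add: raag_def raag_rels_def)

text \<open>These are the additive functionals on the ring generated by the letters subject to x^2 =
  0 and xy = yx for (x, y) in \<open>E\<close>, written as functions on monomials. Since (1 + x)(1 -
  x) = 1 there, sending x to 1 + x gives a representation of the Artin group, a truncated Magnus
  map.\<close>

definition trace_fun :: "('x \<times> 'x) set \<Rightarrow> ('x list \<Rightarrow> int) \<Rightarrow> bool" where
  "trace_fun E f \<longleftrightarrow> (\<forall>p x q. f (p @ [x, x] @ q) = 0) \<and>
     (\<forall>p x y q. (x, y) \<in> E \<longrightarrow> f (p @ [x, y] @ q) = f (p @ [y, x] @ q))"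

definition letter_act :: "'x \<times> bool \<Rightarrow> ('x list \<Rightarrow> int) \<Rightarrow> 'x list \<Rightarrow> int" where
  "letter_act l f = (\<lambda>w. f w + (if snd l then 1 else - 1) * f (fst l # w))"

text \<open>Each letter composes the functional with left multiplication by 1 + x or 1 - x. Applying
  letters from left to right composes it with left multiplication by the whole product, which makes
  this a right action.\<close>

definition word_act :: "'x gword \<Rightarrow> ('x list \<Rightarrow> int) \<Rightarrow> 'x list \<Rightarrow> int" where
  "word_act = fold letter_act"

definition deg_less :: "nat \<Rightarrow> ('x list \<Rightarrow> int) \<Rightarrow> bool" where
  "deg_less N f \<longleftrightarrow> (\<forall>w. N \<le> length w \<longrightarrow> f w = 0)"

lemma trace_funI:
  assumes "\<And>p x q. f (p @ x # x # q) = 0"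
    and "\<And>p x y q. (x, y) \<in> E \<Longrightarrow> f (p @ x # y # q) = f (p @ y # x # q)"
  shows "trace_fun E f"
  unfolding trace_fun_def by (auto simp: assms(1) intro: assms(2))

lemma trace_funD:
  assumes "trace_fun E f"
  shows "f (p @ x # x # q) = 0" and "f (x # x # q) = 0"
    and "(x, y) \<in> E \<Longrightarrow> f (p @ x # y # q) = f (p @ y # x # q)"
    and "(x, y) \<in> E \<Longrightarrow> f (x # y # q) = f (y # x # q)"
proof -
  have *: "f (p @ [x, x] @ q) = 0" "(x, y) \<in> E \<Longrightarrow> f (p @ [x, y] @ q) = f (p @ [y, x] @ q)" for p
    using assms unfolding trace_fun_def by blast+
  from *(1) [of p] *(1) [of "[]"] show "f (p @ x # x # q) = 0" "f (x # x # q) = 0" by simp_all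
  from *(2) [of p] *(2) [of "[]"] show "(x, y) \<in> E \<Longrightarrow> f (p @ x # y # q) = f (p @ y # x # q)"
    "(x, y) \<in> E \<Longrightarrow> f (x # y # q) = f (y # x # q)" by simp_all
qed

lemma trace_fun_shift:
  assumes "trace_fun E f"
  shows "trace_fun E (\<lambda>w. f (x # w))"
proof (rule trace_funI)
  fix p y q show "f (x # p @ y # y # q) = 0"
    using trace_funD(1) [OF assms, of "x # p"] by simp
next
  fix p y z q assume "(y, z) \<in> E"
  then show "f (x # p @ y # z # q) = f (x # p @ z # y # q)"
    using trace_funD(3) [OF assms, of y z "x # p"] by simp
qed

lemma trace_fun_lin:
  assumes "trace_fun E f" "trace_fun E g"
  shows "trace_fun E (\<lambda>w. a * f w + b * g w)"
proof (rule trace_funI)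
  fix p x y q assume "(x, y) \<in> E"
  then show "a * f (p @ x # y # q) + b * g (p @ x # y # q) = a * f (p @ y # x # q) + b * g (p @ y # x # q)"
    using trace_funD(3) [OF assms(1), of x y p q] trace_funD(3) [OF assms(2), of x y p q] by simp
qed (simp add: trace_funD(1) [OF assms(1)] trace_funD(1) [OF assms(2)])

lemma trace_fun_letter_act: "trace_fun E f \<Longrightarrow> trace_fun E (letter_act l f)"
  unfolding letter_act_def using trace_fun_lin [OF _ trace_fun_shift, of E f f 1] by auto

lemma word_act_simps [simp]:
  "word_act [] f = f"
  "word_act (l # u) f = word_act u (letter_act l f)"
  "word_act (u @ v) f = word_act v (word_act u f)"
  by (simp_all add: word_act_def)

lemma trace_fun_word_act: "trace_fun E f \<Longrightarrow> trace_fun E (word_act u f)"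
  by (induction u arbitrary: f) (auto simp: trace_fun_letter_act)

lemma word_act_lin:
  "word_act u (\<lambda>w. a * f w + b * g w) = (\<lambda>w. a * word_act u f w + b * word_act u g w)"
proof (induction u arbitrary: f g)
  case (Cons l u)
  have "letter_act l (\<lambda>w. a * f w + b * g w) = (\<lambda>w. a * letter_act l f w + b * letter_act l g w)"
    by (auto simp: letter_act_def fun_eq_iff algebra_simps)
  then show ?case by (simp add: Cons.IH)
qed auto

lemma word_act_pres_eq:
  assumes "pres_eq X (raag_rels E) u v" "trace_fun E f"
  shows "word_act u f = word_act v f"
  using assms
proof (induction arbitrary: f rule: pres_eq.induct)
  case (cancel u v x b)
  have "letter_act (x, \<not> b) (letter_act (x, b) g) = g" if "trace_fun E g" for g
    using trace_funD(2) [OF that] by (auto simp: letter_act_def fun_eq_iff)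
  then show ?case using trace_fun_word_act [OF cancel(4)] by simp
next
  case (relation u v r s)
  then obtain x y where rs: "r = [(x, True), (y, True)]" "s = [(y, True), (x, True)]" "(x, y) \<in> E"
    by (auto simp: raag_rels_def)
  have "letter_act (y, True) (letter_act (x, True) g) = letter_act (x, True) (letter_act (y, True) g)"
    if "trace_fun E g" for g
    using trace_funD(4) [OF that rs(3)] by (auto simp: letter_act_def fun_eq_iff)
  then show ?case using trace_fun_word_act [OF relation(6)] by (simp add: rs)
qed (auto simp: trace_fun_word_act)

text \<open>A letter changes \<open>f\<close> by plus or minus its shift by one letter, and the
  shift lowers the degree bound by one.\<close>

lemma word_act_unipotent:
  "deg_less (Suc N) f \<Longrightarrow> deg_less N (\<lambda>w. word_act u f w - f w)"
proof (induction u arbitrary: f)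
  case (Cons l u)
  have 1: "deg_less (Suc N) (letter_act l f)" "deg_less N (\<lambda>w. letter_act l f w - f w)"
    using Cons.prems by (auto simp: deg_less_def letter_act_def)
  from Cons.IH [OF this(1)] 1(2) show ?case by (simp add: deg_less_def)
qed (simp add: deg_less_def)

locale raag_graph =
  fixes X :: "'x set" and E :: "('x \<times> 'x) set"
  assumes sym_E: "sym E"
begin

definition "A = raag X E"

definition act :: "'x gword set \<Rightarrow> ('x list \<Rightarrow> int) \<Rightarrow> 'x list \<Rightarrow> int" where
  "act a f = word_act (SOME w. w \<in> a) f"

sublocale A: group A
  unfolding A_def raag_altdef by (rule group_presented_group)

lemma carrier_A: "carrier A = pres_class X (raag_rels E) ` gwords X"
  by (simp add: A_def raag_altdef presented_group_carrier)

lemma act_class: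
  "w \<in> gwords X \<Longrightarrow> trace_fun E f \<Longrightarrow> act (pres_class X (raag_rels E) w) f = word_act w f"
  unfolding act_def by (rule pres_class_some [where f = "\<lambda>w. word_act w f"]) (auto intro: word_act_pres_eq)

lemma act_one: "trace_fun E f \<Longrightarrow> act \<one>\<^bsub>A\<^esub> f = f"
  using act_class [of "[]"] by (simp add: A_def raag_altdef presented_group_one)

lemma trace_fun_act: "trace_fun E f \<Longrightarrow> trace_fun E (act a f)"
  unfolding act_def by (rule trace_fun_word_act)

lemma act_lin: "act u (\<lambda>w. a * f w + b * g w) = (\<lambda>w. a * act u f w + b * act u g w)"
  unfolding act_def by (rule word_act_lin)

lemma act_unipotent: "deg_less (Suc N) f \<Longrightarrow> deg_less N (\<lambda>w. act a f w - f w)"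
  unfolding act_def by (rule word_act_unipotent)

lemma act_mult:
  assumes "a \<in> carrier A" "b \<in> carrier A" "trace_fun E f"
  shows "act (a \<otimes>\<^bsub>A\<^esub> b) f = act b (act a f)"
proof -
  obtain u v where uv: "u \<in> gwords X" "v \<in> gwords X" "a = pres_class X (raag_rels E) u"
    "b = pres_class X (raag_rels E) v"
    using assms by (auto simp: carrier_A)
  then have "a \<otimes>\<^bsub>A\<^esub> b = pres_class X (raag_rels E) (u @ v)"
    by (simp add: A_def raag_altdef presented_group_mult)
  then show ?thesis
    using uv assms(3) by (simp add: act_class trace_fun_word_act)
qed

text \<open>The binomial expansion of the power stops after its linear term, because
  \<open>a\<close> fixes the increment \<open>h\<close>.\<close>

lemma act_int_pow:
  fixes n :: int
  assumes a: "a \<in> carrier A" and f: "trace_fun E f" and h: "trace_fun E h"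
    and af: "act a f = (\<lambda>w. f w + h w)" and ah: "act a h = h"
  shows "act (a [^]\<^bsub>A\<^esub> n) f = (\<lambda>w. f w + n * h w)"
proof -
  have nat: "act (a [^]\<^bsub>A\<^esub> n) f = (\<lambda>w. f w + int n * h w) \<and> act (a [^]\<^bsub>A\<^esub> n) h = h" for n :: nat
  proof (induction n)
    case 0
    then show ?case using f h by (simp add: act_one)
  next
    case (Suc n)
    have "act a (\<lambda>w. 1 * f w + int n * h w) = (\<lambda>w. f w + int (Suc n) * h w)"
      unfolding act_lin by (simp add: af ah algebra_simps)
    with Suc show ?case using a f h ah by (simp add: act_mult)
  qed
  show ?thesis
  proof (cases n rule: int_cases2)
    case (nonneg m)
    then show ?thesis using nat [of m] by (simp add: int_pow_int)
  next
    case n: (nonpos m)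
    \<comment> \<open>For a negative exponent, \<open>g\<close> is the preimage of \<open>f\<close>
      under the \<open>m\<close>-th power.\<close>
    define g where "g = (\<lambda>w. 1 * f w + (- int m) * h w)"
    have g: "trace_fun E g" unfolding g_def by (intro trace_fun_lin f h)
    have "act (a [^]\<^bsub>A\<^esub> m) g = f"
      unfolding g_def act_lin using nat [of m] by simp
    then have "act (inv\<^bsub>A\<^esub> (a [^]\<^bsub>A\<^esub> m)) f = act (inv\<^bsub>A\<^esub> (a [^]\<^bsub>A\<^esub> m)) (act (a [^]\<^bsub>A\<^esub> m) g)"
      by simp
    also have "\<dots> = act (a [^]\<^bsub>A\<^esub> m \<otimes>\<^bsub>A\<^esub> inv\<^bsub>A\<^esub> (a [^]\<^bsub>A\<^esub> m)) g"
      using a g by (simp only: act_mult A.nat_pow_closed A.inv_closed)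
    also have "\<dots> = g" using a g by (simp add: act_one)
    finally show ?thesis using a by (simp add: n A.int_pow_neg int_pow_int g_def)
  qed
qed

definition gen :: "'x \<Rightarrow> 'x gword set" where
  "gen x = pres_class X (raag_rels E) [(x, True)]"

lemma gen_closed [simp]: "x \<in> X \<Longrightarrow> gen x \<in> carrier A"
  by (auto simp: gen_def carrier_A)

lemma act_gen_pow:
  fixes n :: int
  assumes "x \<in> X" "trace_fun E f"
  shows "act (gen x [^]\<^bsub>A\<^esub> n) f = (\<lambda>w. f w + n * f (x # w))"
proof -
  have gen_act: "act (gen x) g = (\<lambda>w. g w + g (x # w))" if "trace_fun E g" for g
    using act_class [of "[(x, True)]"] assms(1) that by (simp add: gen_def letter_act_def)
  show ?thesis
  proof (rule act_int_pow)
    show "trace_fun E (\<lambda>w. f (x # w))" by (rule trace_fun_shift [OF assms(2)])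
    then show "act (gen x) (\<lambda>w. f (x # w)) = (\<lambda>w. f (x # w))"
      by (simp only: gen_act trace_funD(2) [OF assms(2)] add_0_right)
    show "act (gen x) f = (\<lambda>w. f w + f (x # w))" by (rule gen_act [OF assms(2)])
    show "gen x \<in> carrier A" using assms(1) by simp
  qed (rule assms(2))
qed

lemma gen_commute:
  assumes "(x, y) \<in> E" "x \<in> X" "y \<in> X"
  shows "gen x \<otimes>\<^bsub>A\<^esub> gen y = gen y \<otimes>\<^bsub>A\<^esub> gen x"
proof -
  have "([(x, True), (y, True)], [(y, True), (x, True)]) \<in> raag_rels E"
    using assms(1) by (auto simp: raag_rels_def)
  then have "pres_eq X (raag_rels E) ([] @ [(x, True), (y, True)] @ []) ([] @ [(y, True), (x, True)] @ [])"
    using assms by (intro pres_eq.relation) simp_all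
  then show ?thesis
    using assms by (simp add: gen_def A_def raag_altdef presented_group_mult pres_class_eq_iff)
qed

text \<open>A syllable \<open>(x, n)\<close> stands for the \<open>n\<close>-th power of the generator \<open>x\<close>.\<close>

definition syl_val :: "('x \<times> int) list \<Rightarrow> 'x gword set" where
  "syl_val s = foldr (\<lambda>(x, n) a. gen x [^]\<^bsub>A\<^esub> n \<otimes>\<^bsub>A\<^esub> a) s \<one>\<^bsub>A\<^esub>"

lemma syl_val_simps [simp]:
  "syl_val [] = \<one>\<^bsub>A\<^esub>" "syl_val ((x, n) # s) = gen x [^]\<^bsub>A\<^esub> n \<otimes>\<^bsub>A\<^esub> syl_val s"
  by (auto simp: syl_val_def)

lemma syl_val_closed [simp]: "fst ` set s \<subseteq> X \<Longrightarrow> syl_val s \<in> carrier A"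
  by (induction s) auto

lemma syl_val_append:
  "fst ` set s \<subseteq> X \<Longrightarrow> fst ` set t \<subseteq> X \<Longrightarrow> syl_val (s @ t) = syl_val s \<otimes>\<^bsub>A\<^esub> syl_val t"
  by (induction s) (auto simp: A.m_assoc)

lemma syl_val_ex:
  assumes "a \<in> carrier A"
  shows "\<exists>s. fst ` set s \<subseteq> X \<and> syl_val s = a"
proof -
  have "a \<in> carrier (presented_group X (raag_rels E))" using assms by (simp add: A_def raag_altdef)
  then show ?thesis
  proof (induction rule: presented_group_induct)
    case one
    show ?case by (intro exI [of _ "[]"]) (simp add: A_def raag_altdef)
  next
    case (gen x a)
    then obtain s where "fst ` set s \<subseteq> X" "syl_val s = a" by blast
    with gen(1) show ?case
      by (intro exI [of _ "(x, 1) # s"]) (simp add: A_def raag_altdef gen_def [symmetric]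
          A.int_pow_1 [unfolded A_def raag_altdef] gen_closed [unfolded A_def raag_altdef])
  next
    case (inv_gen x a)
    then obtain s where "fst ` set s \<subseteq> X" "syl_val s = a" by blast
    with inv_gen(1) show ?case
      by (intro exI [of _ "(x, - 1) # s"]) (simp add: A_def raag_altdef gen_def [symmetric]
          A.int_pow_neg [unfolded A_def raag_altdef]
          A.int_pow_1 [unfolded A_def raag_altdef] gen_closed [unfolded A_def raag_altdef])
  qed
qed

text \<open>The left side evaluates \<open>f\<close> on the product of the factors 1 + n x. Every
  monomial of the expansion except the full one is shorter than \<open>s\<close>, where
  \<open>f\<close> vanishes, so only the top coefficient survives.\<close>

lemma act_syl_val:
  assumes "fst ` set s \<subseteq> X" "trace_fun E f" "\<And>w. length w < length s \<Longrightarrow> f w = 0"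
  shows "act (syl_val s) f [] = (\<Prod>(x, n)\<leftarrow>s. n) * f (map fst s)"
  using assms
proof (induction s arbitrary: f)
  case Nil
  then show ?case by (simp add: act_one)
next
  case (Cons l s)
  obtain x n where l: "l = (x, n)" by (cases l)
  define g where "g = (\<lambda>w. f w + n * f (x # w))"
  have act: "act (gen x [^]\<^bsub>A\<^esub> n) f = g"
    unfolding g_def using Cons.prems l by (intro act_gen_pow) auto
  then have g: "trace_fun E g" using trace_fun_act [OF Cons.prems(2)] by metis
  have "act (syl_val s) g [] = (\<Prod>(x, n)\<leftarrow>s. n) * g (map fst s)"
    using Cons.prems g by (intro Cons.IH) (auto simp: g_def)
  moreover have "g (map fst s) = n * f (map fst (l # s))"
    using Cons.prems(3) by (simp add: g_def l)
  moreover have "act (syl_val (l # s)) f = act (syl_val s) g"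
    using Cons.prems by (simp add: l act_mult act [symmetric])
  ultimately show ?case by (simp add: l)
qed

definition swap_step :: "'x list \<Rightarrow> 'x list \<Rightarrow> bool" where
  "swap_step u v \<longleftrightarrow> (\<exists>p x y q. (x, y) \<in> E \<and> u = p @ [x, y] @ q \<and> v = p @ [y, x] @ q)"

lemma syl_val_swaps:
  assumes "swap_step\<^sup>*\<^sup>* (map fst s) w" "fst ` set s \<subseteq> X"
  shows "\<exists>t. map fst t = w \<and> fst ` set t \<subseteq> X \<and> syl_val t = syl_val s"
  using assms
proof (induction rule: rtranclp_induct)
  case (step v w)
  then obtain t where t: "map fst t = v" "fst ` set t \<subseteq> X" "syl_val t = syl_val s" by blast
  from step(2) obtain p x y q where E: "(x, y) \<in> E" "v = p @ [x, y] @ q" "w = p @ [y, x] @ q"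
    by (auto simp: swap_step_def)
  then obtain p' t' where t': "t = p' @ t'" "map fst p' = p" "map fst t' = [x, y] @ q"
    using t(1) by (auto simp: map_eq_append_conv)
  then obtain n m q' where t'': "t' = [(x, n), (y, m)] @ q'" "map fst q' = q"
    by (auto simp: map_eq_Cons_conv)
  have X: "x \<in> X" "y \<in> X" "fst ` set p' \<subseteq> X" "fst ` set q' \<subseteq> X"
    using t(2) t'(1) t''(1) by auto
  have "gen x [^]\<^bsub>A\<^esub> n \<otimes>\<^bsub>A\<^esub> gen y [^]\<^bsub>A\<^esub> m = gen y [^]\<^bsub>A\<^esub> m \<otimes>\<^bsub>A\<^esub> gen x [^]\<^bsub>A\<^esub> n"
    using gen_commute [OF E(1) X(1,2)] X by (intro A.int_pow_commute) auto
  then have "syl_val ([(y, m), (x, n)] @ q') = syl_val ([(x, n), (y, m)] @ q')"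
    using X by (simp add: A.m_assoc [symmetric])
  then have "syl_val (p' @ [(y, m), (x, n)] @ q') = syl_val t"
    using X unfolding t'(1) t''(1) by (subst (1 2) syl_val_append) auto
  with t X E t' t'' show ?case
    by (intro exI [of _ "p' @ [(y, m), (x, n)] @ q'"]) auto
qed auto

text \<open>Write \<open>a\<close> with as few syllables as possible and let \<open>f\<close> be the
  indicator of the words reachable from its letters by swaps. Equal adjacent letters in such a word
  could be merged into one syllable, against minimality, so \<open>f\<close> is a trace function.
  Minimality also makes all exponents nonzero; their product is the value of \<open>act a f\<close>
  at the empty word, where \<open>f\<close> itself vanishes.\<close>

lemma act_faithful:
  assumes a: "a \<in> carrier A" "a \<noteq> \<one>\<^bsub>A\<^esub>"
  shows "\<exists>f N. trace_fun E f \<and> deg_less N f \<and> act a f \<noteq> f"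
proof -
  define P where "P s \<longleftrightarrow> fst ` set s \<subseteq> X \<and> syl_val s = a" for s
  define s where "s = arg_min length P"
  have "\<exists>s. P s" using syl_val_ex [OF a(1)] by (auto simp: P_def)
  then have s: "P s" "\<And>t. P t \<Longrightarrow> length s \<le> length t"
    unfolding s_def using arg_min_nat_lemma [of P _ length] by blast+
  have X: "fst ` set s \<subseteq> X" "syl_val s = a" using s(1) by (auto simp: P_def)
  have nz: "n \<noteq> 0" if mem: "(x, n) \<in> set s" for x n
  proof
    assume "n = 0"
    obtain u v where uv: "s = u @ (x, n) # v" using split_list [OF mem] by blast
    then have "P (u @ v)"
      using s(1) \<open>n = 0\<close> uv syl_val_append [of u v] syl_val_append [of u "(x, n) # v"]
      by (simp add: P_def image_Un)
    then show False using s(2) uv by force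
  qed
  define f where "f w = (if swap_step\<^sup>*\<^sup>* (map fst s) w then 1 else 0 :: int)" for w
  have len: "length w = length s" if "swap_step\<^sup>*\<^sup>* (map fst s) w" for w
    using that by (induction rule: rtranclp_induct) (auto simp: swap_step_def)
  have "f (p @ [x, x] @ q) = 0" for p x q
  proof (rule ccontr)
    assume "f (p @ [x, x] @ q) \<noteq> 0"
    then have *: "swap_step\<^sup>*\<^sup>* (map fst s) (p @ [x, x] @ q)" by (auto simp: f_def split: if_splits)
    then obtain t where t: "map fst t = p @ [x, x] @ q" "fst ` set t \<subseteq> X" "syl_val t = a"
      using syl_val_swaps [OF _ X(1)] X(2) by blast
    then obtain p' t' where t': "t = p' @ t'" "map fst p' = p" "map fst t' = [x, x] @ q"
      by (auto simp: map_eq_append_conv)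
    then obtain n m q' where t'': "t' = [(x, n), (x, m)] @ q'" "map fst q' = q"
      by (auto simp: map_eq_Cons_conv)
    have X: "x \<in> X" "fst ` set p' \<subseteq> X" "fst ` set q' \<subseteq> X"
      using t(2) t'(1) t''(1) by auto
    have "syl_val ([(x, n + m)] @ q') = syl_val ([(x, n), (x, m)] @ q')"
      using X by (simp add: A.m_assoc [symmetric] A.int_pow_mult)
    then have "syl_val (p' @ [(x, n + m)] @ q') = syl_val t"
      using X unfolding t'(1) t''(1) by (subst (1 2) syl_val_append) auto
    then have "P (p' @ [(x, n + m)] @ q')" using X t by (auto simp: P_def)
    then have "length s \<le> length (p' @ [(x, n + m)] @ q')" by (rule s(2))
    moreover have "length t = length s" using len [OF *] t(1) by (metis length_map)
    ultimately show False using t'(1) t''(1) by simp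
  qed
  moreover have "f (p @ [x, y] @ q) = f (p @ [y, x] @ q)" if "(x, y) \<in> E" for p x y q
  proof -
    have "swap_step (p @ [x, y] @ q) (p @ [y, x] @ q)" "swap_step (p @ [y, x] @ q) (p @ [x, y] @ q)"
      unfolding swap_step_def using that sym_E by (blast dest: symD)+
    then show ?thesis unfolding f_def by (auto dest: rtranclp.rtrancl_into_rtrancl)
  qed
  ultimately have f: "trace_fun E f" by (auto simp: trace_fun_def)
  have "deg_less (Suc (length s)) f" using len by (auto simp: deg_less_def f_def split: if_splits)
  moreover have "act a f [] \<noteq> f []"
  proof -
    have "act a f [] = (\<Prod>(x, n)\<leftarrow>s. n) * f (map fst s)"
      unfolding X(2) [symmetric] using X(1) f
      by (intro act_syl_val) (auto simp: f_def dest: len split: if_splits)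
    also have "f (map fst s) = 1" by (simp add: f_def)
    finally have "act a f [] \<noteq> 0" using nz by (force simp: prod_list_zero_iff)
    moreover have "s \<noteq> []" using a X(2) by auto
    then have "f [] = 0" using len [of "[]"] by (auto simp: f_def)
    ultimately show ?thesis by simp
  qed
  ultimately show ?thesis using f by metis
qed

text \<open>Every element acts as the identity plus an operator lowering the degree, so that \<open>a\<close> acts on
  a suitable \<open>f\<close> by \<open>f \<mapsto> f + h\<close> with \<open>h\<close> fixed by \<open>a\<close>; comparing leading terms of the two sides
  of the relation then gives \<open>K h = L h\<close>.\<close>

theorem conj_int_pow_eq:
  fixes K L :: int
  assumes a: "a \<in> carrier A" "a \<noteq> \<one>\<^bsub>A\<^esub>" and b: "b \<in> carrier A"
    and eq: "b \<otimes>\<^bsub>A\<^esub> a [^]\<^bsub>A\<^esub> K \<otimes>\<^bsub>A\<^esub> inv\<^bsub>A\<^esub> b = a [^]\<^bsub>A\<^esub> L"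
  shows "K = L"
proof -
  define P where "P N \<longleftrightarrow> (\<exists>f. trace_fun E f \<and> deg_less N f \<and> act a f \<noteq> f)" for N
  have "\<exists>N. P N" using act_faithful [OF a] by (auto simp: P_def)
  \<comment> \<open>By minimality of \<open>M\<close>, \<open>a\<close> fixes every trace function
    with a smaller degree bound; unipotence puts the increments \<open>h\<close> of \<open>a\<close>
    and \<open>m\<close> of \<open>b\<close> at \<open>f\<close> into that range.\<close>
  define M where "M = (LEAST N. P N)"
  have "P M" unfolding M_def using \<open>\<exists>N. P N\<close> by (rule LeastI_ex)
  then obtain f where f: "trace_fun E f" "deg_less M f" "act a f \<noteq> f" by (auto simp: P_def)
  have "M \<noteq> 0"
  proof
    assume "M = 0"
    then have "f = (\<lambda>w. 0 * f w + 0 * f w)" using f(2) by (auto simp: deg_less_def)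
    then have "act a f = f" using act_lin [of a 0 f 0 f] by simp
    then show False using f(3) by simp
  qed
  then obtain N where N: "M = Suc N" by (cases M) auto
  have fix_a: "act a g = g" if "trace_fun E g" "deg_less N g" for g
  proof (rule ccontr)
    assume "act a g \<noteq> g"
    then have "P N" using that by (auto simp: P_def)
    then show False using Least_le [of P N] N by (simp add: M_def)
  qed
  define h where "h = (\<lambda>w. 1 * act a f w + (- 1) * f w)"
  have h: "trace_fun E h" unfolding h_def by (intro trace_fun_lin trace_fun_act f)
  have hN: "deg_less N h" using act_unipotent [of N f a] f(2) N by (simp add: h_def)
  define m where "m = (\<lambda>w. 1 * act b f w + (- 1) * f w)"
  have m: "trace_fun E m" unfolding m_def by (intro trace_fun_lin trace_fun_act f)
  have mN: "deg_less N m" using act_unipotent [of N f b] f(2) N by (simp add: m_def)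
  have pow: "act (a [^]\<^bsub>A\<^esub> n) f = (\<lambda>w. f w + n * h w)" for n :: int
    using a f h fix_a [OF h hN] by (intro act_int_pow) (auto simp: h_def)
  have pow_m: "act (a [^]\<^bsub>A\<^esub> n) m = m" for n :: int
    using act_int_pow [of a m "\<lambda>w. 0" n] fix_a [OF m mN] a m fix_a [of "\<lambda>w. 0"]
    by (simp add: trace_funI deg_less_def)
  have bf: "act b f = (\<lambda>w. 1 * f w + 1 * m w)" by (auto simp: m_def)
  have tb: "trace_fun E (act b f)" by (intro trace_fun_act f)
  \<comment> \<open>Evaluating both sides of the relation at \<open>f\<close> cancels
    \<open>f\<close> and leaves K h' = L h.\<close>
  define h' where "h' = act (inv\<^bsub>A\<^esub> b) h"
  have "act (b \<otimes>\<^bsub>A\<^esub> a [^]\<^bsub>A\<^esub> K \<otimes>\<^bsub>A\<^esub> inv\<^bsub>A\<^esub> b) f = act (inv\<^bsub>A\<^esub> b) (act (a [^]\<^bsub>A\<^esub> K) (act b f))"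
    using a b f by (simp add: act_mult trace_fun_act)
  also have "act (a [^]\<^bsub>A\<^esub> K) (act b f) = (\<lambda>w. 1 * act b f w + K * h w)"
    unfolding bf act_lin by (simp add: pow pow_m algebra_simps)
  also have "act (inv\<^bsub>A\<^esub> b) \<dots> = (\<lambda>w. 1 * act (inv\<^bsub>A\<^esub> b) (act b f) w + K * h' w)"
    unfolding act_lin h'_def ..
  also have "act (inv\<^bsub>A\<^esub> b) (act b f) = f"
    using b f act_mult [of b "inv\<^bsub>A\<^esub> b" f] by (simp add: act_one)
  finally have *: "K * h' w = L * h w" for w
    unfolding eq pow by (auto simp: fun_eq_iff)
  \<comment> \<open>\<open>h'\<close> and \<open>h\<close> differ only in lower degree, so they
    agree at a longest word on which \<open>h\<close> does not vanish; its length is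
    \<open>e = d - 1\<close>.\<close>
  define d where "d = (LEAST d. deg_less d h)"
  have d: "deg_less d h" unfolding d_def using hN by (rule LeastI)
  have "d \<noteq> 0"
  proof
    assume "d = 0"
    then have "h w = 0" for w using d by (simp add: deg_less_def)
    then show False using f(3) by (auto simp: h_def)
  qed
  then obtain e where e: "d = Suc e" by (cases d) auto
  have "\<not> deg_less e h" using e not_less_Least [of e "\<lambda>d. deg_less d h"] by (auto simp: d_def)
  then obtain w where w: "length w \<ge> e" "h w \<noteq> 0" by (auto simp: deg_less_def)
  have "deg_less e (\<lambda>w. h' w - h w)" unfolding h'_def using act_unipotent d e by simp
  then have "h' w = h w" using w by (auto simp: deg_less_def)
  with * [of w] w show ?thesis by simp
qed

end

section \<open>Virtually special groups are balanced\<close>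

text \<open>Pigeonhole: two different powers of \<open>x\<close> lie in the same coset of
  \<open>H\<close>.\<close>

lemma (in group) nat_pow_in_finite_index_subgroup:
  assumes H: "subgroup H G" and fin: "finite (rcosets H)" and x: "x \<in> carrier G"
  obtains n :: nat where "n > 0" "x [^] n \<in> H"
proof -
  have "(\<lambda>n::nat. H #> x [^] n) ` UNIV \<subseteq> rcosets H"
    using x by (auto simp: RCOSETS_def)
  then have "finite (range (\<lambda>n::nat. H #> x [^] n))" using fin finite_subset by blast
  then have "\<not> inj (\<lambda>n::nat. H #> x [^] n)" using finite_imageD infinite_UNIV_nat by blast
  then obtain i j :: nat where ij: "i < j" "H #> x [^] i = H #> x [^] j"
    unfolding inj_def using linorder_neqE_nat by (metis (no_types))
  have "x [^] j \<in> H #> x [^] i"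
    using ij(2) rcos_self [OF _ H, of "x [^] j"] x by simp
  then obtain h where h: "h \<in> H" "x [^] j = h \<otimes> x [^] i" by (auto simp: r_coset_def)
  have "x [^] (j - i) \<otimes> x [^] i = h \<otimes> x [^] i" using ij(1) x h(2) by (simp add: nat_pow_mult)
  then have "x [^] (j - i) = h" using x h(1) subgroup.mem_carrier [OF H] by simp
  then show ?thesis using that [of "j - i"] ij(1) h(1) by simp
qed

text \<open>Each conjugation by \<open>h\<close> trades one factor \<open>k\<close> of the exponent
  for a factor \<open>l\<close>. The iterated form serves to replace \<open>h\<close> by a power of
  it that lies in a subgroup of finite index.\<close>

lemma (in group) iterated_conj_pow:
  fixes k l :: int and j :: nat
  assumes "g \<in> carrier G" "h \<in> carrier G" and eq: "h \<otimes> g [^] k \<otimes> inv h = g [^] l"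
  shows "h [^] j \<otimes> g [^] (k ^ j) \<otimes> inv (h [^] j) = g [^] (l ^ j)"
proof (induction j)
  case (Suc j)
  have pw: "(g [^] a) [^] b = g [^] (a * b)" for a b :: int
    using assms(1) by (rule int_pow_pow)
  have *: "x \<otimes> h \<otimes> y \<otimes> inv (x \<otimes> h) = x \<otimes> (h \<otimes> y \<otimes> inv h) \<otimes> inv x"
    if "x \<in> carrier G" "y \<in> carrier G" for x y
    using that assms(2) by (simp add: inv_mult_group m_assoc)
  have "h [^] Suc j \<otimes> g [^] (k ^ Suc j) \<otimes> inv (h [^] Suc j) =
      h [^] j \<otimes> (h \<otimes> (g [^] k) [^] (k ^ j) \<otimes> inv h) \<otimes> inv (h [^] j)"
    using * [of "h [^] j" "g [^] (k ^ Suc j)"] assms(1,2) by (simp only: nat_pow_Suc pw nat_pow_closed int_pow_closed power_Suc)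
  also have "h \<otimes> (g [^] k) [^] (k ^ j) \<otimes> inv h = (h \<otimes> g [^] k \<otimes> inv h) [^] (k ^ j)"
    using assms(1,2) by (intro conj_int_pow [symmetric]) simp_all
  also have "\<dots> = (g [^] (k ^ j)) [^] l"
    unfolding eq pw by (simp add: mult.commute)
  also have "h [^] j \<otimes> (g [^] (k ^ j)) [^] l \<otimes> inv (h [^] j) = (h [^] j \<otimes> g [^] (k ^ j) \<otimes> inv (h [^] j)) [^] l"
    using assms(1,2) by (intro conj_int_pow [symmetric]) simp_all
  also have "\<dots> = g [^] (l ^ Suc j)" unfolding Suc pw by (simp add: mult.commute)
  finally show ?case .
qed (use assms(1) in simp)

lemma abs_eq_of_power_eq:
  fixes k l :: int
  assumes "k ^ m = l ^ m" "m > 0"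
  shows "l = k \<or> l = - k"
proof -
  have "\<bar>k\<bar> ^ m = \<bar>l\<bar> ^ m" unfolding power_abs [symmetric] assms(1) ..
  then have "\<bar>k\<bar> = \<bar>l\<bar>" using assms(2) by (intro power_eq_imp_eq_base [of "\<bar>k\<bar>" m]) simp_all
  then show ?thesis by (auto simp: abs_if split: if_splits)
qed

text \<open>Powers of \<open>g\<close> and of the conjugator lie in the subgroup of finite index.
  Iterating the relation \<open>m\<close> times, with the \<open>m\<close>-th power of the
  conjugator in that subgroup, gives a relation in the Artin group that forces k^m = l^m. The sign
  in the conclusion arises from extracting the root.\<close>

theorem virtually_special_imp_balanced:
  fixes G (structure)
  assumes "group G" "virtually_special G"
  shows "balanced G"
proof -
  interpret group G by (rule assms(1))
  obtain H X E \<phi> where H: "subgroup H G" "finite (rcosets H)" and E: "simplicial_graph (X :: nat set) E"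
    and \<phi>: "\<phi> \<in> mon (G\<lparr>carrier := H\<rparr>) (raag X E)"
    using assms(2) unfolding virtually_special_def by blast
  interpret raag_graph X E using E by unfold_locales (simp add: simplicial_graph_def)
  interpret H: group "G\<lparr>carrier := H\<rparr>" using H(1) by (rule subgroup_imp_group)
  interpret \<phi>: group_hom "G\<lparr>carrier := H\<rparr>" A \<phi>
    using \<phi> by unfold_locales (simp add: mon_def A_def)
  have hom_mult: "\<phi> (x \<otimes> y) = \<phi> x \<otimes>\<^bsub>A\<^esub> \<phi> y" if "x \<in> H" "y \<in> H" for x y
    using \<phi>.hom_mult [of x y] that by simp
  have hom_pow: "\<phi> (x [^] n) = \<phi> x [^]\<^bsub>A\<^esub> n" if "x \<in> H" for x and n :: int
    using \<phi>.hom_int_pow [of x n] int_pow_consistent [OF H(1) that, of n] that by simp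
  have hom_inv: "\<phi> (inv x) = inv\<^bsub>A\<^esub> \<phi> x" if "x \<in> H" for x
    using \<phi>.hom_inv [of x] m_inv_consistent [OF H(1) that] that by simp
  have closed: "\<phi> x \<in> carrier A" if "x \<in> H" for x
    using \<phi>.hom_closed [of x] that by simp
  have inj: "\<phi> x \<noteq> \<one>\<^bsub>A\<^esub>" if "x \<in> H" "x \<noteq> \<one>" for x
  proof -
    have "inj_on \<phi> H" using \<phi> by (simp add: mon_def)
    moreover have "\<phi> \<one> = \<one>\<^bsub>A\<^esub>" using \<phi>.hom_one by simp
    ultimately show ?thesis using that subgroup.one_closed [OF H(1)] by (metis inj_onD)
  qed
  show ?thesis
    unfolding balanced_def
  proof (intro ballI impI allI; elim bexE)
    fix g h and k l :: int
    assume g: "g \<in> carrier G" "ord g = 0" and h: "h \<in> carrier G" and nz: "k \<noteq> 0" "l \<noteq> 0"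
      and eq: "h \<otimes> g [^] k \<otimes> inv h = g [^] l"
    obtain n where n: "n > 0" "g [^] (n :: nat) \<in> H"
      using nat_pow_in_finite_index_subgroup [OF H g(1)] .
    obtain m where m: "m > 0" "h [^] (m :: nat) \<in> H"
      using nat_pow_in_finite_index_subgroup [OF H h] .
    define a where "a = \<phi> (g [^] n)"
    define b where "b = \<phi> (h [^] m)"
    have conj: "h [^] m \<otimes> (g [^] n) [^] (k ^ m) \<otimes> inv (h [^] m) = (g [^] n) [^] (l ^ m)"
    proof -
      have swap: "(g [^] n) [^] i = (g [^] i) [^] int n" for i :: int
        using g(1) int_pow_pow [of g "int n" i] int_pow_pow [of g i "int n"]
        by (simp add: int_pow_int mult.commute)
      show ?thesis
        unfolding swap iterated_conj_pow [OF g(1) h eq, of m, symmetric]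
        using g(1) h by (intro conj_int_pow [symmetric]) simp_all
    qed
    have HH: "(g [^] n) [^] i \<in> H" "inv (h [^] m) \<in> H" "h [^] m \<otimes> (g [^] n) [^] i \<in> H" for i :: int
      using subgroup_int_pow_closed [OF H(1) n(2)] subgroup.m_inv_closed [OF H(1) m(2)]
        subgroup.m_closed [OF H(1) m(2)] by auto
    have "b \<otimes>\<^bsub>A\<^esub> a [^]\<^bsub>A\<^esub> (k ^ m) \<otimes>\<^bsub>A\<^esub> inv\<^bsub>A\<^esub> b = \<phi> (h [^] m \<otimes> (g [^] n) [^] (k ^ m) \<otimes> inv (h [^] m))"
      by (simp only: a_def b_def hom_mult hom_pow hom_inv n(2) m(2) HH)
    also have "\<dots> = a [^]\<^bsub>A\<^esub> (l ^ m)"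
      unfolding conj a_def by (rule hom_pow [OF n(2)])
    finally have rel: "b \<otimes>\<^bsub>A\<^esub> a [^]\<^bsub>A\<^esub> (k ^ m) \<otimes>\<^bsub>A\<^esub> inv\<^bsub>A\<^esub> b = a [^]\<^bsub>A\<^esub> (l ^ m)" .
    have "g [^] n \<noteq> \<one>" using g n(1) by (simp add: pow_eq_id)
    then have "a \<noteq> \<one>\<^bsub>A\<^esub>" unfolding a_def by (rule inj [OF n(2)])
    with rel have "k ^ m = l ^ m"
      using closed n(2) m(2) by (intro conj_int_pow_eq [of a b]) (auto simp: a_def b_def)
    then show "l = k \<or> l = - k" using m(1) by (rule abs_eq_of_power_eq)
  qed
qed

section \<open>The target group and its action on reduced words\<close>

section \<open>Semidirect products\<close>

definition semidirect :: "'a monoid \<Rightarrow> 'm monoid \<Rightarrow> ('m \<Rightarrow> 'a \<Rightarrow> 'a) \<Rightarrow> ('a \<times> 'm) monoid" where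
  "semidirect A M \<theta> =
     \<lparr>carrier = carrier A \<times> carrier M,
      monoid.mult = (\<lambda>x y. (fst x \<otimes>\<^bsub>A\<^esub> \<theta> (snd x) (fst y), snd x \<otimes>\<^bsub>M\<^esub> snd y)),
      one = (\<one>\<^bsub>A\<^esub>, \<one>\<^bsub>M\<^esub>)\<rparr>"

lemma semidirect_simps [simp]:
  "carrier (semidirect A M \<theta>) = carrier A \<times> carrier M"
  "x \<otimes>\<^bsub>semidirect A M \<theta>\<^esub> y = (fst x \<otimes>\<^bsub>A\<^esub> \<theta> (snd x) (fst y), snd x \<otimes>\<^bsub>M\<^esub> snd y)"
  "\<one>\<^bsub>semidirect A M \<theta>\<^esub> = (\<one>\<^bsub>A\<^esub>, \<one>\<^bsub>M\<^esub>)"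
  by (simp_all add: semidirect_def)

lemma group_semidirect:
  assumes "group A" "group M"
    and hom: "\<And>m. m \<in> carrier M \<Longrightarrow> \<theta> m \<in> hom A A"
    and one: "\<And>a. a \<in> carrier A \<Longrightarrow> \<theta> \<one>\<^bsub>M\<^esub> a = a"
    and mult: "\<And>m n a. m \<in> carrier M \<Longrightarrow> n \<in> carrier M \<Longrightarrow> a \<in> carrier A \<Longrightarrow>
      \<theta> (m \<otimes>\<^bsub>M\<^esub> n) a = \<theta> m (\<theta> n a)"
  shows "group (semidirect A M \<theta>)"
proof -
  interpret A: group A by fact
  interpret M: group M by fact
  have closed [simp]: "\<theta> m a \<in> carrier A" if "m \<in> carrier M" "a \<in> carrier A" for m a
    using hom [OF that(1)] that(2) by (auto simp: hom_def)
  have hom_mult: "\<theta> m (a \<otimes>\<^bsub>A\<^esub> b) = \<theta> m a \<otimes>\<^bsub>A\<^esub> \<theta> m b"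
    if "m \<in> carrier M" "a \<in> carrier A" "b \<in> carrier A" for m a b
    using hom [OF that(1)] that(2,3) by (auto simp: hom_def)
  show ?thesis
  proof (rule groupI)
    fix x assume x: "x \<in> carrier (semidirect A M \<theta>)"
    define m where "m = inv\<^bsub>M\<^esub> (snd x)"
    define y where "y = (\<theta> m (inv\<^bsub>A\<^esub> (fst x)), m)"
    have m: "m \<in> carrier M" "snd x \<in> carrier M" "fst x \<in> carrier A" using x by (auto simp: m_def)
    have "\<theta> m (inv\<^bsub>A\<^esub> (fst x)) \<otimes>\<^bsub>A\<^esub> \<theta> m (fst x) = \<theta> m \<one>\<^bsub>A\<^esub>"
      using m by (simp add: hom_mult [symmetric])
    also have "\<dots> = \<one>\<^bsub>A\<^esub>" using hom [OF m(1)] hom_one [OF _ assms(1,1)] by blast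
    finally have "y \<otimes>\<^bsub>semidirect A M \<theta>\<^esub> x = \<one>\<^bsub>semidirect A M \<theta>\<^esub>"
      using m by (simp add: y_def m_def)
    moreover have "y \<in> carrier (semidirect A M \<theta>)" using m by (simp add: y_def)
    ultimately show "\<exists>y\<in>carrier (semidirect A M \<theta>). y \<otimes>\<^bsub>semidirect A M \<theta>\<^esub> x = \<one>\<^bsub>semidirect A M \<theta>\<^esub>"
      by blast
  qed (auto simp: one mult hom_mult A.m_assoc M.m_assoc)
qed


section \<open>Cancellation in words\<close>

text \<open>Van der Waerden's method: the free group acts on reduced words by adding a letter in
  front, with cancellation. The most recent letter is thus the head of the word.\<close>

fun push :: "'l \<times> bool \<Rightarrow> ('l \<times> bool) list \<Rightarrow> ('l \<times> bool) list" where
  "push l [] = [l]"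
| "push l (k # w) = (if k = (fst l, \<not> snd l) then w else l # k # w)"

fun reduced :: "('l \<times> bool) list \<Rightarrow> bool" where
  "reduced [] = True"
| "reduced [l] = True"
| "reduced (l # k # w) \<longleftrightarrow> k \<noteq> (fst l, \<not> snd l) \<and> reduced (k # w)"

lemma reduced_Cons: "reduced (l # w) \<Longrightarrow> reduced w"
  by (cases w) auto

lemma reduced_push: "reduced w \<Longrightarrow> reduced (push l w)"
  by (cases w) (auto dest: reduced_Cons)

lemma push_push:
  assumes "reduced w"
  shows "push (x, \<not> b) (push (x, b) w) = w"
proof (cases w)
  case (Cons k v)
  with assms show ?thesis by (cases v) auto
qed auto

lemma length_push:
  "w = [] \<or> hd w \<noteq> (fst l, \<not> snd l) \<Longrightarrow> length (push l w) = Suc (length w) \<and> hd (push l w) = l"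
  by (cases w) auto


section \<open>A right-angled Artin group with an action of a lattice\<close>

text \<open>\<open>Zg i\<close> belongs to the linear form with index \<open>i\<close>.
  \<open>Tg e r s\<close> is the copy of the stable letter of \<open>e\<close> with residue
  \<open>r\<close> modulo \<open>N\<close> on sheet \<open>s\<close>; lattice and sheet swap permute
  these copies.\<close>

datatype ('e, 'f) rgen = Zg "'f \<times> bool" | Tg 'e int bool

definition flip :: "bool \<Rightarrow> 'f \<times> bool \<Rightarrow> 'f \<times> bool" where
  "flip s i = (fst i, snd i \<noteq> s)"

lemma flip_simps [simp]:
  "flip False i = i" "flip s (flip s' i) = flip (s \<noteq> s') i" "fst (flip s i) = fst i"
  "flip s (f, b) = (f, b \<noteq> s)"
  by (auto simp: flip_def prod_eq_iff)

text \<open>The boolean component generates a group of order two that swaps the two sheets.\<close>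

definition Mgrp :: "(('f \<times> bool \<Rightarrow> int) \<times> bool) monoid" where
  "Mgrp = \<lparr>carrier = UNIV,
     monoid.mult = (\<lambda>x y. (\<lambda>i. fst x i + fst y (flip (snd x) i), snd x \<noteq> snd y)),
     one = (\<lambda>i. 0, False)\<rparr>"

lemma Mgrp_simps [simp]:
  "carrier Mgrp = UNIV"
  "x \<otimes>\<^bsub>Mgrp\<^esub> y = (\<lambda>i. fst x i + fst y (flip (snd x) i), snd x \<noteq> snd y)"
  "\<one>\<^bsub>Mgrp\<^esub> = (\<lambda>i. 0, False)"
  by (simp_all add: Mgrp_def)

lemma group_Mgrp: "group Mgrp"
proof (rule groupI)
  fix x :: "('f \<times> bool \<Rightarrow> int) \<times> bool"
  have "(\<lambda>i. - fst x (flip (snd x) i), snd x) \<otimes>\<^bsub>Mgrp\<^esub> x = \<one>\<^bsub>Mgrp\<^esub>" by simp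
  then show "\<exists>y\<in>carrier Mgrp. y \<otimes>\<^bsub>Mgrp\<^esub> x = \<one>\<^bsub>Mgrp\<^esub>" by (metis Mgrp_simps(1) UNIV_I)
next
  fix x y z :: "('f \<times> bool \<Rightarrow> int) \<times> bool"
  show "x \<otimes>\<^bsub>Mgrp\<^esub> y \<otimes>\<^bsub>Mgrp\<^esub> z = x \<otimes>\<^bsub>Mgrp\<^esub> (y \<otimes>\<^bsub>Mgrp\<^esub> z)"
    by (cases "snd x"; cases "snd y") (auto simp: fun_eq_iff add.assoc)
qed auto

definition zmult :: "int \<Rightarrow> int \<times> int \<Rightarrow> int \<times> int" where
  "zmult k z = (k * fst z, k * snd z)"

definition det2 :: "int \<times> int \<Rightarrow> int \<times> int \<Rightarrow> int" where
  "det2 p z = fst p * snd z - snd p * fst z"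

text \<open>An edge \<open>e\<close> identifies \<open>ph e\<close> in the copy of the lattice at \<open>tgt e\<close> with \<open>pt e\<close> in the
  one at \<open>src e\<close>.  The linear form with index \<open>(f, b)\<close> lives on sheet \<open>b\<close> of a double cover of
  the graph, in which the edge \<open>e\<close> changes the sheet iff \<open>sg e\<close>.\<close>

locale raag_target =
  fixes Ep :: "'e set" and src tgt :: "'e \<Rightarrow> 'v" and pt ph :: "'e \<Rightarrow> int \<times> int"
    and F :: "'f list" and i0 :: "'e \<Rightarrow> 'f" and ea eb :: "'f \<times> bool \<Rightarrow> 'v \<Rightarrow> int"
    and sg :: "'e \<Rightarrow> bool" and N :: int
    and ell
  defines "ell i v z \<equiv> ea i v * fst z + eb i v * snd z"
  assumes finite_Ep: "finite Ep"
    and distinct_F: "distinct F"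
    and N_pos: "N > 0"
    and i0: "e \<in> Ep \<Longrightarrow> i0 e \<in> set F"
    and ell_edge: "e \<in> Ep \<Longrightarrow> f \<in> set F \<Longrightarrow> ell (f, b) (src e) (pt e) = ell (f, b \<noteq> sg e) (tgt e) (ph e)"
    and ell_i0: "e \<in> Ep \<Longrightarrow> ell (i0 e, False) (src e) (pt e) = N"
    and det_src: "e \<in> Ep \<Longrightarrow> \<exists>f\<in>set F. \<forall>z. ell (f, False) (src e) z = 0 \<longleftrightarrow> det2 (pt e) z = 0"
    and det_tgt: "e \<in> Ep \<Longrightarrow> \<exists>f\<in>set F. \<forall>z. ell (f, False) (tgt e) z = 0 \<longleftrightarrow> det2 (ph e) z = 0"
    and pt_nz: "e \<in> Ep \<Longrightarrow> pt e \<noteq> 0" and ph_nz: "e \<in> Ep \<Longrightarrow> ph e \<noteq> 0"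
begin

lemma ell_add: "ell i v (z + z') = ell i v z + ell i v z'"
  by (simp add: ell_def algebra_simps)

lemma ell_zmult: "ell i v (zmult k z) = k * ell i v z"
  by (simp add: ell_def zmult_def algebra_simps)

text \<open>The value 0 outside \<open>F\<close> matches \<open>zword\<close>, which sees only the
  forms in \<open>F\<close>; thus both copies of the lattice record the same coordinates.\<close>

definition lam :: "'v \<Rightarrow> int \<times> int \<Rightarrow> 'f \<times> bool \<Rightarrow> int" where
  "lam v z i = (if fst i \<in> set F then ell i v z else 0)"

lemma lam_add: "lam v (z + z') i = lam v z i + lam v z' i"
  by (simp add: lam_def ell_add)

lemma lam_edge: "e \<in> Ep \<Longrightarrow> lam (src e) (pt e) i = lam (tgt e) (ph e) (flip (sg e) i)"
  using ell_edge [of e "fst i" "snd i"] by (simp add: lam_def flip_def)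

definition supp :: "'e \<Rightarrow> bool \<Rightarrow> ('f \<times> bool) set" where
  "supp e s = {i. lam (src e) (pt e) (flip s i) \<noteq> 0}"

definition gens :: "('e, 'f) rgen set" where
  "gens = {Zg i | i. fst i \<in> set F} \<union> {Tg e r s | e r s. e \<in> Ep \<and> 0 \<le> r \<and> r < N}"

text \<open>The stable letter has to commute with the word of its edge vector. That word contains
  exactly the generators whose form is nonzero on the vector, which is what \<open>supp\<close>
  collects for either sheet.\<close>

definition comms :: "(('e, 'f) rgen \<times> ('e, 'f) rgen) set" where
  "comms = {(x, y). x \<in> gens \<and> y \<in> gens \<and>
     (\<exists>i j. x = Zg i \<and> y = Zg j \<and> i \<noteq> j \<or>
       (\<exists>e r s. i \<in> supp e s \<and> (x = Zg i \<and> y = Tg e r s \<or> x = Tg e r s \<and> y = Zg i)))}"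

lemma simplicial: "simplicial_graph gens comms"
  by (auto simp: simplicial_graph_def comms_def sym_def irrefl_def)

lemma finite_gens: "finite gens"
proof -
  have "gens \<subseteq> Zg ` (set F \<times> UNIV) \<union> (\<lambda>(e, r, s). Tg e r s) ` (Ep \<times> {0..<N} \<times> UNIV)"
    unfolding gens_def by (force simp: image_iff)
  then show ?thesis using finite_Ep by (auto intro: finite_subset)
qed

sublocale raag_graph gens comms
  using simplicial by unfold_locales (simp add: simplicial_graph_def)

abbreviation cls :: "('e, 'f) rgen gword \<Rightarrow> ('e, 'f) rgen gword set" where
  "cls \<equiv> pres_class gens (raag_rels comms)"

lemma cls_mult: "u \<in> gwords gens \<Longrightarrow> v \<in> gwords gens \<Longrightarrow> cls u \<otimes>\<^bsub>A\<^esub> cls v = cls (u @ v)"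
  by (simp add: A_def raag_altdef presented_group_mult)

lemma one_A: "\<one>\<^bsub>A\<^esub> = cls []"
  by (simp add: A_def raag_altdef presented_group_one)

subsection \<open>Relabelling the generators\<close>

text \<open>An element of \<open>Mgrp\<close> acts as a swap followed by a translation, so the
  residue is shifted by the coordinate on the new sheet. Translations fix every \<open>Zg\<close>
  because the lattice is commutative.\<close>

fun relabel :: "('f \<times> bool \<Rightarrow> int) \<times> bool \<Rightarrow> ('e, 'f) rgen \<Rightarrow> ('e, 'f) rgen" where
  "relabel m (Zg i) = Zg (flip (snd m) i)"
| "relabel m (Tg e r s) = Tg e ((r + fst m (i0 e, s \<noteq> snd m)) mod N) (s \<noteq> snd m)"

lemma relabel_gens: "x \<in> gens \<Longrightarrow> relabel m x \<in> gens"
  using N_pos by (cases x) (auto simp: gens_def)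

lemma relabel_comms:
  assumes "(x, y) \<in> comms" shows "(relabel m x, relabel m y) \<in> comms"
proof -
  have "flip (snd m) i \<noteq> flip (snd m) j" if "i \<noteq> j" for i j :: "'f \<times> bool"
    using that by (auto simp: flip_def prod_eq_iff)
  moreover have "flip (snd m) i \<in> supp e (s \<noteq> snd m)" if "i \<in> supp e s" for i e s
  proof -
    have "flip (s \<noteq> snd m) (flip (snd m) i) = flip s i" by (auto simp: flip_def)
    with that show ?thesis unfolding supp_def mem_Collect_eq by (simp only: not_False_eq_True)
  qed
  ultimately show ?thesis
    using assms relabel_gens [of x m] relabel_gens [of y m] unfolding comms_def by fastforce
qed

lemma relabel_mult: "x \<in> gens \<Longrightarrow> relabel (m \<otimes>\<^bsub>Mgrp\<^esub> n) x = relabel m (relabel n x)"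
  by (cases x; cases "snd m"; cases "snd n") (auto simp: mod_simps algebra_simps)

lemma relabel_one: "x \<in> gens \<Longrightarrow> relabel \<one>\<^bsub>Mgrp\<^esub> x = x"
  by (cases x) (auto simp: gens_def)

definition relabels :: "('f \<times> bool \<Rightarrow> int) \<times> bool \<Rightarrow> ('e, 'f) rgen gword \<Rightarrow> ('e, 'f) rgen gword" where
  "relabels m = map (apfst (relabel m))"

lemma relabels_simps [simp]:
  "relabels m [] = []" "relabels m ((x, b) # w) = (relabel m x, b) # relabels m w"
  "relabels m (u @ v) = relabels m u @ relabels m v"
  by (auto simp: relabels_def)

lemma relabels_gwords: "w \<in> gwords gens \<Longrightarrow> relabels m w \<in> gwords gens"
proof (induction w)
  case (Cons l w)
  then show ?case by (cases l) (auto simp: relabel_gens)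
qed auto

lemma relabels_pres_eq:
  "pres_eq gens (raag_rels comms) u v \<Longrightarrow> pres_eq gens (raag_rels comms) (relabels m u) (relabels m v)"
proof (induction rule: pres_eq.induct)
  case (relation u v r s)
  then have "(relabels m r, relabels m s) \<in> raag_rels comms"
    by (auto simp: raag_rels_def dest: relabel_comms)
  with relation show ?case unfolding relabels_simps by (intro pres_eq.relation relabels_gwords)
next
  case (trans u v w)
  then show ?case by (blast intro: pres_eq.trans)
next
  case (cancel u v x b)
  then show ?case unfolding relabels_simps by (intro pres_eq.cancel relabels_gwords relabel_gens)
qed (auto intro: pres_eq.refl pres_eq.sym relabels_gwords)

definition theta :: "('f \<times> bool \<Rightarrow> int) \<times> bool \<Rightarrow> ('e, 'f) rgen gword set \<Rightarrow> ('e, 'f) rgen gword set" where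
  "theta m a = cls (relabels m (SOME w. w \<in> a))"

lemma theta_cls:
  assumes "w \<in> gwords gens"
  shows "theta m (cls w) = cls (relabels m w)"
  unfolding theta_def
  by (rule pres_class_some [OF assms, where f = "\<lambda>w. cls (relabels m w)"])
    (simp add: pres_class_eq_iff relabels_gwords assms relabels_pres_eq)

lemma carrier_A_cases:
  assumes "a \<in> carrier A" obtains w where "w \<in> gwords gens" "a = cls w"
  using assms by (auto simp: carrier_A)

lemma cls_closed [simp]: "w \<in> gwords gens \<Longrightarrow> cls w \<in> carrier A"
  by (simp add: carrier_A)

lemma theta_hom: "theta m \<in> hom A A"
proof (rule homI)
  fix a b assume "a \<in> carrier A" "b \<in> carrier A"
  then show "theta m (a \<otimes>\<^bsub>A\<^esub> b) = theta m a \<otimes>\<^bsub>A\<^esub> theta m b"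
    by (elim carrier_A_cases) (simp add: cls_mult theta_cls relabels_gwords)
qed (auto elim!: carrier_A_cases simp: theta_cls relabels_gwords)

lemma relabels_mult: "w \<in> gwords gens \<Longrightarrow> relabels (m \<otimes>\<^bsub>Mgrp\<^esub> n) w = relabels m (relabels n w)"
proof (induction w)
  case (Cons l w)
  then show ?case by (cases l) (simp add: relabel_mult del: Mgrp_simps)
qed auto

lemma relabels_one: "w \<in> gwords gens \<Longrightarrow> relabels \<one>\<^bsub>Mgrp\<^esub> w = w"
proof (induction w)
  case (Cons l w)
  then show ?case by (cases l) (simp add: relabel_one del: Mgrp_simps)
qed auto

definition "W = semidirect A Mgrp theta"

sublocale W: group W
  unfolding W_def
proof (rule group_semidirect)
  fix a assume "a \<in> carrier A"
  then show "theta \<one>\<^bsub>Mgrp\<^esub> a = a"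
    by (elim carrier_A_cases) (simp add: theta_cls relabels_one del: Mgrp_simps)
next
  fix m n a assume "a \<in> carrier A"
  then show "theta (m \<otimes>\<^bsub>Mgrp\<^esub> n) a = theta m (theta n a)"
    by (elim carrier_A_cases) (simp add: theta_cls relabels_mult relabels_gwords del: Mgrp_simps)
qed (auto intro: theta_hom group_Mgrp A.is_group)

lemma W_simps [simp]:
  "carrier W = carrier A \<times> UNIV"
  "x \<otimes>\<^bsub>W\<^esub> y = (fst x \<otimes>\<^bsub>A\<^esub> theta (snd x) (fst y), snd x \<otimes>\<^bsub>Mgrp\<^esub> snd y)"
  "\<one>\<^bsub>W\<^esub> = (\<one>\<^bsub>A\<^esub>, \<one>\<^bsub>Mgrp\<^esub>)"
  by (simp_all add: W_def)

subsection \<open>The action on states\<close>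

text \<open>A state \<open>(w, u)\<close> stands for the element \<open>w u\<close> of a semidirect product of a free group with the
  lattice: the conjugates of a stable letter by the lattice are free generators, and they only depend on
  the coordinates outside \<open>supp\<close>, which \<open>mask\<close> retains.\<close>

definition mask :: "'e \<Rightarrow> bool \<Rightarrow> ('f \<times> bool \<Rightarrow> int) \<Rightarrow> 'f \<times> bool \<Rightarrow> int" where
  "mask e s u = (\<lambda>i. if i \<in> supp e s then 0 else u i)"

type_synonym (in -) ('e, 'f) label = "'e \<times> int \<times> bool \<times> ('f \<times> bool \<Rightarrow> int)"

fun st_letter :: "('e, 'f) rgen \<times> bool \<Rightarrow> (('e, 'f) label \<times> bool) list \<times> ('f \<times> bool \<Rightarrow> int) \<Rightarrow>
    (('e, 'f) label \<times> bool) list \<times> ('f \<times> bool \<Rightarrow> int)" where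
  "st_letter (Zg i, b) (w, u) = (w, u(i := u i + (if b then 1 else - 1)))"
| "st_letter (Tg e r s, b) (w, u) = (push ((e, r, s, mask e s u), b) w, u)"

definition "st_word = fold st_letter"

lemma st_word_simps [simp]:
  "st_word [] x = x" "st_word (l # u) x = st_word u (st_letter l x)"
  "st_word (u @ v) x = st_word v (st_word u x)"
  by (simp_all add: st_word_def)

lemma reduced_st_letter: "reduced (fst x) \<Longrightarrow> reduced (fst (st_letter l x))"
  by (cases "(l, x)" rule: st_letter.cases) (auto simp: reduced_push)

lemma reduced_st_word: "reduced (fst x) \<Longrightarrow> reduced (fst (st_word u x))"
  by (induction u arbitrary: x) (auto simp: reduced_st_letter)

text \<open>A lattice generator that commutes with a stable letter changes a coordinate that
  \<open>mask\<close> erases, so the label pushed is the same before and after.\<close>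

lemma st_letter_comm:
  assumes "(x, y) \<in> comms"
  shows "st_letter (y, True) (st_letter (x, True) p) = st_letter (x, True) (st_letter (y, True) p)"
proof -
  obtain w u where p: "p = (w, u)" by (cases p)
  have mask: "mask e s (u(i := k)) = mask e s u" if "i \<in> supp e s" for i e s k
    using that by (auto simp: mask_def)
  from assms show ?thesis
    unfolding comms_def by (auto simp: p mask fun_upd_twist)
qed

lemma st_word_pres_eq:
  assumes "pres_eq gens (raag_rels comms) u v" "reduced (fst x)"
  shows "st_word u x = st_word v x"
  using assms
proof (induction arbitrary: x rule: pres_eq.induct)
  case (cancel u v y b)
  have "st_letter (y, \<not> b) (st_letter (y, b) p) = p" if "reduced (fst p)" for p
    using that by (cases p; cases y) (auto simp: push_push)
  then show ?case using reduced_st_word [OF cancel(4)] by simp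
next
  case (relation u v r s)
  then obtain y z where rs: "r = [(y, True), (z, True)]" "s = [(z, True), (y, True)]" "(y, z) \<in> comms"
    by (auto simp: raag_rels_def)
  then show ?case by (simp add: st_letter_comm)
qed auto

definition st_act where
  "st_act a x = st_word (SOME w. w \<in> a) x"

lemma st_act_cls: "w \<in> gwords gens \<Longrightarrow> reduced (fst x) \<Longrightarrow> st_act (cls w) x = st_word w x"
  unfolding st_act_def by (rule pres_class_some [where f = "\<lambda>w. st_word w x"]) (auto intro: st_word_pres_eq)

text \<open>A right action of the semidirect product: the second component accumulates the
  \<open>Mgrp\<close> parts and twists the \<open>A\<close> part of every later factor.\<close>

definition W_act where
  "W_act a x = (st_act (theta (snd x) (fst a)) (fst x), snd x \<otimes>\<^bsub>Mgrp\<^esub> snd a)"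

lemma W_act_cls:
  assumes "w \<in> gwords gens" "reduced (fst (fst x))"
  shows "W_act (cls w, m) x = (st_word (relabels (snd x) w) (fst x), snd x \<otimes>\<^bsub>Mgrp\<^esub> m)"
  using assms by (simp add: W_act_def theta_cls st_act_cls relabels_gwords)

lemma carrier_W_cases:
  assumes "a \<in> carrier W" obtains w m where "w \<in> gwords gens" "a = (cls w, m)"
  using assms by (cases a) (auto elim: carrier_A_cases)

lemma reduced_W_act:
  "a \<in> carrier W \<Longrightarrow> reduced (fst (fst x)) \<Longrightarrow> reduced (fst (fst (W_act a x)))"
  by (erule carrier_W_cases) (simp add: W_act_cls reduced_st_word)

lemma W_act_mult:
  assumes "a \<in> carrier W" "b \<in> carrier W" "reduced (fst (fst x))"
  shows "W_act (a \<otimes>\<^bsub>W\<^esub> b) x = W_act b (W_act a x)"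
proof -
  obtain u m where a: "u \<in> gwords gens" "a = (cls u, m)" using assms(1) by (rule carrier_W_cases)
  obtain v n where b: "v \<in> gwords gens" "b = (cls v, n)" using assms(2) by (rule carrier_W_cases)
  note ab = a b
  interpret M: group "Mgrp :: (('f \<times> bool \<Rightarrow> int) \<times> bool) monoid" by (rule group_Mgrp)
  have "a \<otimes>\<^bsub>W\<^esub> b = (cls (u @ relabels m v), m \<otimes>\<^bsub>Mgrp\<^esub> n)"
    using ab by (simp add: theta_cls cls_mult relabels_gwords)
  moreover have "snd x \<otimes>\<^bsub>Mgrp\<^esub> (m \<otimes>\<^bsub>Mgrp\<^esub> n) = snd x \<otimes>\<^bsub>Mgrp\<^esub> m \<otimes>\<^bsub>Mgrp\<^esub> n"
    by (rule M.m_assoc [symmetric]) auto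
  ultimately show ?thesis
    using ab assms(3) by (simp add: W_act_cls relabels_gwords relabels_mult [symmetric] reduced_st_word del: Mgrp_simps)
qed

lemma W_act_one:
  assumes "reduced (fst (fst x))"
  shows "W_act \<one>\<^bsub>W\<^esub> x = x"
  using assms by (simp add: one_A W_act_cls prod_eq_iff)

end

section \<open>Paths without backtracking and their images in the target group\<close>

section \<open>Groups generated by lattices along a graph\<close>

lemma (in group) additive_zmult:
  assumes "\<And>z. f z \<in> carrier G" "\<And>z z'. f (z + z') = f z \<otimes> f z'"
  shows "f (zmult k z) = f z [^] k"
proof -
  have "(\<lambda>k. f (zmult k z)) \<in> hom integer_group G"
    using assms(1) by (intro homI) (auto simp: assms(2) [symmetric] zmult_def algebra_simps)
  then interpret h: group_hom integer_group G "\<lambda>k. f (zmult k z)"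
    by (simp add: group_hom_def group_hom_axioms_def)
  have "f (zmult (1 [^]\<^bsub>integer_group\<^esub> k) z) = f (zmult 1 z) [^] k"
    by (rule h.hom_int_pow) simp
  then show ?thesis by (simp add: zmult_def)
qed

text \<open>The relations of a graph of lattices are required to hold, not to be defining. The
  fundamental group, its image in \<open>W\<close> and a group of affine maps of the rational line
  are all treated as models.\<close>

locale lattice_graph_group = group G for G :: "'g monoid" (structure) +
  fixes Vs :: "'v set" and Ep :: "'e set" and src tgt :: "'e \<Rightarrow> 'v" and pt ph :: "'e \<Rightarrow> int \<times> int"
    and vx :: "'v \<Rightarrow> int \<times> int \<Rightarrow> 'g" and st :: "'e \<Rightarrow> 'g"
  assumes ends: "e \<in> Ep \<Longrightarrow> src e \<in> Vs" "e \<in> Ep \<Longrightarrow> tgt e \<in> Vs"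
    and vx_closed [simp]: "v \<in> Vs \<Longrightarrow> vx v z \<in> carrier G"
    and vx_add: "v \<in> Vs \<Longrightarrow> vx v (z + z') = vx v z \<otimes> vx v z'"
    and st_closed [simp]: "e \<in> Ep \<Longrightarrow> st e \<in> carrier G"
    and st_rel: "e \<in> Ep \<Longrightarrow> st e \<otimes> vx (tgt e) (ph e) = vx (src e) (pt e) \<otimes> st e"
begin

lemma vx_zero: "v \<in> Vs \<Longrightarrow> vx v 0 = \<one>"
  using vx_add [of v 0 0] by simp

lemma vx_zmult: "v \<in> Vs \<Longrightarrow> vx v (zmult k z) = vx v z [^] k"
  by (rule additive_zmult) (auto simp: vx_add)

definition arc_src :: "'e \<times> bool \<Rightarrow> 'v" where "arc_src a = (if snd a then src (fst a) else tgt (fst a))"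
definition arc_tgt :: "'e \<times> bool \<Rightarrow> 'v" where "arc_tgt a = (if snd a then tgt (fst a) else src (fst a))"
definition arc_vec :: "'e \<times> bool \<Rightarrow> int \<times> int" where "arc_vec a = (if snd a then pt (fst a) else ph (fst a))"
definition arc_val :: "'e \<times> bool \<Rightarrow> 'g" where "arc_val a = (if snd a then st (fst a) else inv (st (fst a)))"
definition arc_rev :: "'e \<times> bool \<Rightarrow> 'e \<times> bool" where "arc_rev a = (fst a, \<not> snd a)"

lemma arc_rev_simps [simp]:
  "arc_src (arc_rev a) = arc_tgt a" "arc_tgt (arc_rev a) = arc_src a" "fst (arc_rev a) = fst a"
  by (auto simp: arc_src_def arc_tgt_def arc_rev_def)

lemma arc_ends: "fst a \<in> Ep \<Longrightarrow> arc_src a \<in> Vs" "fst a \<in> Ep \<Longrightarrow> arc_tgt a \<in> Vs"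
  by (auto simp: arc_src_def arc_tgt_def ends)

lemma arc_val_closed [simp]: "fst a \<in> Ep \<Longrightarrow> arc_val a \<in> carrier G"
  by (auto simp: arc_val_def)

lemma arc_val_rev: "fst a \<in> Ep \<Longrightarrow> arc_val (arc_rev a) = inv (arc_val a)"
  by (auto simp: arc_val_def arc_rev_def)

text \<open>The relation for an edge yields, by inversion and by powers, the one for both directions
  and for all multiples of the edge vector.\<close>

lemma arc_rel:
  assumes a: "fst a \<in> Ep"
  shows "arc_val a \<otimes> vx (arc_tgt a) (zmult k (arc_vec (arc_rev a))) \<otimes> inv (arc_val a) =
    vx (arc_src a) (zmult k (arc_vec a))"
proof -
  let ?s = "st (fst a)" and ?p = "vx (src (fst a)) (pt (fst a))" and ?q = "vx (tgt (fst a)) (ph (fst a))"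
  have c: "?s \<in> carrier G" "?p \<in> carrier G" "?q \<in> carrier G" using a ends by auto
  have "?s \<otimes> ?q \<otimes> inv ?s = ?p"
    using st_rel [OF a] c by (simp add: inv_solve_right')
  moreover from this have "inv ?s \<otimes> ?p \<otimes> inv (inv ?s) = ?q"
    using c by (metis inv_inv inv_solve_left' inv_solve_right' m_assoc m_closed inv_closed)
  ultimately have "arc_val a \<otimes> vx (arc_tgt a) (arc_vec (arc_rev a)) \<otimes> inv (arc_val a) = vx (arc_src a) (arc_vec a)"
    by (cases a) (auto simp: arc_val_def arc_tgt_def arc_src_def arc_vec_def arc_rev_def)
  then show ?thesis
    using a conj_int_pow [of "arc_val a" "vx (arc_tgt a) (arc_vec (arc_rev a))" k]
    by (simp add: vx_zmult arc_ends)
qed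

fun is_path :: "'v \<Rightarrow> ((int \<times> int) \<times> 'e \<times> bool) list \<Rightarrow> 'v \<Rightarrow> bool" where
  "is_path v [] w \<longleftrightarrow> v = w"
| "is_path v ((y, a) # p) w \<longleftrightarrow> fst a \<in> Ep \<and> arc_src a = v \<and> is_path (arc_tgt a) p w"

fun path_val :: "'v \<Rightarrow> ((int \<times> int) \<times> 'e \<times> bool) list \<Rightarrow> int \<times> int \<Rightarrow> 'g" where
  "path_val v [] z = vx v z"
| "path_val v ((y, a) # p) z = vx v y \<otimes> (arc_val a \<otimes> path_val (arc_tgt a) p z)"

text \<open>Britton's condition: the path never crosses an arc and at once returns along it with
  only an element of the edge group in between.\<close>

fun reduced_path :: "((int \<times> int) \<times> 'e \<times> bool) list \<Rightarrow> bool" where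
  "reduced_path ((y, a) # (y', a') # p) \<longleftrightarrow>
     \<not> (a' = arc_rev a \<and> (\<exists>k. y' = zmult k (arc_vec a'))) \<and> reduced_path ((y', a') # p)"
| "reduced_path p \<longleftrightarrow> True"

lemma path_ends: "is_path v p w \<Longrightarrow> v \<in> Vs \<or> w \<in> Vs \<Longrightarrow> v \<in> Vs \<and> w \<in> Vs"
  by (induction v p w rule: is_path.induct) (auto simp: arc_ends)

lemma path_val_closed: "is_path v p w \<Longrightarrow> v \<in> Vs \<Longrightarrow> path_val v p z \<in> carrier G"
  by (induction v p w rule: is_path.induct) (auto simp: arc_ends)

lemma absorb:
  assumes "is_path v p w" "v \<in> Vs"
  shows "\<exists>p' z'. is_path v p' w \<and> length p' = length p \<and> path_val v p' z' = vx v y \<otimes> path_val v p z"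
proof (cases p)
  case Nil
  then show ?thesis using assms by (intro exI [of _ "[]"] exI [of _ "y + z"]) (auto simp: vx_add)
next
  case (Cons l q)
  obtain x a where l: "l = (x, a)" by (cases l)
  then show ?thesis
    using Cons assms arc_ends path_val_closed [of "arc_tgt a" q w z]
    by (intro exI [of _ "(y + x, a) # q"] exI [of _ z]) (auto simp: vx_add m_assoc)
qed

lemma shorten:
  assumes "is_path v p w" "v \<in> Vs" "\<not> reduced_path p"
  shows "\<exists>p' z'. is_path v p' w \<and> length p' < length p \<and> path_val v p' z' = path_val v p z"
  using assms
proof (induction p arbitrary: v rule: reduced_path.induct)
  case (1 y a y' a' p)
  have a: "fst a \<in> Ep" "fst a' \<in> Ep" "arc_src a = v" "arc_src a' = arc_tgt a" "is_path (arc_tgt a') p w"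
    using 1(2) by auto
  have Vs: "arc_tgt a \<in> Vs" "arc_tgt a' \<in> Vs" using arc_ends a by auto
  have pc: "path_val (arc_tgt a') p z \<in> carrier G" using path_val_closed a(5) Vs(2) .
  show ?case
  proof (cases "reduced_path ((y', a') # p)")
    case True
    then obtain k where k: "a' = arc_rev a" "y' = zmult k (arc_vec a')" using 1(4) by auto
    define q where "q = path_val v p z"
    have q: "q \<in> carrier G" "path_val (arc_tgt a') p z = q" using pc k a by (auto simp: q_def)
    define b where "b = arc_val a"
    have b: "b \<in> carrier G" "arc_val a' = inv b" using a k by (auto simp: b_def arc_val_rev)
    define c where "c = vx (arc_tgt a) y'"
    have c: "c \<in> carrier G" using Vs by (simp add: c_def)
    have "vx v y \<otimes> (b \<otimes> (c \<otimes> (inv b \<otimes> q))) = vx v y \<otimes> ((b \<otimes> c \<otimes> inv b) \<otimes> q)"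
      using b c q 1(3) by (simp add: m_assoc)
    also have "b \<otimes> c \<otimes> inv b = vx v (zmult k (arc_vec a))"
      using arc_rel [OF a(1), of k] a k by (simp add: b_def c_def)
    finally have *: "path_val v ((y, a) # (y', a') # p) z = vx v y \<otimes> (vx v (zmult k (arc_vec a)) \<otimes> q)"
      using q(2) b by (simp add: b_def [symmetric] c_def [symmetric])
    have "is_path v p w" using a k by simp
    then obtain p1 z1 where p1: "is_path v p1 w" "length p1 = length p"
      "path_val v p1 z1 = vx v (zmult k (arc_vec a)) \<otimes> q"
      using absorb [of v p w "zmult k (arc_vec a)" z] 1(3) unfolding q_def by blast
    obtain p2 z2 where p2: "is_path v p2 w" "length p2 = length p1" "path_val v p2 z2 = vx v y \<otimes> path_val v p1 z1"
      using absorb [OF p1(1) 1(3), of y z1] by blast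
    show ?thesis
      using p1 p2 * by (intro exI [of _ p2] exI [of _ z2]) auto
  next
    case False
    then obtain p' z' where p': "is_path (arc_tgt a) p' w" "length p' < length ((y', a') # p)"
      "path_val (arc_tgt a) p' z' = path_val (arc_tgt a) ((y', a') # p) z"
      using 1(1) [of "arc_tgt a"] 1(2) Vs by auto
    then show ?thesis using a by (intro exI [of _ "(y, a) # p'"] exI [of _ z']) auto
  qed
qed auto

lemma reduced_path_ex:
  assumes "is_path v p w" "v \<in> Vs"
  shows "\<exists>p' z'. is_path v p' w \<and> reduced_path p' \<and> path_val v p' z' = path_val v p z"
  using assms(1)
proof (induction "length p" arbitrary: p z rule: less_induct)
  case less
  show ?case
  proof (cases "reduced_path p")
    case False
    then obtain p' z' where "is_path v p' w" "length p' < length p" "path_val v p' z' = path_val v p z"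
      using shorten [OF less(2) assms(2)] by blast
    then show ?thesis using less(1) [of p' z'] by metis
  qed (use less(2) in blast)
qed

lemma path_val_append:
  assumes "is_path u p v" "is_path v q w" "u \<in> Vs"
  shows "\<exists>r z'. is_path u r w \<and> path_val u r z' = path_val u p y \<otimes> path_val v q z"
  using assms
proof (induction u p v rule: is_path.induct)
  case (1 v w')
  then show ?case using absorb [of v q w y z] by auto
next
  case (2 u x a p v)
  then have "arc_tgt a \<in> Vs" using arc_ends by auto
  with 2 obtain r z' where r: "is_path (arc_tgt a) r w"
    "path_val (arc_tgt a) r z' = path_val (arc_tgt a) p y \<otimes> path_val v q z" by auto
  have "path_val (arc_tgt a) p y \<in> carrier G" "path_val v q z \<in> carrier G"
    using 2(2,3) \<open>arc_tgt a \<in> Vs\<close> path_ends [of "arc_tgt a" p v]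
    by (auto intro!: path_val_closed)
  then show ?case
    using r 2 by (intro exI [of _ "(x, a) # r"] exI [of _ z']) (auto simp: m_assoc)
qed

end

context raag_target
begin

subsection \<open>Lattices in the target group\<close>

definition zl :: "'f \<times> bool \<Rightarrow> int \<Rightarrow> ('e, 'f) rgen gword" where
  "zl i n = replicate (nat \<bar>n\<bar>) (Zg i, 0 \<le> n)"

definition zword :: "'f list \<Rightarrow> ('f \<times> bool \<Rightarrow> int) \<Rightarrow> ('e, 'f) rgen gword" where
  "zword fs u = concat (map (\<lambda>f. zl (f, False) (u (f, False)) @ zl (f, True) (u (f, True))) fs)"

lemma zword_simps [simp]:
  "zword [] u = []"
  "zword (f # fs) u = zl (f, False) (u (f, False)) @ zl (f, True) (u (f, True)) @ zword fs u"
  by (simp_all add: zword_def)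

lemma zl_gwords: "fst i \<in> set F \<Longrightarrow> zl i n \<in> gwords gens"
  by (cases i) (auto simp: zl_def gwords_def gens_def)

lemma zword_gwords: "set fs \<subseteq> set F \<Longrightarrow> zword fs u \<in> gwords gens"
  by (induction fs) (auto simp: zl_gwords)

lemma Zg_gens: "fst i \<in> set F \<Longrightarrow> Zg i \<in> gens"
  by (cases i) (auto simp: gens_def)

lemma cls_zl:
  assumes i: "fst i \<in> set F"
  shows "cls (zl i n) = gen (Zg i) [^]\<^bsub>A\<^esub> n"
proof -
  have g: "Zg i \<in> gens" using i by (rule Zg_gens)
  have inv: "cls [(Zg i, False)] = inv\<^bsub>A\<^esub> (gen (Zg i))"
    using presented_group_letter_inv [OF g] by (simp add: gen_def A_def raag_altdef)
  have rep: "replicate k (Zg i, b) \<in> gwords gens" for k b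
    using g by (auto simp: gwords_def)
  have nat: "cls (replicate k (Zg i, b)) = (if b then gen (Zg i) else inv\<^bsub>A\<^esub> (gen (Zg i))) [^]\<^bsub>A\<^esub> k" for k :: nat and b
  proof (induction k)
    case (Suc k)
    have "cls (replicate (Suc k) (Zg i, b)) = cls (replicate k (Zg i, b)) \<otimes>\<^bsub>A\<^esub> cls [(Zg i, b)]"
      using g rep by (simp add: cls_mult replicate_append_same)
    also have "cls [(Zg i, b)] = (if b then gen (Zg i) else inv\<^bsub>A\<^esub> (gen (Zg i)))"
      using inv by (simp add: gen_def)
    finally show ?case using Suc by simp
  qed (simp add: one_A)
  show ?thesis
  proof (cases n rule: int_cases2)
    case (nonneg k)
    then show ?thesis using nat [of k True] by (simp add: zl_def int_pow_int)
  next
    case (nonpos k)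
    show ?thesis
    proof (cases "k = 0")
      case False
      then show ?thesis
        using nat [of k False] g A.nat_pow_inv [of "gen (Zg i)" k]
        by (simp add: zl_def nonpos A.int_pow_neg int_pow_int)
    qed (simp add: zl_def nonpos one_A)
  qed
qed

lemma comms_Zg_Zg: "fst i \<in> set F \<Longrightarrow> fst j \<in> set F \<Longrightarrow> i \<noteq> j \<Longrightarrow> (Zg i, Zg j) \<in> comms"
  unfolding comms_def by (blast intro: Zg_gens)

lemma comms_Tg_Zg: "fst i \<in> set F \<Longrightarrow> Tg e r s \<in> gens \<Longrightarrow> i \<in> supp e s \<Longrightarrow> (Tg e r s, Zg i) \<in> comms"
  unfolding comms_def by (blast intro: Zg_gens)

lemma gen_Zg_commute:
  assumes "fst i \<in> set F" "fst j \<in> set F"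
  shows "gen (Zg i) \<otimes>\<^bsub>A\<^esub> gen (Zg j) = gen (Zg j) \<otimes>\<^bsub>A\<^esub> gen (Zg i)"
proof (cases "i = j")
  case False
  with assms show ?thesis by (intro gen_commute comms_Zg_Zg Zg_gens)
qed simp

lemma cls_zl_zl:
  assumes "fst i \<in> set F" "fst j \<in> set F"
  shows "cls (zl i n) \<otimes>\<^bsub>A\<^esub> cls (zl j m) = cls (zl j m) \<otimes>\<^bsub>A\<^esub> cls (zl i n)"
  unfolding cls_zl [OF assms(1)] cls_zl [OF assms(2)]
  using assms by (intro A.int_pow_commute gen_Zg_commute gen_closed Zg_gens)

lemma cls_zl_commute:
  assumes "x \<in> carrier A" "fst i \<in> set F"
    and "n = 0 \<or> x \<otimes>\<^bsub>A\<^esub> gen (Zg i) = gen (Zg i) \<otimes>\<^bsub>A\<^esub> x"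
  shows "x \<otimes>\<^bsub>A\<^esub> cls (zl i n) = cls (zl i n) \<otimes>\<^bsub>A\<^esub> x"
  using assms A.int_pow_commute [of x "gen (Zg i)" 1 n]
  by (auto simp: cls_zl Zg_gens)

text \<open>A generator with exponent 0 contributes the empty word, so it may fail to commute with
  \<open>x\<close>. This is how a stable letter relates to the forms vanishing on its edge
  group.\<close>

lemma cls_zword_commute:
  assumes "x \<in> carrier A" "set fs \<subseteq> set F"
    and "\<And>i. fst i \<in> set fs \<Longrightarrow> u i = 0 \<or> x \<otimes>\<^bsub>A\<^esub> gen (Zg i) = gen (Zg i) \<otimes>\<^bsub>A\<^esub> x"
  shows "x \<otimes>\<^bsub>A\<^esub> cls (zword fs u) = cls (zword fs u) \<otimes>\<^bsub>A\<^esub> x"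
  using assms(2,3)
proof (induction fs)
  case (Cons f fs)
  have comm: "x \<otimes>\<^bsub>A\<^esub> (a \<otimes>\<^bsub>A\<^esub> b) = (a \<otimes>\<^bsub>A\<^esub> b) \<otimes>\<^bsub>A\<^esub> x"
    if "a \<in> carrier A" "b \<in> carrier A" "x \<otimes>\<^bsub>A\<^esub> a = a \<otimes>\<^bsub>A\<^esub> x" "x \<otimes>\<^bsub>A\<^esub> b = b \<otimes>\<^bsub>A\<^esub> x" for a b
  proof -
    have "x \<otimes>\<^bsub>A\<^esub> (a \<otimes>\<^bsub>A\<^esub> b) = (x \<otimes>\<^bsub>A\<^esub> a) \<otimes>\<^bsub>A\<^esub> b" using that(1,2) assms(1) by (simp only: A.m_assoc)
    also have "\<dots> = a \<otimes>\<^bsub>A\<^esub> (x \<otimes>\<^bsub>A\<^esub> b)" unfolding that(3) using that(1,2) assms(1) by (simp only: A.m_assoc)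
    also have "\<dots> = (a \<otimes>\<^bsub>A\<^esub> b) \<otimes>\<^bsub>A\<^esub> x" unfolding that(4) using that(1,2) assms(1) by (simp only: A.m_assoc)
    finally show ?thesis .
  qed
  have eq: "cls (zword (f # fs) u) =
      cls (zl (f, False) (u (f, False))) \<otimes>\<^bsub>A\<^esub> (cls (zl (f, True) (u (f, True))) \<otimes>\<^bsub>A\<^esub> cls (zword fs u))"
    using Cons.prems(1) by (simp add: cls_mult zl_gwords zword_gwords)
  show ?case
    unfolding eq using Cons.prems Cons.IH assms(1)
    by (intro comm cls_zl_commute A.m_closed cls_closed zl_gwords zword_gwords) auto
qed (use assms(1) in \<open>simp add: one_A [symmetric]\<close>)

lemma gen_Zg_zword:
  "fst i \<in> set F \<Longrightarrow> set fs \<subseteq> set F \<Longrightarrow>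
    cls (zl i n) \<otimes>\<^bsub>A\<^esub> cls (zword fs u) = cls (zword fs u) \<otimes>\<^bsub>A\<^esub> cls (zl i n)"
  using cls_zl_commute [of "gen (Zg j)" i n for j]
  by (intro cls_zword_commute disjI2) (auto simp: zl_gwords gen_Zg_commute Zg_gens subset_iff)

lemma cls_zl_add:
  "fst i \<in> set F \<Longrightarrow> cls (zl i (n + m)) = cls (zl i n) \<otimes>\<^bsub>A\<^esub> cls (zl i m)"
  by (simp add: cls_zl A.int_pow_mult Zg_gens)

lemma cls_zword_add:
  assumes "set fs \<subseteq> set F"
  shows "cls (zword fs (\<lambda>i. u i + v i)) = cls (zword fs u) \<otimes>\<^bsub>A\<^esub> cls (zword fs v)"
  using assms
proof (induction fs)
  case (Cons f fs)
  define a b where "a = (\<lambda>w :: 'f \<times> bool \<Rightarrow> int. cls (zl (f, False) (w (f, False))))"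
    and "b = (\<lambda>w :: 'f \<times> bool \<Rightarrow> int. cls (zl (f, True) (w (f, True))))"
  define c where "c = (\<lambda>w. cls (zword fs w))"
  have eq: "cls (zword (f # fs) w) = a w \<otimes>\<^bsub>A\<^esub> (b w \<otimes>\<^bsub>A\<^esub> c w)" for w
    using Cons.prems by (simp add: cls_mult zl_gwords zword_gwords a_def b_def c_def)
  have closed: "a w \<in> carrier A" "b w \<in> carrier A" "c w \<in> carrier A" for w
    using Cons.prems by (auto simp: a_def b_def c_def zl_gwords zword_gwords)
  have add: "a (\<lambda>i. u i + v i) = a u \<otimes>\<^bsub>A\<^esub> a v" "b (\<lambda>i. u i + v i) = b u \<otimes>\<^bsub>A\<^esub> b v"
    "c (\<lambda>i. u i + v i) = c u \<otimes>\<^bsub>A\<^esub> c v"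
    using Cons by (auto simp: a_def b_def c_def cls_zl_add)
  have ab: "b u \<otimes>\<^bsub>A\<^esub> a v = a v \<otimes>\<^bsub>A\<^esub> b u"
    unfolding a_def b_def using Cons.prems by (intro cls_zl_zl) auto
  have ac: "c u \<otimes>\<^bsub>A\<^esub> a v = a v \<otimes>\<^bsub>A\<^esub> c u" "c u \<otimes>\<^bsub>A\<^esub> b v = b v \<otimes>\<^bsub>A\<^esub> c u"
    unfolding a_def b_def c_def using Cons.prems by (auto intro!: gen_Zg_zword [symmetric])
  have "(a u \<otimes>\<^bsub>A\<^esub> (b u \<otimes>\<^bsub>A\<^esub> c u)) \<otimes>\<^bsub>A\<^esub> (a v \<otimes>\<^bsub>A\<^esub> (b v \<otimes>\<^bsub>A\<^esub> c v)) =
      a u \<otimes>\<^bsub>A\<^esub> (b u \<otimes>\<^bsub>A\<^esub> ((c u \<otimes>\<^bsub>A\<^esub> a v) \<otimes>\<^bsub>A\<^esub> (b v \<otimes>\<^bsub>A\<^esub> c v)))"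
    using closed by (simp add: A.m_assoc)
  also have "\<dots> = a u \<otimes>\<^bsub>A\<^esub> ((b u \<otimes>\<^bsub>A\<^esub> a v) \<otimes>\<^bsub>A\<^esub> ((c u \<otimes>\<^bsub>A\<^esub> b v) \<otimes>\<^bsub>A\<^esub> c v))"
    unfolding ac(1) using closed by (simp add: A.m_assoc)
  also have "\<dots> = (a u \<otimes>\<^bsub>A\<^esub> a v) \<otimes>\<^bsub>A\<^esub> ((b u \<otimes>\<^bsub>A\<^esub> b v) \<otimes>\<^bsub>A\<^esub> (c u \<otimes>\<^bsub>A\<^esub> c v))"
    unfolding ab ac(2) using closed by (simp add: A.m_assoc)
  finally show ?case unfolding eq add by simp
qed (simp add: one_A [symmetric])

lemma relabels_zl: "relabels m (zl i n) = zl (flip (snd m) i) n"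
  by (simp add: relabels_def zl_def)

lemma theta_zword:
  assumes "set fs \<subseteq> set F"
  shows "theta m (cls (zword fs u)) = cls (zword fs (\<lambda>i. u (flip (snd m) i)))"
proof -
  have "cls (relabels m (zword fs u)) = cls (zword fs (\<lambda>i. u (flip (snd m) i)))"
    using assms
  proof (induction fs)
    case (Cons f fs)
    have comm: "cls (zl (f, True) k @ zl (f, False) l) = cls (zl (f, False) l @ zl (f, True) k)" for k l
      using Cons.prems cls_zl_zl [of "(f, True)" "(f, False)" k l] by (simp add: cls_mult zl_gwords)
    let ?s = "snd m"
    have "cls (relabels m (zword (f # fs) u)) =
        cls (zl (f, ?s) (u (f, False)) @ zl (f, \<not> ?s) (u (f, True))) \<otimes>\<^bsub>A\<^esub> cls (relabels m (zword fs u))"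
      using Cons.prems by (simp add: cls_mult zl_gwords zword_gwords relabels_zl relabels_gwords)
    also have "cls (zl (f, ?s) (u (f, False)) @ zl (f, \<not> ?s) (u (f, True))) =
        cls (zl (f, False) (u (f, ?s)) @ zl (f, True) (u (f, \<not> ?s)))"
      using comm by (cases ?s) auto
    finally show ?case
      using Cons by (simp add: cls_mult zl_gwords zword_gwords)
  qed auto
  then show ?thesis using assms by (simp add: theta_cls zword_gwords)
qed

lemma st_word_zl: "st_word (zl i n) (w, u) = (w, u(i := u i + n))"
proof -
  have "st_word (replicate k (Zg i, b)) (w, u) = (w, u(i := u i + (if b then int k else - int k)))" for k b u
    by (induction k arbitrary: u) (auto simp: fun_eq_iff)
  from this [of "nat \<bar>n\<bar>" "0 \<le> n"] show ?thesis by (simp add: zl_def)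
qed

lemma st_word_zword:
  assumes "distinct fs"
  shows "st_word (relabels m (zword fs v)) (w, u) =
    (w, \<lambda>i. u i + (if fst i \<in> set fs then v (flip (snd m) i) else 0))"
  using assms
proof (induction fs arbitrary: u)
  case (Cons f fs)
  then show ?case
    by (cases "snd m") (auto simp: relabels_zl st_word_zl fun_eq_iff flip_def)
qed auto

text \<open>The component in \<open>A\<close> detects the lattice element after projection to
  \<open>A\<close>; the component in \<open>Mgrp\<close> shifts the residues of the stable letters
  that follow.\<close>

definition Lw :: "'v \<Rightarrow> int \<times> int \<Rightarrow> ('e, 'f) rgen gword set \<times> ('f \<times> bool \<Rightarrow> int) \<times> bool" where
  "Lw v z = (cls (zword F (lam v z)), (lam v z, False))"

definition Tw :: "'e \<Rightarrow> ('e, 'f) rgen gword set \<times> ('f \<times> bool \<Rightarrow> int) \<times> bool" where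
  "Tw e = (cls [(Tg e 0 False, True)], (\<lambda>i. 0, sg e))"

lemma Tg_gens: "e \<in> Ep \<Longrightarrow> 0 \<le> r \<Longrightarrow> r < N \<Longrightarrow> Tg e r s \<in> gens"
  by (auto simp: gens_def)

lemma Lw_closed: "Lw v z \<in> carrier W"
  by (simp add: Lw_def zword_gwords)

lemma Tw_closed: "e \<in> Ep \<Longrightarrow> Tw e \<in> carrier W"
  using N_pos by (simp add: Tw_def Tg_gens)

lemma Lw_add: "Lw v (z + z') = Lw v z \<otimes>\<^bsub>W\<^esub> Lw v z'"
proof -
  have "lam v (z + z') = (\<lambda>i. lam v z i + lam v z' i)" by (auto simp: lam_add)
  then show ?thesis by (simp add: Lw_def theta_zword cls_zword_add)
qed

text \<open>The edge vector has value \<open>N\<close> under the form \<open>i0 e\<close>, so it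
  shifts the residue 0 of the stable letter to itself. The generators in its word commute with that
  letter, and the sheet change of \<open>e\<close> carries coordinates at the target to those at the
  source.\<close>

lemma Tw_rel:
  assumes e: "e \<in> Ep"
  shows "Tw e \<otimes>\<^bsub>W\<^esub> Lw (tgt e) (ph e) = Lw (src e) (pt e) \<otimes>\<^bsub>W\<^esub> Tw e"
proof -
  define x where "x = gen (Tg e 0 False)"
  have Tg: "Tg e 0 False \<in> gens" using e N_pos by (simp add: Tg_gens)
  have x: "x \<in> carrier A" "cls [(Tg e 0 False, True)] = x" using Tg by (auto simp: x_def gen_def)
  have lam: "lam (src e) (pt e) = (\<lambda>i. lam (tgt e) (ph e) (flip (sg e) i))"
    using lam_edge [OF e] by auto
  have "lam (src e) (pt e) (i0 e, False) = N" using i0 ell_i0 e by (simp add: lam_def)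
  then have theta: "theta (lam (src e) (pt e), False) x = x"
    using Tg by (simp add: x(2) [symmetric] theta_cls)
  have "x \<otimes>\<^bsub>A\<^esub> cls (zword F (lam (src e) (pt e))) = cls (zword F (lam (src e) (pt e))) \<otimes>\<^bsub>A\<^esub> x"
  proof (rule cls_zword_commute)
    fix i :: "'f \<times> bool" assume "fst i \<in> set F"
    then have "x \<otimes>\<^bsub>A\<^esub> gen (Zg i) = gen (Zg i) \<otimes>\<^bsub>A\<^esub> x" if "lam (src e) (pt e) i \<noteq> 0"
      using Tg that unfolding x_def
      by (intro gen_commute comms_Tg_Zg Zg_gens) (auto simp: supp_def)
    then show "lam (src e) (pt e) i = 0 \<or> x \<otimes>\<^bsub>A\<^esub> gen (Zg i) = gen (Zg i) \<otimes>\<^bsub>A\<^esub> x" by blast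
  qed (use x in auto)
  then show ?thesis
    by (simp add: Tw_def Lw_def x(2) theta theta_zword lam [symmetric])
qed

end

text \<open>\<open>raag_target\<close> carries no vertex set; the endpoints of the edges take its
  place.\<close>

sublocale raag_target \<subseteq> Wp: lattice_graph_group W "src ` Ep \<union> tgt ` Ep" Ep src tgt pt ph Lw Tw
  by unfold_locales (use Lw_closed Tw_closed Lw_add Tw_rel in \<open>auto simp del: W_simps\<close>)

context raag_target
begin

subsection \<open>Reduced paths act without cancellation\<close>

text \<open>The letter pushed when \<open>a\<close> is crossed in coordinate \<open>u\<close> on
  sheet \<open>s\<close>. Labels refer to the sheet at the source of the edge, so crossing the same
  lift of an edge backwards, with the same \<open>u\<close>, pushes the inverse letter.\<close>

definition arc_letter :: "'e \<times> bool \<Rightarrow> ('f \<times> bool \<Rightarrow> int) \<Rightarrow> bool \<Rightarrow> ('e, 'f) label \<times> bool" where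
  "arc_letter a u s = (let e = fst a; t = (if snd a then s else s \<noteq> sg e)
     in ((e, u (i0 e, t) mod N, t, mask e t u), snd a))"

text \<open>States along a path carry the coordinate \<open>u\<close> twice, once moved by the
  \<open>A\<close> part and once as accumulated \<open>Mgrp\<close> part; lattice elements move both
  alike.\<close>

lemma W_act_Lw:
  assumes "reduced w"
  shows "W_act (Lw v z) ((w, u), (u, s)) =
    ((w, \<lambda>i. u i + lam v z (flip s i)), (\<lambda>i. u i + lam v z (flip s i), s))"
  using assms distinct_F unfolding Lw_def
  by (subst W_act_cls) (auto simp: zword_gwords st_word_zword lam_def fun_eq_iff)

lemma W_act_Tw:
  assumes "reduced w" "e \<in> Ep"
  shows "W_act (Tw e) ((w, u), (u, s)) = ((push (arc_letter (e, True) u s) w, u), (u, s \<noteq> sg e))"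
  using assms N_pos unfolding Tw_def
  by (subst W_act_cls) (auto simp: Tg_gens arc_letter_def)

lemma W_act_arc:
  assumes w: "reduced w" and a: "fst a \<in> Ep"
  shows "W_act (Wp.arc_val a) ((w, u), (u, s)) = ((push (arc_letter a u s) w, u), (u, s \<noteq> sg (fst a)))"
proof (cases "snd a")
  case True
  then show ?thesis using W_act_Tw [OF assms] by (cases a) (auto simp: Wp.arc_val_def)
next
  case False
  then obtain e where e: "a = (e, False)" "e \<in> Ep" using a by (cases a) auto
  define s' where "s' = (s \<noteq> sg e)"
  have s: "s = (s' \<noteq> sg e)" by (auto simp: s'_def)
  \<comment> \<open>\<open>x\<close> is the claimed result; the forward arc sends it back to the
    original state, so the inverse arc produces it.\<close>
  define x where "x = ((push (arc_letter a u s) w, u), (u, s'))"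
  have rx: "reduced (fst (fst x))" using w by (simp add: x_def reduced_push)
  have "arc_letter a u s = ((e, u (i0 e, s') mod N, s', mask e s' u), False)"
    "arc_letter (e, True) u s' = ((e, u (i0 e, s') mod N, s', mask e s' u), True)"
    by (simp_all add: arc_letter_def Let_def e s'_def)
  then have "push (arc_letter (e, True) u s') (push (arc_letter a u s) w) = w"
    using push_push [OF w, of _ False] by simp
  then have "W_act (Tw e) x = ((w, u), (u, s))"
    using W_act_Tw [OF _ e(2)] w by (simp add: x_def reduced_push s)
  then have "W_act (inv\<^bsub>W\<^esub> (Tw e)) ((w, u), (u, s)) = W_act (Tw e \<otimes>\<^bsub>W\<^esub> inv\<^bsub>W\<^esub> (Tw e)) x"
    using W_act_mult [OF Tw_closed [OF e(2)] W.inv_closed [OF Tw_closed [OF e(2)]] rx] by simp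
  also have "\<dots> = x" using W_act_one [OF rx] W.r_inv [OF Tw_closed [OF e(2)]] by (simp del: W_simps)
  finally show ?thesis by (simp add: e x_def s'_def Wp.arc_val_def)
qed

lemma det2_zero:
  assumes "p \<noteq> 0" "det2 p z = 0"
  obtains a b where "b \<noteq> 0" "zmult b z = zmult a p"
proof (cases "fst p = 0")
  case True
  then have "snd p \<noteq> 0" using assms(1) by (auto simp: prod_eq_iff)
  then show ?thesis using that [of "snd p" "snd z"] assms(2) by (auto simp: det2_def zmult_def mult.commute)
next
  case False
  then show ?thesis using that [of "fst p" "fst z"] assms(2) by (auto simp: det2_def zmult_def mult.commute)
qed

text \<open>The residue of one coordinate modulo \<open>N\<close> distinguishes an edge vector from its roots; this is why
  the stable letters carry such a residue.\<close>

lemma multiple_of_edge: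
  assumes p: "p \<noteq> 0" and det: "det2 p z = 0" and N: "ell i v p = N" and dvd: "N dvd ell i v z"
  obtains k where "z = zmult k p"
proof -
  obtain a b where ab: "b \<noteq> 0" "zmult b z = zmult a p" using det2_zero [OF p det] .
  obtain c where c: "ell i v z = N * c" using dvd by (auto simp: dvd_def)
  have "b * ell i v z = a * N"
    using ab(2) N ell_zmult [of i v b z] ell_zmult [of i v a p] by simp
  then have "a = b * c" using c N_pos by simp
  then have "b * fst z = b * (c * fst p)" "b * snd z = b * (c * snd p)"
    using ab(2) by (auto simp: zmult_def prod_eq_iff)
  then have "z = zmult c p" using ab(1) by (simp add: zmult_def prod_eq_iff)
  then show ?thesis using that by blast
qed

text \<open>Equal labels have equal masks and equal residues. The mask retains a form that vanishes
  exactly along the edge group, so \<open>z\<close> is parallel to the edge vector; the residue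
  modulo \<open>N\<close> then excludes proper roots.\<close>

lemma no_cancel:
  assumes a: "fst a \<in> Ep"
    and eq: "fst (arc_letter (Wp.arc_rev a) (\<lambda>i. u i + lam (Wp.arc_tgt a) z (flip (s \<noteq> sg (fst a)) i)) (s \<noteq> sg (fst a)))
      = fst (arc_letter a u s)"
  shows "\<exists>k. z = zmult k (Wp.arc_vec (Wp.arc_rev a))"
proof -
  obtain e b where e: "a = (e, b)" "e \<in> Ep" using a by (cases a) auto
  let ?s' = "s \<noteq> sg e"
  define t where "t = (if b then s else ?s')"
  define v where "v = Wp.arc_tgt a"
  define p where "p = Wp.arc_vec (Wp.arc_rev a)"
  \<comment> \<open>\<open>r\<close> is the sheet difference between the vertex just reached and the
    source of \<open>e\<close>; the indices of forms have to be translated by it.\<close>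
  define r where "r = (b \<and> sg e)"
  have t: "(?s' \<noteq> t) = r" "(t \<noteq> ?s') = r" by (auto simp: t_def r_def)
  have "(if \<not> b then ?s' else ?s' \<noteq> sg e) = t" by (auto simp: t_def)
  then have eq': "(u (i0 e, t) + lam v z (flip ?s' (i0 e, t))) mod N = u (i0 e, t) mod N"
    "mask e t (\<lambda>i. u i + lam v z (flip ?s' i)) = mask e t u"
    using eq by (auto simp: arc_letter_def Let_def e Wp.arc_rev_def t_def v_def split: if_splits)
  have ell: "ell (f, r) v p = ell (f, False) (src e) (pt e)" if "f \<in> set F" for f
    using ell_edge [OF e(2) that, of False] e
    by (auto simp: r_def v_def p_def Wp.arc_tgt_def Wp.arc_vec_def Wp.arc_rev_def)
  have ell': "ell (f, False) v p = ell (f, r) (src e) (pt e)" if "f \<in> set F" for f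
    using ell_edge [OF e(2) that, of r] e
    by (auto simp: r_def v_def p_def Wp.arc_tgt_def Wp.arc_vec_def Wp.arc_rev_def)
  have p: "p \<noteq> 0" using pt_nz ph_nz e by (auto simp: p_def Wp.arc_vec_def Wp.arc_rev_def)
  obtain f where f: "f \<in> set F" "\<And>z. ell (f, False) v z = 0 \<longleftrightarrow> det2 p z = 0"
    using det_src [OF e(2)] det_tgt [OF e(2)] e
    by (cases b) (auto simp: v_def p_def Wp.arc_tgt_def Wp.arc_vec_def Wp.arc_rev_def)
  \<comment> \<open>The form vanishes on the edge vector, hence its index is outside
    \<open>supp\<close> and its value on \<open>z\<close> survives in the mask.\<close>
  have "ell (f, r) (src e) (pt e) = 0"
    using ell' [OF f(1)] f(2) [of p] by (simp add: det2_def)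
  then have "(f, ?s') \<notin> supp e t"
    using f(1) t by (auto simp: supp_def lam_def)
  then have "lam v z (flip ?s' (f, ?s')) = 0"
    using fun_cong [OF eq'(2), of "(f, ?s')"] by (simp add: mask_def)
  then have det: "det2 p z = 0" using f by (simp add: lam_def)
  have N: "ell (i0 e, r) v p = N" using ell i0 ell_i0 e by simp
  have "N dvd lam v z (flip ?s' (i0 e, t))"
    using eq'(1) by (metis add_diff_cancel_left' mod_eq_dvd_iff)
  then have "N dvd ell (i0 e, r) v z" using i0 e t by (simp add: lam_def)
  then show ?thesis using multiple_of_edge [OF p det N] by (metis p_def)
qed

text \<open>The starting word is arbitrary for the sake of the induction, and the condition on its
  head says that the first arc does not cancel. For later arcs \<open>no_cancel\<close> turns a
  cancellation into a pinch, so a reduced path adds one letter per arc.\<close>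

lemma W_act_path:
  assumes "Wp.is_path v p v'" "v \<in> src ` Ep \<union> tgt ` Ep" "reduced w"
  shows "\<exists>w' u' s'. W_act (Wp.path_val v p z) ((w, u), (u, s)) = ((w', u'), (u', s')) \<and>
    (Wp.reduced_path p \<longrightarrow>
      (\<forall>y a q. p = (y, a) # q \<longrightarrow> w = [] \<or>
         hd w \<noteq> apsnd Not (arc_letter a (\<lambda>i. u i + lam v y (flip s i)) s)) \<longrightarrow>
      length w' = length w + length p)"
  using assms
proof (induction p arbitrary: v w u s)
  case Nil
  then show ?case by (auto simp: W_act_Lw)
next
  case (Cons l q)
  obtain y a where l: "l = (y, a)" by (cases l)
  have a: "fst a \<in> Ep" "Wp.arc_src a = v" "Wp.is_path (Wp.arc_tgt a) q v'"
    using Cons.prems(1) by (auto simp: l)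
  have tgt: "Wp.arc_tgt a \<in> src ` Ep \<union> tgt ` Ep" using Wp.arc_ends a(1) by blast
  define u1 where "u1 = (\<lambda>i. u i + lam v y (flip s i))"
  define s1 where "s1 = (s \<noteq> sg (fst a))"
  define w1 where "w1 = push (arc_letter a u1 s) w"
  have w1: "reduced w1" using Cons.prems(3) by (simp add: w1_def reduced_push)
  have closed: "Wp.path_val (Wp.arc_tgt a) q z \<in> carrier W" "Wp.arc_val a \<in> carrier W" "Lw v y \<in> carrier W"
    using Wp.path_val_closed [OF a(3) tgt] Wp.arc_val_closed [OF a(1)] Lw_closed by auto
  have "W_act (Wp.path_val v (l # q) z) ((w, u), (u, s)) =
      W_act (Wp.path_val (Wp.arc_tgt a) q z) (W_act (Wp.arc_val a) (W_act (Lw v y) ((w, u), (u, s))))"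
    unfolding l Wp.path_val.simps using closed Cons.prems(3)
    by (simp add: W_act_mult reduced_W_act W_act_Lw del: W_simps)
  also have "W_act (Wp.arc_val a) (W_act (Lw v y) ((w, u), (u, s))) = ((w1, u1), (u1, s1))"
    using Cons.prems(3) a(1) by (simp add: W_act_Lw W_act_arc u1_def s1_def w1_def)
  finally have step: "W_act (Wp.path_val v (l # q) z) ((w, u), (u, s)) =
    W_act (Wp.path_val (Wp.arc_tgt a) q z) ((w1, u1), (u1, s1))" .
  obtain w' u' s' where IH: "W_act (Wp.path_val (Wp.arc_tgt a) q z) ((w1, u1), (u1, s1)) = ((w', u'), (u', s'))"
    "Wp.reduced_path q \<Longrightarrow>
      (\<forall>y a' q'. q = (y, a') # q' \<longrightarrow> w1 = [] \<or>
         hd w1 \<noteq> apsnd Not (arc_letter a' (\<lambda>i. u1 i + lam (Wp.arc_tgt a) y (flip s1 i)) s1)) \<Longrightarrow>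
      length w' = length w1 + length q"
    using Cons.IH [OF a(3) tgt w1, of u1 s1] by blast
  have "length w' = length w + length (l # q)"
    if red: "Wp.reduced_path (l # q)" and nc: "\<forall>y a q'. l # q = (y, a) # q' \<longrightarrow> w = [] \<or>
         hd w \<noteq> apsnd Not (arc_letter a (\<lambda>i. u i + lam v y (flip s i)) s)"
  proof -
    have "w = [] \<or> hd w \<noteq> apsnd Not (arc_letter a u1 s)" using nc [rule_format, OF arg_cong [OF l]] by (simp add: u1_def)
    then have len: "length w1 = Suc (length w)" "hd w1 = arc_letter a u1 s"
      using length_push [of w "arc_letter a u1 s"] unfolding w1_def by (auto simp: prod_eq_iff apsnd_def map_prod_def split_beta)
    have "hd w1 \<noteq> apsnd Not (arc_letter a' (\<lambda>i. u1 i + lam (Wp.arc_tgt a) y' (flip s1 i)) s1)"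
      if q: "q = (y', a') # q'" for y' a' q'
    proof
      assume eq: "hd w1 = apsnd Not (arc_letter a' (\<lambda>i. u1 i + lam (Wp.arc_tgt a) y' (flip s1 i)) s1)"
      have "a' = Wp.arc_rev a"
        using eq len(2) by (auto simp: arc_letter_def Let_def Wp.arc_rev_def prod_eq_iff)
      moreover from this have "\<exists>k. y' = zmult k (Wp.arc_vec (Wp.arc_rev a))"
        using eq len(2) by (intro no_cancel [OF a(1), of u1 y' s]) (auto simp: s1_def)
      ultimately show False using red by (simp add: l q)
    qed
    moreover have "Wp.reduced_path q" using red unfolding l by (cases q) auto
    ultimately show ?thesis using IH(2) len(1) by auto
  qed
  then show ?case using IH(1) step by auto
qed

end

section \<open>From a homomorphism into the target group to a special subgroup\<close>

subsection \<open>Right-angled Artin groups on natural numbers\<close>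

lemma raag_hom:
  assumes f: "\<And>x. x \<in> X \<Longrightarrow> f x \<in> X'" "\<And>x y. (x, y) \<in> E \<Longrightarrow> x \<in> X \<Longrightarrow> y \<in> X \<Longrightarrow> (f x, f y) \<in> E'"
    and sym: "sym E'"
  obtains \<rho> where "\<rho> \<in> hom (raag X E) (raag X' E')"
    "\<And>x. x \<in> X \<Longrightarrow> \<rho> (pres_class X (raag_rels E) [(x, True)]) = pres_class X' (raag_rels E') [(f x, True)]"
proof -
  interpret raag_graph X' E' by unfold_locales (rule sym)
  have h: "(\<lambda>x. gen (f x)) \<in> X \<rightarrow> carrier A" using f by auto
  have rel: "word_eval A (\<lambda>x. gen (f x)) r = word_eval A (\<lambda>x. gen (f x)) s"
    if rs: "(r, s) \<in> raag_rels E" "r \<in> gwords X" "s \<in> gwords X" for r s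
  proof -
    obtain x y where "r = [(x, True), (y, True)]" "s = [(y, True), (x, True)]" "(x, y) \<in> E" "x \<in> X" "y \<in> X"
      using rs by (auto simp: raag_rels_def)
    then show ?thesis using f gen_commute [of "f x" "f y"] by simp
  qed
  obtain \<rho> where \<rho>: "\<rho> \<in> hom (presented_group X (raag_rels E)) A"
    "\<And>w. w \<in> gwords X \<Longrightarrow> \<rho> (pres_class X (raag_rels E) w) = word_eval A (\<lambda>x. gen (f x)) w"
    using A.presented_group_hom [OF h rel] by blast
  show ?thesis
  proof (rule that)
    show "\<rho> \<in> hom (raag X E) (raag X' E')" using \<rho>(1) by (simp add: raag_altdef A_def)
    fix x assume "x \<in> X"
    then show "\<rho> (pres_class X (raag_rels E) [(x, True)]) = pres_class X' (raag_rels E') [(f x, True)]"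
      using \<rho>(2) [of "[(x, True)]"] f by (simp add: gen_def [symmetric])
  qed
qed

lemma fin_gen_raag:
  assumes "finite X" shows "fin_gen_group (raag X E)"
proof -
  let ?G = "presented_group X (raag_rels E)"
  let ?S = "(\<lambda>x. pres_class X (raag_rels E) [(x, True)]) ` X"
  interpret group ?G by (rule group_presented_group)
  have S: "?S \<subseteq> carrier ?G" by (auto simp: presented_group_carrier)
  have "a \<in> generate ?G ?S" if "a \<in> carrier ?G" for a
    using that
  proof (induction rule: presented_group_induct)
    case (gen x a)
    then show ?case by (blast intro: generate.eng generate.incl)
  next
    case (inv_gen x a)
    then show ?case by (blast intro: generate.eng generate.inv)
  qed (rule generate.one)
  then have "generate ?G ?S = carrier ?G" using generate_incl [OF S] by blast
  then show ?thesis unfolding fin_gen_group_def raag_altdef using assms S by (intro exI [of _ ?S]) auto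
qed

text \<open>An injection of the vertices into the naturals and its inverse both induce
  homomorphisms, and the second is a left inverse of the first.\<close>

lemma raag_to_nat:
  assumes fin: "finite X" and simp: "simplicial_graph X E"
  obtains X' :: "nat set" and E' \<rho> where "simplicial_graph X' E'" "fin_gen_group (raag X' E')"
    "\<rho> \<in> mon (raag X E) (raag X' E')"
proof -
  obtain f :: "_ \<Rightarrow> nat" where f: "inj_on f X" using finite_imp_inj_to_nat_seg [OF fin] by blast
  define X' where "X' = f ` X"
  define E' where "E' = (\<lambda>(x, y). (f x, f y)) ` E"
  have E: "E \<subseteq> X \<times> X" "sym E" "irrefl E" using simp by (auto simp: simplicial_graph_def)
  have E': "sym E'" using E(2) by (auto simp: E'_def sym_def)
  have "irrefl E'" using E(1,3) f by (auto simp: E'_def irrefl_def dest!: inj_onD)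
  then have simp': "simplicial_graph X' E'"
    using E E' by (auto simp: simplicial_graph_def X'_def E'_def)
  obtain \<rho> where \<rho>: "\<rho> \<in> hom (raag X E) (raag X' E')"
    "\<And>x. x \<in> X \<Longrightarrow> \<rho> (pres_class X (raag_rels E) [(x, True)]) = pres_class X' (raag_rels E') [(f x, True)]"
  proof (rule raag_hom [OF _ _ E'])
    show "f x \<in> X'" if "x \<in> X" for x using that by (simp add: X'_def)
    show "(f x, f y) \<in> E'" if "(x, y) \<in> E" for x y using that by (force simp: E'_def)
  qed blast
  obtain \<sigma> where \<sigma>: "\<sigma> \<in> hom (raag X' E') (raag X E)"
    "\<And>x. x \<in> X' \<Longrightarrow> \<sigma> (pres_class X' (raag_rels E') [(x, True)]) =
       pres_class X (raag_rels E) [(inv_into X f x, True)]"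
  proof (rule raag_hom [of X' "inv_into X f" X E' E])
    show "inv_into X f x \<in> X" if "x \<in> X'" for x using that by (auto simp: X'_def inv_into_into)
    show "(inv_into X f x, inv_into X f y) \<in> E" if xy: "(x, y) \<in> E'" for x y
    proof -
      obtain a b where ab: "(a, b) \<in> E" "x = f a" "y = f b" using xy by (auto simp: E'_def)
      moreover have "a \<in> X" "b \<in> X" using E(1) ab(1) by auto
      ultimately show ?thesis using f by simp
    qed
  qed (use E(2) in auto)
  let ?G = "presented_group X (raag_rels E)" and ?G' = "presented_group X' (raag_rels E')"
  interpret G: group ?G by (rule group_presented_group)
  interpret G': group ?G' by (rule group_presented_group)
  interpret \<rho>: group_hom ?G ?G' \<rho> using \<rho>(1) by unfold_locales (simp add: raag_altdef)
  interpret \<sigma>: group_hom ?G' ?G \<sigma> using \<sigma>(1) by unfold_locales (simp add: raag_altdef)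
  have gen_id: "\<sigma> (\<rho> (pres_class X (raag_rels E) [(x, True)])) = pres_class X (raag_rels E) [(x, True)]"
    "pres_class X (raag_rels E) [(x, True)] \<in> carrier ?G" if "x \<in> X" for x
    using that f \<sigma>(2) [of "f x"] by (simp_all add: \<rho>(2) X'_def presented_group_carrier)
  have "\<sigma> (\<rho> a) = a" if "a \<in> carrier ?G" for a
    using that
  proof (induction rule: presented_group_induct)
    case (gen x a)
    then show ?case by (simp add: gen_id)
  next
    case (inv_gen x a)
    then show ?case by (simp add: gen_id)
  qed simp
  then have "inj_on \<rho> (carrier ?G)" by (rule inj_on_inverseI)
  then have "\<rho> \<in> mon (raag X E) (raag X' E')" using \<rho>(1) by (simp add: mon_def raag_altdef)
  then show ?thesis using that simp' fin_gen_raag [of X' E'] fin by (auto simp: X'_def)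
qed

subsection \<open>Virtual specialness\<close>

context raag_target
begin

lemma theta_trivial:
  assumes "\<not> snd m" "\<And>f b. f \<in> set F \<Longrightarrow> N dvd fst m (f, b)" "a \<in> carrier A"
  shows "theta m a = a"
proof -
  have "relabel m x = x" if "x \<in> gens" for x
  proof (cases x)
    case (Tg e r s)
    then have e: "e \<in> Ep" "0 \<le> r" "r < N" using that by (auto simp: gens_def)
    obtain k where "fst m (i0 e, s) = N * k" using assms(2) i0 [OF e(1)] by blast
    then show ?thesis using Tg e assms(1) by simp
  qed (use assms(1) in simp)
  then have "relabels m w = w" if "w \<in> gwords gens" for w
    using that
  proof (induction w)
    case (Cons l w)
    then show ?case by (cases l) auto
  qed simp
  then show ?thesis using assms(3) by (auto elim!: carrier_A_cases simp: theta_cls)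
qed

text \<open>Conjugators \<open>S v\<close> let tree letters be trivial in \<open>G\<close> although
  \<open>Tw\<close> is not; along a path they telescope, and disappear on loops at
  \<open>src e0\<close>. The subgroup that acts trivially on \<open>A\<close> has finite index, and
  on it the first component of \<Phi> is an injective homomorphism.\<close>

theorem virtually_special_of_hom:
  fixes G :: "'g monoid" (structure)
  assumes "lattice_graph_group G Vs Ep src tgt pt ph vx st"
    and \<Phi>: "\<Phi> \<in> hom G W"
    and S: "\<And>v. v \<in> Vs \<Longrightarrow> S v \<in> carrier W"
    and \<Phi>_vx: "\<And>v z. v \<in> Vs \<Longrightarrow> \<Phi> (vx v z) = S v \<otimes>\<^bsub>W\<^esub> Lw v z \<otimes>\<^bsub>W\<^esub> inv\<^bsub>W\<^esub> (S v)"
    and \<Phi>_st: "\<And>e. e \<in> Ep \<Longrightarrow> \<Phi> (st e) = S (src e) \<otimes>\<^bsub>W\<^esub> Tw e \<otimes>\<^bsub>W\<^esub> inv\<^bsub>W\<^esub> (S (tgt e))"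
    and e0: "e0 \<in> Ep" "S (src e0) = \<one>\<^bsub>W\<^esub>"
    and paths: "\<And>g. g \<in> carrier G \<Longrightarrow> \<exists>p z. lattice_graph_group.is_path Ep src tgt (src e0) p (src e0) \<and>
      lattice_graph_group.path_val G src tgt vx st (src e0) p z = g"
  shows "virtually_special G"
proof -
  interpret L: lattice_graph_group G Vs Ep src tgt pt ph vx st by fact
  interpret \<Phi>: group_hom G W \<Phi> using \<Phi> by unfold_locales
  have \<Phi>_arc: "\<Phi> (L.arc_val a) = S (L.arc_src a) \<otimes>\<^bsub>W\<^esub> Wp.arc_val a \<otimes>\<^bsub>W\<^esub> inv\<^bsub>W\<^esub> (S (L.arc_tgt a))"
    if a: "fst a \<in> Ep" for a
  proof -
    have "S (src (fst a)) \<in> carrier W" "S (tgt (fst a)) \<in> carrier W" "Tw (fst a) \<in> carrier W"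
      using S L.ends a Tw_closed by auto
    then show ?thesis
      using a \<Phi>_st [OF a]
      by (simp add: L.arc_val_def Wp.arc_val_def L.arc_src_def L.arc_tgt_def W.inv_mult_group W.m_assoc del: W_simps)
  qed
  have \<Phi>_path: "\<Phi> (L.path_val v p z) = S v \<otimes>\<^bsub>W\<^esub> Wp.path_val v p z \<otimes>\<^bsub>W\<^esub> inv\<^bsub>W\<^esub> (S w)"
    if "L.is_path v p w" "v \<in> Vs" "v \<in> src ` Ep \<union> tgt ` Ep" for v p w z
    using that
  proof (induction p arbitrary: v)
    case (Cons l p)
    obtain y a where l: "l = (y, a)" by (cases l)
    have a: "fst a \<in> Ep" "L.arc_src a = v" "L.is_path (L.arc_tgt a) p w" "L.arc_tgt a \<in> Vs"
      "L.arc_tgt a \<in> src ` Ep \<union> tgt ` Ep" "w \<in> Vs"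
      using Cons.prems L.arc_ends [of a] Wp.arc_ends [of a] L.path_ends [of v "l # p" w] by (auto simp: l)
    have 1: "L.path_val (L.arc_tgt a) p z \<in> carrier G" "Wp.path_val (L.arc_tgt a) p z \<in> carrier W"
      using L.path_val_closed [OF a(3,4)] Wp.path_val_closed [OF a(3,5)] by auto
    have 2: "S v \<in> carrier W" "S w \<in> carrier W" "S (L.arc_tgt a) \<in> carrier W" "Lw v y \<in> carrier W" "Wp.arc_val a \<in> carrier W"
      using S a Cons.prems Lw_closed Wp.arc_val_closed [OF a(1)] by auto
    have canc: "inv\<^bsub>W\<^esub> x \<otimes>\<^bsub>W\<^esub> (x \<otimes>\<^bsub>W\<^esub> y) = y" if "x \<in> carrier W" "y \<in> carrier W" for x y
      using that by (simp add: W.m_assoc [symmetric] del: W_simps)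
    have "\<Phi> (L.path_val v (l # p) z) = \<Phi> (vx v y) \<otimes>\<^bsub>W\<^esub> (\<Phi> (L.arc_val a) \<otimes>\<^bsub>W\<^esub> \<Phi> (L.path_val (L.arc_tgt a) p z))"
      using 1 a Cons.prems by (simp add: l del: W_simps)
    also have "\<dots> = S v \<otimes>\<^bsub>W\<^esub> (Lw v y \<otimes>\<^bsub>W\<^esub> (Wp.arc_val a \<otimes>\<^bsub>W\<^esub> Wp.path_val (L.arc_tgt a) p z)) \<otimes>\<^bsub>W\<^esub> inv\<^bsub>W\<^esub> (S w)"
      unfolding Cons.IH [OF a(3,4,5)] \<Phi>_arc [OF a(1)] \<Phi>_vx [OF Cons.prems(2)] a(2)
      using 1(2) 2 by (simp add: W.m_assoc canc del: W_simps)
    finally show ?case by (simp add: l del: W_simps)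
  qed (use \<Phi>_vx in \<open>auto simp del: W_simps\<close>)
  have v0: "src e0 \<in> Vs" "src e0 \<in> src ` Ep \<union> tgt ` Ep" using e0 L.ends by auto
  \<comment> \<open>Only the component in \<open>A\<close> is assumed trivial, and it alone
    determines the word of the state. An empty word forces the reduced path to have no arcs; the
    remaining lattice element is killed by all forms and hence zero.\<close>
  have kernel: "g = \<one>" if g: "g \<in> carrier G" "fst (\<Phi> g) = \<one>\<^bsub>A\<^esub>" for g
  proof -
    obtain p z where p: "L.is_path (src e0) p (src e0)" "L.path_val (src e0) p z = g" "L.reduced_path p"
      using paths [OF g(1)] L.reduced_path_ex [OF _ v0(1)] by metis
    have closed: "Wp.path_val (src e0) p z \<in> carrier W" using Wp.path_val_closed [OF p(1) v0(2)] .
    have \<Phi>g: "\<Phi> g = Wp.path_val (src e0) p z"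
      using \<Phi>_path [OF p(1) v0, of z] p(2) e0(2) closed by (simp del: W_simps)
    let ?x = "(([], \<lambda>i. 0), (\<lambda>i. 0, False))"
    have red: "reduced (fst (fst ?x))" by simp
    obtain w' u' s' where act: "W_act (\<Phi> g) ?x = ((w', u'), (u', s'))" "length w' = length p"
      using W_act_path [OF p(1) v0(2), of "[]" z "\<lambda>i. 0" False] p(3) by (auto simp: \<Phi>g)
    have "\<Phi> g = (cls [], snd (\<Phi> g))" using g(2) by (simp add: one_A prod_eq_iff)
    then have "W_act (\<Phi> g) ?x = (([], \<lambda>i. 0), (\<lambda>i. 0, False) \<otimes>\<^bsub>Mgrp\<^esub> snd (\<Phi> g))"
      using W_act_cls [of "[]" ?x "snd (\<Phi> g)"] by simp
    then have "p = []" "u' = (\<lambda>i. 0)" using act by auto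
    then have lam_zero: "lam (src e0) z = (\<lambda>i. 0)"
      using act W_act_Lw [of "[]" "src e0" z "\<lambda>i. 0" False] by (simp add: \<Phi>g)
    have lam: "ell (f, b) (src e0) z = 0" if "f \<in> set F" for f b
      using fun_cong [OF lam_zero, of "(f, b)"] that by (simp add: lam_def)
    have det: "det2 (pt e0) z = 0" using det_src [OF e0(1)] lam by blast
    obtain k where k: "z = zmult k (pt e0)"
      using multiple_of_edge [OF pt_nz [OF e0(1)] det ell_i0 [OF e0(1)]] lam i0 [OF e0(1)] by auto
    have "k * N = 0"
      using lam [OF i0 [OF e0(1)], of False] ell_i0 [OF e0(1)] by (simp add: k ell_zmult)
    then have "z = 0" using N_pos by (simp add: k zmult_def prod_eq_iff)
    then show "g = \<one>" using p(2) \<open>p = []\<close> v0 by (simp add: L.vx_zero)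
  qed
  \<comment> \<open>A congruence subgroup: no sheet change and all coordinates divisible by
    \<open>N\<close>, so that \<open>theta_trivial\<close> applies.\<close>
  define H where "H = {g \<in> carrier G. \<not> snd (snd (\<Phi> g)) \<and> (\<forall>f\<in>set F. \<forall>b. N dvd fst (snd (\<Phi> g)) (f, b))}"
  have snd_mult: "snd (\<Phi> (x \<otimes> y)) = (\<lambda>i. fst (snd (\<Phi> x)) i + fst (snd (\<Phi> y)) (flip (snd (snd (\<Phi> x))) i),
      snd (snd (\<Phi> x)) \<noteq> snd (snd (\<Phi> y)))" if "x \<in> carrier G" "y \<in> carrier G" for x y
    using that by simp
  have H: "subgroup H G"
  proof (rule L.subgroupI)
    show "H \<noteq> {}" using \<Phi>.hom_one by (auto simp: H_def intro!: exI [of _ "\<one>"])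
    show "x \<otimes> y \<in> H" if "x \<in> H" "y \<in> H" for x y
      using that snd_mult by (auto simp: H_def)
    fix x assume x: "x \<in> H"
    then have xc: "x \<in> carrier G" by (simp add: H_def)
    have "snd (\<Phi> (x \<otimes> inv x)) = (\<lambda>i. 0, False)" using xc \<Phi>.hom_one by (simp del: \<Phi>.hom_mult)
    then have *: "fst (snd (\<Phi> x)) i + fst (snd (\<Phi> (inv x))) i = 0" "\<not> snd (snd (\<Phi> (inv x)))" for i
      using snd_mult [OF xc L.inv_closed [OF xc]] x by (cases i; auto simp: H_def fun_eq_iff)+
    have "fst (snd (\<Phi> (inv x))) i = - fst (snd (\<Phi> x)) i" for i
      using *(1) [of i] by simp
    then show "inv x \<in> H" using x xc *(2) by (simp add: H_def)
  qed (auto simp: H_def)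
  \<comment> \<open>Sheet and residues of the coordinates in \<open>F\<close> determine the coset,
    and they take finitely many values.\<close>
  define K where "K g = (restrict (\<lambda>i. fst (snd (\<Phi> g)) i mod N) (set F \<times> UNIV), snd (snd (\<Phi> g)))" for g
  have coset: "H #> g = H #> g'" if g: "g \<in> carrier G" "g' \<in> carrier G" and K: "K g = K g'" for g g'
  proof -
    define d where "d = g \<otimes> inv g'"
    have d: "d \<in> carrier G" "g = d \<otimes> g'" using g by (auto simp: d_def L.m_assoc)
    have mult: "snd (\<Phi> g) = (\<lambda>i. fst (snd (\<Phi> d)) i + fst (snd (\<Phi> g')) (flip (snd (snd (\<Phi> d))) i),
      snd (snd (\<Phi> d)) \<noteq> snd (snd (\<Phi> g')))" unfolding d(2) by (rule snd_mult [OF d(1) g(2)])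
    have "snd (snd (\<Phi> g)) = snd (snd (\<Phi> g'))" using K by (simp add: K_def)
    then have s: "\<not> snd (snd (\<Phi> d))" using mult by auto
    have "N dvd fst (snd (\<Phi> d)) (f, b)" if "f \<in> set F" for f b
    proof -
      have "fst (snd (\<Phi> g)) (f, b) mod N = fst (snd (\<Phi> g')) (f, b) mod N"
        using K that by (auto simp: K_def restrict_def fun_eq_iff split: if_splits)
      then have "N dvd fst (snd (\<Phi> g)) (f, b) - fst (snd (\<Phi> g')) (f, b)" by (simp add: mod_eq_dvd_iff)
      then show ?thesis using mult s by simp
    qed
    then have "d \<in> H" using d s by (simp add: H_def)
    then have "g \<in> H #> g'" using d(2) by (auto simp: r_coset_def)
    then show ?thesis using L.repr_independence [OF _ g(2) H] by simp
  qed
  have "finite (K ` carrier G)"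
  proof (rule finite_subset)
    show "K ` carrier G \<subseteq> (\<Pi>\<^sub>E i\<in>set F \<times> UNIV. {0..<N}) \<times> UNIV"
      using N_pos by (auto simp: K_def split: if_splits)
    show "finite ((\<Pi>\<^sub>E i\<in>set F \<times> (UNIV :: bool set). {0..<N}) \<times> (UNIV :: bool set))"
      by (intro finite_cartesian_product finite_PiE) auto
  qed
  moreover have "rcosets H \<subseteq> (\<lambda>k. H #> inv_into (carrier G) K k) ` K ` carrier G"
  proof
    fix C assume "C \<in> rcosets H"
    then obtain g where g: "g \<in> carrier G" "C = H #> g" by (auto simp: RCOSETS_def)
    have "K (inv_into (carrier G) K (K g)) = K g" "inv_into (carrier G) K (K g) \<in> carrier G"
      using g by (auto intro: f_inv_into_f inv_into_into)
    then have "C = H #> inv_into (carrier G) K (K g)" using coset g by metis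
    then show "C \<in> (\<lambda>k. H #> inv_into (carrier G) K k) ` K ` carrier G" using g by blast
  qed
  ultimately have fin: "finite (rcosets H)" using finite_subset by blast
  let ?H = "G\<lparr>carrier := H\<rparr>"
  interpret H: group ?H using H by (rule L.subgroup_imp_group)
  have Hc: "x \<in> H \<Longrightarrow> x \<in> carrier G" for x by (simp add: H_def)
  have fst_closed: "fst (\<Phi> x) \<in> carrier A" if "x \<in> carrier G" for x
    using \<Phi>.hom_closed [OF that] by (auto simp: mem_Times_iff)
  have hom: "(\<lambda>x. fst (\<Phi> x)) \<in> hom ?H A"
  proof (rule homI)
    fix x y assume "x \<in> carrier ?H" "y \<in> carrier ?H"
    then have xy: "x \<in> H" "y \<in> H" by auto
    then have "theta (snd (\<Phi> x)) (fst (\<Phi> y)) = fst (\<Phi> y)"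
      using fst_closed by (intro theta_trivial) (auto simp: H_def)
    then show "fst (\<Phi> (x \<otimes>\<^bsub>?H\<^esub> y)) = fst (\<Phi> x) \<otimes>\<^bsub>A\<^esub> fst (\<Phi> y)"
      using Hc xy by simp
  qed (use Hc fst_closed in auto)
  then interpret h: group_hom ?H A "\<lambda>x. fst (\<Phi> x)" by unfold_locales
  have inj: "inj_on (\<lambda>x. fst (\<Phi> x)) (carrier ?H)"
    using h.inj_on_one_iff kernel Hc by auto
  obtain X' :: "nat set" and E' \<rho> where \<rho>: "simplicial_graph X' E'" "fin_gen_group (raag X' E')"
    "\<rho> \<in> mon A (raag X' E')"
    using raag_to_nat [OF finite_gens simplicial] unfolding A_def .
  have "\<rho> \<circ> (\<lambda>x. fst (\<Phi> x)) \<in> hom ?H (raag X' E')"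
    using hom_compose [OF hom, of \<rho> "raag X' E'"] \<rho>(3) by (simp add: mon_def)
  moreover have "inj_on (\<rho> \<circ> (\<lambda>x. fst (\<Phi> x))) (carrier ?H)"
  proof (rule comp_inj_on [OF inj])
    have "(\<lambda>x. fst (\<Phi> x)) ` carrier ?H \<subseteq> carrier A" using h.hom_closed by blast
    then show "inj_on \<rho> ((\<lambda>x. fst (\<Phi> x)) ` carrier ?H)"
      using \<rho>(3) inj_on_subset unfolding mon_def by blast
  qed
  ultimately have "\<rho> \<circ> (\<lambda>x. fst (\<Phi> x)) \<in> mon ?H (raag X' E')" by (simp add: mon_def)
  then show ?thesis unfolding virtually_special_def using H fin \<rho> by blast
qed

end

section \<open>Maximal trees as iterated attachment of leaves\<close>

section \<open>Maximal trees\<close>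

definition osrc :: "('e \<Rightarrow> 'v) \<Rightarrow> ('e \<Rightarrow> 'v) \<Rightarrow> 'e \<times> bool \<Rightarrow> 'v" where
  "osrc src tgt a = (if snd a then src (fst a) else tgt (fst a))"

text \<open>The pair \<open>a\<close> is the attached edge together with the direction in which it leaves the subtree.\<close>

inductive grown :: "'e set \<Rightarrow> ('e \<Rightarrow> 'v) \<Rightarrow> ('e \<Rightarrow> 'v) \<Rightarrow> 'v \<Rightarrow> 'v set \<Rightarrow> 'e set \<Rightarrow> bool"
  for E src tgt r where
  root: "grown E src tgt r {r} {}"
| attach: "grown E src tgt r S U \<Longrightarrow> fst a \<in> E \<Longrightarrow> osrc src tgt a \<in> S \<Longrightarrow> osrc tgt src a \<notin> S \<Longrightarrow>
    grown E src tgt r (insert (osrc tgt src a) S) (insert (fst a) U)"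

lemma grown_ends: "grown E src tgt r S U \<Longrightarrow> U \<subseteq> E \<and> r \<in> S \<and> finite S \<and> finite U \<and> (\<forall>e\<in>U. src e \<in> S \<and> tgt e \<in> S)"
  by (induction rule: grown.induct) (auto simp: osrc_def split: if_splits)

lemma grown_card: "grown E src tgt r S U \<Longrightarrow> card S = Suc (card U)"
proof (induction rule: grown.induct)
  case (attach S U a)
  then have "fst a \<notin> U" using grown_ends [OF attach(1)] by (auto simp: osrc_def split: if_splits)
  with attach show ?case using grown_ends [OF attach(1)] by simp
qed simp

lemma grown_mono: "grown E src tgt r S U \<Longrightarrow> E \<subseteq> E' \<Longrightarrow> grown E' src tgt r S U"
  by (induction rule: grown.induct) (auto intro: grown.intros)

lemma connected_crossing:
  assumes conn: "connected D" and S: "r \<in> S" "r \<in> verts D" "v \<in> verts D" "v \<notin> S"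
  shows "\<exists>a\<in>arcs D. tail D a \<in> S \<and> head D a \<notin> S \<or> head D a \<in> S \<and> tail D a \<notin> S"
proof (rule ccontr)
  assume *: "\<not> ?thesis"
  have "(r, v) \<in> rtrancl_on (verts D) (parcs (mk_symmetric D))"
    using conn S by (simp add: connected_def strongly_connected_def reachable_def)
  then have "v \<in> S"
  proof (induction rule: rtrancl_on_induct)
    case (step y z)
    then show ?case using * by (auto simp: mk_symmetric_def)
  qed (use S in simp)
  with S show False by simp
qed

lemma connectedI_grow:
  assumes D: "connected D" and D': "verts D' = insert w (verts D)" "arcs D \<subseteq> arcs D'"
    "tail D' = tail D" "head D' = head D"
    and a: "a \<in> arcs D'" "tail D a = u \<and> head D a = w \<or> tail D a = w \<and> head D a = u" "u \<in> verts D"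
  shows "connected D'"
proof -
  let ?R = "\<lambda>D. rtrancl_on (verts D) (parcs (mk_symmetric D))"
  have mono: "(x, y) \<in> ?R D'" if "(x, y) \<in> ?R D" for x y
    using that by (rule rtrancl_on_mono [rotated 2]) (use D' in \<open>auto simp: mk_symmetric_def\<close>)
  have uw: "(u, w) \<in> ?R D'" "(w, u) \<in> ?R D'"
    using a D' by (auto simp: mk_symmetric_def intro!: rtrancl_on_into_rtrancl_on [OF rtrancl_on_refl])
  have "(x, y) \<in> ?R D" if "x \<in> verts D" "y \<in> verts D" for x y
    using D that by (simp add: connected_def strongly_connected_def reachable_def)
  then have "(x, y) \<in> ?R D'" if "x \<in> insert w (verts D)" "y \<in> insert w (verts D)" for x y
    using that mono uw a(3) by (metis insert_iff rtrancl_on_trans rtrancl_on_refl D'(1))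
  then show ?thesis
    using D'(1) by (simp add: connected_def strongly_connected_def reachable_def)
qed

locale oriented_graph = bidirected_digraph D ei + fin_digraph D
  for D :: "('v, 'e) pre_digraph" and ei :: "'e \<Rightarrow> 'e" +
  fixes Ep :: "'e set"
  assumes orient: "orientation D ei Ep"
begin

lemma Ep_arcs: "Ep \<subseteq> arcs D"
  using orient by (auto simp: orientation_def)

lemma arc_cases:
  assumes "x \<in> arcs D" obtains "x \<in> Ep" | "ei x \<in> Ep"
  using assms orient arev_arev unfolding orientation_def by (metis UnE imageE)

lemma ei_notin: "e \<in> Ep \<Longrightarrow> ei e \<notin> Ep"
  using orient by (auto simp: orientation_def)

definition sub :: "'v set \<Rightarrow> 'e set \<Rightarrow> ('v, 'e) pre_digraph" where
  "sub S U = \<lparr>verts = S, arcs = U \<union> ei ` U, tail = tail D, head = head D\<rparr>"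

lemma sub_simps [simp]:
  "verts (sub S U) = S" "arcs (sub S U) = U \<union> ei ` U" "tail (sub S U) = tail D" "head (sub S U) = head D"
  by (simp_all add: sub_def)

lemma sub_wf:
  assumes "U \<subseteq> arcs D" "\<And>e. e \<in> U \<Longrightarrow> tail D e \<in> S \<and> head D e \<in> S"
  shows "wf_digraph (sub S U)"
proof -
  have "tail D e \<in> S \<and> head D e \<in> S" if "e \<in> U \<union> ei ` U" for e
    using that assms(2) subsetD [OF assms(1)] by auto
  then show ?thesis by (intro wf_digraph.intro) auto
qed

lemma sub_cas: "pre_digraph.cas (sub S U) = cas"
  by (rule compatible_cas) (simp add: compatible_def)

lemma sub_awalk_verts: "pre_digraph.awalk_verts (sub S U) = awalk_verts"
  by (rule compatible_awalk_verts) (simp add: compatible_def)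

lemma distinct_cycle: "cas u p v \<Longrightarrow> p \<noteq> [] \<Longrightarrow> tl (awalk_verts u p) = map (head D) p"
  using awalk_verts_conv' [of u p v] by simp

lemma cas_last: "cas u p v \<Longrightarrow> p \<noteq> [] \<Longrightarrow> head D (last p) = v"
proof (induction p arbitrary: u)
  case (Cons x p)
  then show ?case by (cases p) auto
qed simp

text \<open>A closed path without repeated vertices that passes through a leaf enters and leaves it by
  the same edge, hence is a back-and-forth path.\<close>

lemma leaf_no_circuit:
  assumes old: "\<nexists>p. serre_circuit (sub S U) ei p"
    and U: "U \<subseteq> Ep" "\<And>e. e \<in> U \<Longrightarrow> tail D e \<in> S \<and> head D e \<in> S"
    and a: "a \<in> arcs D" "tail D a \<in> S" "head D a \<notin> S" "insert a (insert (ei a) (U \<union> ei ` U)) = U' \<union> ei ` U'"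
  shows "\<nexists>p. serre_circuit (sub (insert (head D a) S) U') ei p"
proof
  assume "\<exists>p. serre_circuit (sub (insert (head D a) S) U') ei p"
  then obtain p where p0: "serre_circuit (sub (insert (head D a) S) U') ei p" by blast
  then have circ: "p \<noteq> [e, ei e]" for e by (simp add: serre_circuit_def)
  have "pre_digraph.cycle (sub (insert (head D a) S) U') p"
    using p0 by (simp add: serre_circuit_def)
  then obtain u where u: "pre_digraph.awalk (sub (insert (head D a) S) U') u p u"
    "distinct (tl (pre_digraph.awalk_verts (sub (insert (head D a) S) U') u p))" "p \<noteq> []"
    unfolding pre_digraph.cycle_def by metis
  then have p': "u \<in> insert (head D a) S" "set p \<subseteq> U' \<union> ei ` U'" "cas u p u"
    "distinct (tl (awalk_verts u p))" "p \<noteq> []"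
    by (simp_all add: pre_digraph.awalk_def sub_cas sub_awalk_verts)
  have "distinct (map (head D) p)" using p'(4) distinct_cycle [OF p'(3,5)] by simp
  note p = p'(1,2,3) this p'(5)
  define w where "w = head D a"
  define v where "v = tail D a"
  have vw: "v \<noteq> w" "head D a = w" "tail D a = v" "head D (ei a) = v" "tail D (ei a) = w" "w \<notin> S"
    using a by (auto simp: w_def v_def)
  have Uarcs: "x \<in> arcs D" if "x \<in> U \<union> ei ` U" for x using that U(1) Ep_arcs by auto
  have inS: "tail D x \<in> S" "head D x \<in> S" if "x \<in> U \<union> ei ` U" for x
    using that U Ep_arcs by (auto simp: subset_iff)
  have into_w: "x = a" if "x \<in> set p" "head D x = w" for x
  proof -
    have "x = a \<or> x = ei a \<or> x \<in> U \<union> ei ` U" using that(1) p(2) unfolding a(4) [symmetric] by blast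
    then show ?thesis using that(2) inS(2) [of x] vw by auto
  qed
  have from_w: "x = ei a" if "x \<in> set p" "tail D x = w" for x
  proof -
    have "x = a \<or> x = ei a \<or> x \<in> U \<union> ei ` U" using that(1) p(2) unfolding a(4) [symmetric] by blast
    then show ?thesis using that(2) inS(1) [of x] vw by auto
  qed
  have "a \<in> set p \<or> ei a \<in> set p"
  proof (rule ccontr)
    assume "\<not> ?thesis"
    then have sub: "set p \<subseteq> U \<union> ei ` U" using p(2) a(4) by auto
    obtain x q where x: "p = x # q" using p(5) by (cases p) auto
    have "u \<in> S" using inS(1) [of x] sub p(3) by (auto simp: x)
    then have "serre_circuit (sub S U) ei p"
      unfolding serre_circuit_def pre_digraph.cycle_def pre_digraph.awalk_def sub_cas sub_awalk_verts
      using p sub circ distinct_cycle by (intro conjI exI [of _ u]) auto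
    then show False using old by blast
  qed
  moreover have "a \<in> set p" if ei_a: "ei a \<in> set p"
  proof -
    obtain xs ys where xy: "p = xs @ ei a # ys" using ei_a by (meson split_list)
    then have cas: "cas u xs w" "cas v ys u" using p(3) vw by auto
    show ?thesis
    proof (cases xs rule: rev_cases)
      case (snoc zs z)
      then show ?thesis using cas_last [OF cas(1)] into_w [of z] xy by auto
    next
      \<comment> \<open>The closed path starts at the leaf with \<open>ei a\<close>, so its last
        edge leads back to the leaf and must be \<open>a\<close>.\<close>
      case Nil
      then have u: "u = w" using cas by simp
      then show ?thesis
        using cas vw cas_last [OF cas(2)] into_w [of "last ys"] xy by (cases ys rule: rev_cases) auto
    qed
  qed
  ultimately have "a \<in> set p" by blast
  then obtain xs ys where xy: "p = xs @ a # ys" by (meson split_list)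
  then have cas: "cas u xs v" "cas w ys u" using p(3) vw by auto
  show False
  proof (cases ys)
    case (Cons y zs)
    then have y: "y = ei a" using from_w [of y] cas xy by auto
    have zs: "cas v zs u" using cas Cons y vw by simp
    have "xs = []"
      using cas_last [OF cas(1)] p(4) y Cons xy vw by (cases xs rule: rev_cases) auto
    moreover from this have "u = v" using cas by simp
    ultimately have "zs = []"
      using cas_last [OF zs] p(4) y Cons xy vw by (cases zs rule: rev_cases) auto
    then show False using circ [of a] xy \<open>xs = []\<close> y Cons by simp
  next
    case Nil
    then have u: "u = w" using cas by simp
    then obtain x zs where xs: "xs = x # zs" using cas vw by (cases xs) auto
    then have x: "x = ei a" using from_w [of x] cas u xy by auto
    have zs: "cas v zs v" using cas xs x vw by simp
    have "zs = []"
      using cas_last [OF zs] p(4) x xs xy vw by (cases zs rule: rev_cases) auto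
    then show False using circ [of "ei a"] xy Nil xs x by simp
  qed
qed

lemma grown_serre_tree:
  assumes "grown Ep (tail D) (head D) r S U"
  shows "serre_tree ei (sub S U)"
  using assms
proof (induction rule: grown.induct)
  case root
  have "connected (sub {r} {})"
    by (simp add: connected_def strongly_connected_def reachable_def)
  moreover have "\<not> serre_circuit (sub {r} {}) ei p" for p
    by (auto simp: serre_circuit_def pre_digraph.cycle_def pre_digraph.awalk_def)
  ultimately show ?case by (simp add: serre_tree_def)
next
  case (attach S U a)
  let ?S = "insert (osrc (head D) (tail D) a) S" and ?U = "insert (fst a) U"
  define b where "b = (if snd a then fst a else ei (fst a))"
  have e: "fst a \<in> arcs D" using attach Ep_arcs by auto
  then have b: "b \<in> arcs D" "tail D b \<in> S" "head D b \<notin> S" "head D b = osrc (head D) (tail D) a"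
    using attach by (auto simp: b_def osrc_def)
  have bU: "insert b (insert (ei b) (U \<union> ei ` U)) = ?U \<union> ei ` ?U" by (auto simp: b_def)
  have U: "U \<subseteq> Ep" "e \<in> U \<Longrightarrow> tail D e \<in> S \<and> head D e \<in> S" for e
    using grown_ends [OF attach(1)] by auto
  have "\<nexists>p. serre_circuit (sub ?S ?U) ei p"
    using leaf_no_circuit [OF _ U b(1,2,3) bU] attach by (simp add: serre_tree_def b(4))
  moreover have "connected (sub ?S ?U)"
    by (rule connectedI_grow [of "sub S U" _ _ b "tail D b"])
      (use attach b bU in \<open>auto simp: serre_tree_def\<close>)
  moreover have "ei ` arcs (sub ?S ?U) \<subseteq> arcs (sub ?S ?U)" by (auto simp: image_iff)
  ultimately show ?case by (simp add: serre_tree_def)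
qed

text \<open>A grown subtree with the most vertices reaches all of \<open>T\<close>, since otherwise
  connectedness supplies a further edge to attach. An edge of \<open>T\<close> outside it would
  close up with a path of the subtree to a circuit.\<close>

lemma grown_in_tree:
  assumes T: "serre_tree ei T" "subgraph T D" and r: "r \<in> verts T"
  shows "grown (arcs T \<inter> Ep) (tail D) (head D) r (verts T) (arcs T \<inter> Ep)"
proof -
  interpret T: wf_digraph T using T(2) by (simp add: subgraph_def)
  have T': "verts T \<subseteq> verts D" "arcs T \<subseteq> arcs D" "tail T = tail D" "head T = head D"
    using T(2) by (auto simp: subgraph_def compatible_def)
  have eiT: "x \<in> arcs T \<Longrightarrow> ei x \<in> arcs T" for x using T(1) by (auto simp: serre_tree_def)
  let ?g = "grown (arcs T \<inter> Ep) (tail D) (head D) r"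
  have sub: "S \<subseteq> verts T" if "?g S U" for S U
    using that
  proof (induction rule: grown.induct)
    case (attach S U a)
    then show ?case using T.tail_in_verts [of "fst a"] T.head_in_verts [of "fst a"] T' by (auto simp: osrc_def)
  qed (use r in simp)
  define n where "n = (GREATEST n. \<exists>S U. ?g S U \<and> card S = n)"
  have fin: "finite (verts T)" using T'(1) finite_verts by (rule finite_subset)
  have bound: "\<exists>S U. ?g S U \<and> card S = m \<Longrightarrow> m \<le> card (verts T)" for m
    using sub fin by (auto intro: card_mono)
  have "\<exists>S U. ?g S U \<and> card S = n"
    unfolding n_def by (rule GreatestI_ex_nat [OF _ bound]) (auto intro: grown.root)
  then obtain S U where SU: "?g S U" "card S = n" by blast
  have max: "card S' \<le> card S" if "?g S' U'" for S' U'
    unfolding SU(2) n_def by (rule Greatest_le_nat [OF _ bound]) (use that in auto)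
  note SU_ends = grown_ends [OF SU(1)]
  have S: "S = verts T"
  proof (rule ccontr)
    assume "S \<noteq> verts T"
    then obtain v where v: "v \<in> verts T" "v \<notin> S" using sub [OF SU(1)] by auto
    have "connected T" using T(1) by (simp add: serre_tree_def)
    then obtain x where x: "x \<in> arcs T" "tail D x \<in> S \<and> head D x \<notin> S \<or> head D x \<in> S \<and> tail D x \<notin> S"
      using connected_crossing [of T r S v] v r SU_ends T' by auto
    obtain e where e: "e \<in> arcs T \<inter> Ep" "tail D e \<in> S \<and> head D e \<notin> S \<or> head D e \<in> S \<and> tail D e \<notin> S"
    proof (rule arc_cases [of x])
      show "x \<in> arcs D" using x T' by auto
      assume "ei x \<in> Ep"
      then show thesis using that [of "ei x"] x eiT T'(2) by (auto simp: subset_iff)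
    qed (use x that in blast)
    then have "\<exists>b. ?g (insert (osrc (head D) (tail D) (e, b)) S) (insert e U) \<and> osrc (head D) (tail D) (e, b) \<notin> S"
      using grown.attach [OF SU(1), of "(e, True)"] grown.attach [OF SU(1), of "(e, False)"]
      by (auto simp: osrc_def)
    then show False using max SU_ends by (metis card_insert_disjoint Suc_n_not_le_n)
  qed
  have "e \<in> U" if e: "e \<in> arcs T \<inter> Ep" for e
  proof (rule ccontr)
    assume eU: "e \<notin> U"
    have wf: "wf_digraph (sub S U)"
      by (rule sub_wf) (use SU_ends Ep_arcs in auto)
    interpret H: wf_digraph "sub S U" by (rule wf)
    have "grown Ep (tail D) (head D) r S U" using SU(1) by (rule grown_mono) auto
    then have "serre_tree ei (sub S U)" by (rule grown_serre_tree)
    then have "connected (sub S U)" by (simp add: serre_tree_def)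
    moreover have "symmetric (sub S U)"
    proof -
      have "\<exists>y\<in>U \<union> ei ` U. tail D x = head D y \<and> head D x = tail D y" if x: "x \<in> U \<union> ei ` U" for x
      proof -
        have "U \<subseteq> arcs D" using SU_ends Ep_arcs by auto
        then have "x \<in> arcs D" "ei x \<in> U \<union> ei ` U" using x by (auto simp: subset_iff)
        then show ?thesis by (intro bexI [of _ "ei x"]) auto
      qed
      then show ?thesis by (simp add: symmetric_conv)
    qed
    moreover have "tail D e \<in> S" "head D e \<in> S"
      using e S T' T.tail_in_verts [of e] T.head_in_verts [of e] by auto
    ultimately have "reachable (sub S U) (head D e) (tail D e)"
      using H.reachable_mk_symmetric_eq by (auto simp: connected_def strongly_connected_def)
    then obtain p where "H.apath (head D e) p (tail D e)" using H.reachable_apath by blast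
    then have p: "set p \<subseteq> U \<union> ei ` U" "cas (head D e) p (tail D e)" "distinct (awalk_verts (head D e) p)"
      by (auto simp: H.apath_def H.awalk_def sub_cas sub_awalk_verts)
    have "U \<union> ei ` U \<subseteq> arcs T" using SU_ends eiT by auto
    moreover have "pre_digraph.cas T = cas" "pre_digraph.awalk_verts T = awalk_verts"
      using T' by (auto intro!: compatible_cas compatible_awalk_verts simp: compatible_def)
    ultimately have "T.cycle (e # p)"
      using p e T.tail_in_verts [of e] T' subset_trans [OF p(1)]
      unfolding T.cycle_def T.awalk_def by (intro exI [of _ "tail D e"]) simp
    \<comment> \<open>The path runs inside the grown subtree, which contains neither
      \<open>e\<close> nor its inverse, so the cycle is no back-and-forth path.\<close>
    moreover have "e # p \<noteq> [x, ei x]" for x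
    proof
      assume "e # p = [x, ei x]"
      then have "ei e \<in> U \<union> ei ` U" using p(1) by auto
      moreover have "ei e \<notin> U" using ei_notin e SU_ends by auto
      ultimately have "e \<in> U" by (auto simp: arev_eq_iff)
      then show False using eU by simp
    qed
    ultimately have "serre_circuit T ei (e # p)" by (simp add: serre_circuit_def)
    then show False using T(1) by (auto simp: serre_tree_def)
  qed
  then have "U = arcs T \<inter> Ep" using SU_ends by auto
  then show ?thesis using SU(1) S by simp
qed

text \<open>If a vertex were missed, attaching a crossing edge would give a strictly larger Serre
  tree, against maximality. The tree therefore spans, and induction over attached leaves becomes
  available.\<close>

theorem maximal_tree_grown:
  assumes conn: "connected D" and T: "maximal_tree D ei T" and r: "r \<in> verts D"
  shows "grown (arcs T \<inter> Ep) (tail D) (head D) r (verts D) (arcs T \<inter> Ep)"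
proof -
  have T': "serre_tree ei T" "subgraph T D"
    and max: "\<And>H. subgraph T H \<Longrightarrow> subgraph H D \<Longrightarrow> serre_tree ei H \<Longrightarrow> H = T"
    using T by (auto simp: maximal_tree_def max_subgraph_def)
  have T'': "verts T \<subseteq> verts D" "arcs T \<subseteq> arcs D" "tail T = tail D" "head T = head D" "wf_digraph T"
    using T'(2) by (auto simp: subgraph_def compatible_def)
  have "verts T = verts D"
  proof (rule ccontr)
    assume "verts T \<noteq> verts D"
    then obtain v where v: "v \<in> verts D" "v \<notin> verts T" using T'' by auto
    have "connected T" using T' by (simp add: serre_tree_def)
    then obtain q where q: "q \<in> verts T" by (auto simp: connected_def strongly_connected_def)
    have g: "grown Ep (tail D) (head D) q (verts T) (arcs T \<inter> Ep)"
      using grown_mono [OF grown_in_tree [OF T' q]] by auto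
    obtain x where x: "x \<in> arcs D"
      "tail D x \<in> verts T \<and> head D x \<notin> verts T \<or> head D x \<in> verts T \<and> tail D x \<notin> verts T"
      using connected_crossing [OF conn q _ v] q T'' by auto
    obtain e where e: "e \<in> Ep"
      "tail D e \<in> verts T \<and> head D e \<notin> verts T \<or> head D e \<in> verts T \<and> tail D e \<notin> verts T"
    proof (rule arc_cases [OF x(1)])
      assume "ei x \<in> Ep"
      then show thesis using that [of "ei x"] x by auto
    qed (use x(2) that in blast)
    have "\<exists>b. osrc (tail D) (head D) (e, b) \<in> verts T \<and> osrc (head D) (tail D) (e, b) \<notin> verts T"
      using e(2) by (auto simp: osrc_def ex_bool_eq)
    then obtain b where "osrc (tail D) (head D) (e, b) \<in> verts T"
      and b': "osrc (head D) (tail D) (e, b) \<notin> verts T" by blast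
    then have "grown Ep (tail D) (head D) q (insert (osrc (head D) (tail D) (e, b)) (verts T)) (insert e (arcs T \<inter> Ep))"
      using grown.attach [OF g, of "(e, b)"] e(1) by simp
    moreover have "osrc (head D) (tail D) (e, b) \<in> verts D"
      using e(1) Ep_arcs by (auto simp: osrc_def)
    ultimately have b: "grown Ep (tail D) (head D) q (insert (osrc (head D) (tail D) (e, b)) (verts T)) (insert e (arcs T \<inter> Ep))"
      "osrc (head D) (tail D) (e, b) \<notin> verts T" "osrc (head D) (tail D) (e, b) \<in> verts D"
      using b' by auto
    define H where "H = sub (insert (osrc (head D) (tail D) (e, b)) (verts T)) (insert e (arcs T \<inter> Ep))"
    have H: "serre_tree ei H" unfolding H_def by (rule grown_serre_tree [OF b(1)])
    have wf: "wf_digraph H"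
      unfolding H_def by (rule sub_wf) (use grown_ends [OF b(1)] Ep_arcs in auto)
    have ei: "x \<in> arcs T \<Longrightarrow> ei x \<in> arcs T" for x using T'(1) by (auto simp: serre_tree_def)
    have "arcs T \<subseteq> arcs H"
    proof
      fix x assume x: "x \<in> arcs T"
      show "x \<in> arcs H"
      proof (rule arc_cases [of x])
        assume "ei x \<in> Ep"
        then have "x \<in> ei ` (arcs T \<inter> Ep)" using ei [OF x] by (intro image_eqI [of _ _ "ei x"]) auto
        then show ?thesis by (auto simp: H_def)
      qed (use x T'' in \<open>auto simp: H_def\<close>)
    qed
    then have "subgraph T H" using T'' wf by (auto simp: subgraph_def compatible_def H_def)
    moreover have "subgraph H D"
      using wf b(3) T'' Ep_arcs e wf_digraph_axioms by (auto simp: subgraph_def compatible_def H_def)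
    ultimately have "H = T" using H by (rule max)
    then have "verts T = insert (osrc (head D) (tail D) (e, b)) (verts T)" by (metis H_def sub_simps(1))
    then have "osrc (head D) (tail D) (e, b) \<in> verts T" by (metis insertI1)
    then show False using b(2) by simp
  qed
  then show ?thesis using grown_in_tree [OF T', of r] r by simp
qed

end

section \<open>Rational embedding of the vertex lattices and separating forms\<close>

section \<open>Rational linear algebra on trees of lattices\<close>

definition emb :: "('v \<Rightarrow> 'i \<Rightarrow> rat) \<Rightarrow> ('v \<Rightarrow> 'i \<Rightarrow> rat) \<Rightarrow> 'v \<Rightarrow> int \<times> int \<Rightarrow> 'i \<Rightarrow> rat" where
  "emb A B v z = (\<lambda>i. of_int (fst z) * A v i + of_int (snd z) * B v i)"

definition indep :: "('i \<Rightarrow> rat) \<Rightarrow> ('i \<Rightarrow> rat) \<Rightarrow> bool" where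
  "indep x y \<longleftrightarrow> (\<forall>a b. (\<forall>i. a * x i + b * y i = 0) \<longrightarrow> a = 0 \<and> b = 0)"

lemma emb_zmult: "emb A B v (zmult k z) i = of_int k * emb A B v z i"
  by (simp add: emb_def zmult_def algebra_simps)

lemma emb_inj:
  assumes "indep (A v) (B v)" "emb A B v z = emb A B v z'"
  shows "z = z'"
proof -
  have "of_int (fst z - fst z') * A v i + of_int (snd z - snd z') * B v i = 0" for i
    using fun_cong [OF assms(2), of i] by (simp add: emb_def algebra_simps)
  then have "of_int (fst z - fst z') = (0 :: rat) \<and> of_int (snd z - snd z') = (0 :: rat)"
    using assms(1) unfolding indep_def by blast
  then show ?thesis by (simp add: prod_eq_iff)
qed

text \<open>A vector both parallel and orthogonal to a nonzero vector of the plane is zero.\<close>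

lemma sq_sum_eq_0:
  fixes a b p q :: "'a :: linordered_field"
  assumes "a * q = b * p" "a * p + b * q = 0" "p \<noteq> 0 \<or> q \<noteq> 0"
  shows "a = 0 \<and> b = 0"
proof -
  have pq: "p * p + q * q \<noteq> 0" using assms(3) sum_squares_eq_zero_iff by blast
  have "a * (p * p + q * q) = p * (a * p + b * q) + q * (a * q - b * p)"
    "b * (p * p + q * q) = q * (a * p + b * q) - p * (a * q - b * p)"
    by (simp_all add: algebra_simps)
  then have "a * (p * p + q * q) = 0" "b * (p * p + q * q) = 0" using assms(1,2) by simp_all
  then show ?thesis using pq mult_eq_0_iff by blast
qed

text \<open>A vector parallel to \<open>p\<close> is its own orthogonal projection to
  \<open>p\<close>; multiplying by the squared length avoids division.\<close>

lemma det2_zero_proj: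
  assumes "det2 p z = 0"
  shows "zmult (fst p * fst p + snd p * snd p) z = zmult (fst z * fst p + snd z * snd p) p"
proof -
  have *: "fst p * snd z = snd p * fst z" using assms by (simp add: det2_def)
  have "(fst p * fst p + snd p * snd p) * fst z = fst p * (fst p * fst z) + snd p * (fst p * snd z)"
    unfolding * by (simp add: algebra_simps)
  moreover have "(fst p * fst p + snd p * snd p) * snd z = fst p * (snd p * fst z) + snd p * (snd p * snd z)"
    unfolding * [symmetric] by (simp add: algebra_simps)
  ultimately show ?thesis by (simp add: zmult_def algebra_simps)
qed

context lattice_graph_group
begin

text \<open>The vector space is the abelianization of the tree product tensored with the rationals; each
  new vertex contributes one new coordinate.\<close>

lemma tree_embedding:
  assumes "grown T src tgt r S U" and T: "T \<subseteq> Ep" "\<And>e. e \<in> T \<Longrightarrow> st e = \<one>"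
    and nz: "\<And>e. e \<in> Ep \<Longrightarrow> pt e \<noteq> 0 \<and> ph e \<noteq> 0" and r: "r \<in> Vs"
  shows "\<exists>A B :: 'v \<Rightarrow> 'v option \<Rightarrow> rat.
    (\<forall>e\<in>U. emb A B (src e) (pt e) = emb A B (tgt e) (ph e)) \<and>
    (\<forall>v\<in>S. v \<in> Vs \<and> indep (A v) (B v) \<and> (\<forall>w. w \<notin> S \<longrightarrow> A v (Some w) = 0 \<and> B v (Some w) = 0)) \<and>
    (\<forall>v\<in>S. \<forall>w\<in>S. \<forall>z z'. emb A B v z = emb A B w z' \<longrightarrow> (\<exists>k>0. vx v (zmult k z) = vx w (zmult k z')))"
  using assms(1)
proof (induction rule: grown.induct)
  case root
  \<comment> \<open>The root lattice needs two coordinates, \<open>None\<close> and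
    \<open>Some r\<close>.\<close>
  define A B :: "'v \<Rightarrow> 'v option \<Rightarrow> rat"
    where "A = (\<lambda>v i. if i = None then 1 else 0)" and "B = (\<lambda>v i. if i = Some r then 1 else 0)"
  have ind: "indep (A r) (B r)"
    unfolding indep_def
  proof (intro allI impI)
    fix a b assume *: "\<forall>i. a * A r i + b * B r i = 0"
    from *[rule_format, of None] *[rule_format, of "Some r"] show "a = 0 \<and> b = 0"
      by (simp add: A_def B_def)
  qed
  then have "\<exists>k>0. vx r (zmult k z) = vx r (zmult k z')" if "emb A B r z = emb A B r z'" for z z'
    using emb_inj [of A r B z z', OF ind that] by (intro exI [of _ 1]) simp
  with ind r show ?case by (rule_tac exI [of _ A], rule_tac exI [of _ B]) (auto simp: A_def B_def)
next
  case (attach S U a)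
  then obtain A B :: "'v \<Rightarrow> 'v option \<Rightarrow> rat" where
    edge: "\<And>e. e \<in> U \<Longrightarrow> emb A B (src e) (pt e) = emb A B (tgt e) (ph e)" and
    vert: "\<And>v. v \<in> S \<Longrightarrow> v \<in> Vs \<and> indep (A v) (B v)" and
    supp: "\<And>v w. v \<in> S \<Longrightarrow> w \<notin> S \<Longrightarrow> A v (Some w) = 0 \<and> B v (Some w) = 0" and
    rel: "\<And>v w z z'. v \<in> S \<Longrightarrow> w \<in> S \<Longrightarrow> emb A B v z = emb A B w z' \<Longrightarrow>
      \<exists>k>0. vx v (zmult k z) = vx w (zmult k z')"
    by blast
  define e u w where "e = fst a" and "u = osrc src tgt a" and "w = osrc tgt src a"
  define p q where "p = (if snd a then pt e else ph e)" and "q = (if snd a then ph e else pt e)"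
  have e: "e \<in> Ep" "e \<in> T" using attach(2) T by (auto simp: e_def)
  have uw: "u \<in> S" "w \<notin> S" "u \<in> Vs" "w \<in> Vs"
    using attach(3,4) vert ends e by (auto simp: u_def w_def osrc_def e_def)
  have uw_cases: "src e = u \<and> tgt e = w \<and> p = pt e \<and> q = ph e \<or> src e = w \<and> tgt e = u \<and> p = ph e \<and> q = pt e"
    by (auto simp: u_def w_def osrc_def p_def q_def e_def)
  have pq: "p \<noteq> 0" "q \<noteq> 0" using nz [OF e(1)] by (auto simp: p_def q_def)
  have "vx (src e) (pt e) = vx (tgt e) (ph e)"
    using st_rel [OF e(1)] T(2) [OF e(2)] ends [OF e(1)] by simp
  then have slide: "vx u (zmult k p) = vx w (zmult k q)" for k
    using uw_cases ends [OF e(1)] by (auto simp: vx_zmult)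
  define n where "n = fst q * fst q + snd q * snd q"
  have n: "n > 0"
  proof -
    have "fst q \<noteq> 0 \<or> snd q \<noteq> 0" using pq(2) by (auto simp: prod_eq_iff)
    then show ?thesis unfolding n_def using sum_squares_gt_zero_iff by blast
  qed
  define x where "x = emb A B u p"
  \<comment> \<open>A vector at \<open>w\<close> is sent to its normalized inner product with
    \<open>q\<close> times \<open>x\<close>, plus its determinant against \<open>q\<close> in the
    new coordinate \<open>Some w\<close>. Thus \<open>q\<close> goes to \<open>x\<close>, as the
    edge demands, and the determinant keeps the map injective.\<close>
  define A' where "A' = A(w := \<lambda>i. of_int (fst q) / of_int n * x i - (if i = Some w then of_int (snd q) else 0))"
  define B' where "B' = B(w := \<lambda>i. of_int (snd q) / of_int n * x i + (if i = Some w then of_int (fst q) else 0))"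
  have old: "emb A' B' v = emb A B v" "A' v = A v" "B' v = B v" if "v \<in> S" for v
    using that uw(2) by (auto simp: A'_def B'_def emb_def fun_eq_iff)
  have x_w: "x (Some w) = 0" using supp [OF uw(1,2)] by (simp add: x_def emb_def)
  have new: "emb A' B' w z i = of_int (fst z * fst q + snd z * snd q) / of_int n * x i +
      (if i = Some w then of_int (det2 q z) else 0)" for z i
    by (simp add: emb_def A'_def B'_def det2_def add_divide_distrib algebra_simps)
  have "emb A' B' w q i = x i" for i
    using n unfolding new n_def [symmetric] by (simp add: det2_def)
  then have "emb A' B' w q = emb A' B' u p" unfolding old(1) [OF uw(1)] x_def by auto
  then have edge': "emb A' B' (src e) (pt e) = emb A' B' (tgt e) (ph e)" using uw_cases by auto
  have "emb A B u p \<noteq> emb A B u 0" using emb_inj [of A u B p 0] vert [OF uw(1)] pq(1) by blast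
  then obtain j where j: "x j \<noteq> 0" by (auto simp: x_def emb_def fun_eq_iff)
  have indep_w: "indep (A' w) (B' w)"
    unfolding indep_def
  proof (intro allI impI)
    fix a b assume *: "\<forall>i. a * A' w i + b * B' w i = 0"
    have 1: "a * of_int (snd q) = b * of_int (fst q)"
      using *[rule_format, of "Some w"] by (simp add: A'_def B'_def x_w)
    have "j \<noteq> Some w" using j x_w by auto
    then have "(a * of_int (fst q) + b * of_int (snd q)) / of_int n * x j = 0"
      using *[rule_format, of j] by (simp add: A'_def B'_def add_divide_distrib algebra_simps)
    then have 2: "a * of_int (fst q) + b * of_int (snd q) = 0" using j n by simp
    show "a = 0 \<and> b = 0"
      using sq_sum_eq_0 [OF 1 2] pq(2) by (auto simp: prod_eq_iff)
  qed
  have cross: "\<exists>k>0. vx w (zmult k z) = vx v (zmult k z')"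
    if v: "v \<in> S" and eq: "emb A' B' w z = emb A' B' v z'" for v z z'
  proof -
    \<comment> \<open>The new coordinate vanishes at all earlier vertices, so \<open>z\<close> is
      parallel to \<open>q\<close>. The multiple \<open>n\<close> of \<open>z\<close> is then a
      multiple of \<open>q\<close>, which can be moved across the edge to \<open>u\<close>.\<close>
    have "emb A' B' v z' (Some w) = 0"
      using supp [OF v uw(2)] old(2,3) [OF v] by (simp add: emb_def)
    then have det: "det2 q z = 0" using new [of z "Some w"] eq by (simp add: x_w)
    define m where "m = fst z * fst q + snd z * snd q"
    have proj: "zmult n z = zmult m q"
      using det2_zero_proj [OF det] by (simp add: n_def m_def mult.commute)
    have "emb A B v (zmult n z') = emb A B u (zmult m p)"
    proof
      fix i
      have "of_int n * emb A B v z' i = of_int n * emb A' B' w z i" using old(1) [OF v] eq by simp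
      also have "\<dots> = of_int m * x i" using n unfolding new det m_def by simp
      finally show "emb A B v (zmult n z') i = emb A B u (zmult m p) i" by (simp add: emb_zmult x_def)
    qed
    then obtain k where k: "k > 0" "vx v (zmult k (zmult n z')) = vx u (zmult k (zmult m p))"
      using rel [OF v uw(1)] by blast
    have assoc: "zmult k (zmult l y) = zmult (k * l) y" for k l y by (simp add: zmult_def mult.assoc)
    have "vx u (zmult k (zmult m p)) = vx w (zmult k (zmult n z))"
      unfolding proj unfolding assoc by (rule slide)
    then show ?thesis using k n unfolding assoc by (intro exI [of _ "k * n"]) auto
  qed
  have rel': "\<exists>k>0. vx v (zmult k z) = vx v' (zmult k z')"
    if vv: "v \<in> insert w S" "v' \<in> insert w S" and eq: "emb A' B' v z = emb A' B' v' z'" for v v' z z'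
  proof (cases "v = w")
    case True
    show ?thesis
    proof (cases "v' = w")
      case True
      then have "z = z'" using \<open>v = w\<close> eq emb_inj [of A' w B' z z'] indep_w True by simp
      then show ?thesis using \<open>v = w\<close> True by (intro exI [of _ 1]) simp
    next
      case False
      then show ?thesis using cross [of v' z z'] vv eq \<open>v = w\<close> by simp
    qed
  next
    case v: False
    show ?thesis
    proof (cases "v' = w")
      case True
      then obtain k where "k > 0" "vx w (zmult k z') = vx v (zmult k z)"
        using cross [of v z' z] vv eq v by auto
      then show ?thesis using True by (intro exI [of _ k]) simp
    next
      case False
      then have "v \<in> S" "v' \<in> S" using vv v by auto
      then show ?thesis using rel [of v v' z z'] eq by (simp add: old)
    qed
  qed
  have edges': "emb A' B' (src d) (pt d) = emb A' B' (tgt d) (ph d)" if "d \<in> insert e U" for d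
    using that edge' edge old(1) grown_ends [OF attach(1)] by auto
  have vert': "v \<in> Vs \<and> indep (A' v) (B' v)" if "v \<in> insert w S" for v
    using that indep_w uw(4) vert old by auto
  have supp': "A' v (Some w') = 0 \<and> B' v (Some w') = 0" if "v \<in> insert w S" "w' \<notin> insert w S" for v w'
  proof (cases "v = w")
    case True
    have "x (Some w') = 0" using supp [of u w'] uw(1) that by (simp add: x_def emb_def)
    then show ?thesis using True that by (simp add: A'_def B'_def)
  next
    case False
    then show ?thesis using that supp [of v w'] old [of v] by auto
  qed
  show ?case
    unfolding e_def [symmetric] w_def [symmetric]
  proof (rule exI [of _ A'], rule exI [of _ B'], intro conjI ballI allI impI)
    fix d assume "d \<in> insert e U"
    then show "emb A' B' (src d) (pt d) = emb A' B' (tgt d) (ph d)" by (rule edges')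
  next
    fix v assume v: "v \<in> insert w S"
    show "v \<in> Vs" "indep (A' v) (B' v)" using vert' [OF v] by auto
    fix w' assume "w' \<notin> insert w S"
    then show "A' v (Some w') = 0" "B' v (Some w') = 0" using supp' [OF v] by auto
  next
    fix v v' z z' assume "v \<in> insert w S" "v' \<in> insert w S" "emb A' B' v z = emb A' B' v' z'"
    then show "\<exists>k>0. vx v (zmult k z) = vx v' (zmult k z')" by (rule rel')
  qed
qed

end

subsection \<open>Linear forms and involutions\<close>

definition linear_form :: "(('i \<Rightarrow> rat) \<Rightarrow> rat) \<Rightarrow> bool" where
  "linear_form f \<longleftrightarrow> (\<forall>a b x y. f (\<lambda>i. a * x i + b * y i) = a * f x + b * f y)"

lemma linear_formD: "linear_form f \<Longrightarrow> f (\<lambda>i. a * x i + b * y i) = a * f x + b * f y"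
  by (simp add: linear_form_def)

text \<open>Cramer's rule for a nonvanishing minor of \<open>x\<close> and \<open>y\<close> in two
  coordinates \<open>i\<close> and \<open>j\<close>.\<close>

lemma linear_form_ex:
  assumes "indep x y"
  shows "\<exists>f. linear_form f \<and> f x = \<alpha> \<and> f y = \<beta>"
proof -
  obtain i where i: "x i \<noteq> 0"
  proof (rule ccontr)
    assume "\<not> thesis"
    then have "\<forall>i. 1 * x i + 0 * y i = 0" using that by auto
    then show False using assms unfolding indep_def by (metis one_neq_zero)
  qed
  obtain j where j: "- y i * x j + x i * y j \<noteq> 0"
  proof (rule ccontr)
    assume "\<not> thesis"
    then have "\<forall>j. - y i * x j + x i * y j = 0" using that by blast
    then show False using assms i unfolding indep_def by blast
  qed
  define d where "d = - y i * x j + x i * y j"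
  define f where "f u = ((\<alpha> * y j - \<beta> * x j) * u i + (\<beta> * x i - \<alpha> * y i) * u j) / d" for u :: "'a \<Rightarrow> rat"
  have "linear_form f" unfolding linear_form_def f_def by (simp add: add_divide_distrib [symmetric] algebra_simps)
  moreover have "(\<alpha> * y j - \<beta> * x j) * x i + (\<beta> * x i - \<alpha> * y i) * x j = \<alpha> * d"
    "(\<alpha> * y j - \<beta> * x j) * y i + (\<beta> * x i - \<alpha> * y i) * y j = \<beta> * d"
    by (simp_all add: d_def algebra_simps)
  then have "f x = \<alpha>" "f y = \<beta>" using j unfolding d_def [symmetric] by (simp_all add: f_def)
  ultimately show ?thesis by blast
qed

text \<open>For independent vectors this is the reflection along x - y, with a form taking the
  values 1 and -1 at \<open>x\<close> and \<open>y\<close>; otherwise the identity or its negative.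
  Linearity is stated through pulled back forms, the way it is applied.\<close>

lemma swap_ex:
  fixes x y :: "'a \<Rightarrow> rat"
  assumes "indep x y \<or> x = y \<or> x = (\<lambda>i. - y i)"
  shows "\<exists>\<tau>. (\<forall>f. linear_form f \<longrightarrow> linear_form (\<lambda>u. f (\<tau> u))) \<and> \<tau> x = y \<and> \<tau> y = x"
proof -
  consider "x = y" | "x = (\<lambda>i. - y i)" | "indep x y" using assms by blast
  then show ?thesis
  proof cases
    case 1
    then show ?thesis by (intro exI [of _ "\<lambda>u. u"]) simp
  next
    case 2
    have "linear_form (\<lambda>u. f (\<lambda>i. - u i))" if f: "linear_form f" for f :: "('a \<Rightarrow> rat) \<Rightarrow> rat"
      unfolding linear_form_def
    proof (intro allI)
      fix a b and x y :: "'a \<Rightarrow> rat"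
      have "f (\<lambda>i. a * - x i + b * - y i) = a * f (\<lambda>i. - x i) + b * f (\<lambda>i. - y i)"
        by (rule linear_formD [OF f])
      then show "f (\<lambda>i. - (a * x i + b * y i)) = a * f (\<lambda>i. - x i) + b * f (\<lambda>i. - y i)" by simp
    qed
    then show ?thesis using 2 by (intro exI [of _ "\<lambda>u i. - u i"]) auto
  next
    case 3
    then obtain t where t: "linear_form t" "t x = 1" "t y = - 1" using linear_form_ex by blast
    define \<tau> where "\<tau> u = (\<lambda>i. 1 * u i + - t u * (x i - y i))" for u
    have "linear_form (\<lambda>u. f (\<tau> u))" if f: "linear_form f" for f
    proof -
      note lin = linear_formD [OF f] linear_formD [OF t(1)]
      have f\<tau>: "f (\<tau> u) = 1 * f u + - t u * f (\<lambda>i. x i - y i)" for u unfolding \<tau>_def by (rule lin(1))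
      show ?thesis unfolding linear_form_def
      proof (intro allI)
        fix a b and u v :: "'a \<Rightarrow> rat"
        show "f (\<tau> (\<lambda>i. a * u i + b * v i)) = a * f (\<tau> u) + b * f (\<tau> v)"
          unfolding f\<tau> lin(1) [of a u b v] lin(2) [of a u b v] by (simp add: algebra_simps)
      qed
    qed
    moreover have "\<tau> x = y" "\<tau> y = x" using t by (auto simp: \<tau>_def)
    ultimately show ?thesis by blast
  qed
qed

lemma common_denominator:
  assumes "finite (Q :: rat set)"
  shows "\<exists>D>0 :: int. \<forall>q\<in>Q. \<exists>n :: int. of_int D * q = of_int n"
  using assms
proof (induction rule: finite_induct)
  case (insert q Q)
  then obtain D where D: "D > 0" "\<And>q. q \<in> Q \<Longrightarrow> \<exists>n :: int. of_int D * q = of_int n" by blast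
  obtain a b where ab: "q = Fract a b" "b > 0" by (cases q) auto
  have "of_int b * q = of_int a" using ab by (simp add: Fract_of_int_quotient)
  then have "of_int (b * D) * q = of_int (a * D)" by (simp add: algebra_simps)
  then have "\<exists>n :: int. of_int (b * D) * q = of_int n" by blast
  moreover have "\<exists>n :: int. of_int (b * D) * q' = of_int n" if q': "q' \<in> Q" for q'
  proof -
    obtain n where n: "of_int D * q' = (of_int n :: rat)" using D(2) [OF q'] by blast
    have "of_int (b * D) * q' = of_int b * (of_int D * q')" by (simp add: mult.assoc)
    also have "\<dots> = of_int (b * n)" by (simp add: n)
    finally show ?thesis by blast
  qed
  moreover have "b * D > 0" using D(1) ab(2) by simp
  ultimately show ?case by blast
qed (intro exI [of _ 1], simp)

text \<open>The forms with indices \<open>(e, 0)\<close>, \<open>(e, 1)\<close>, \<open>(e, 2)\<close> take the value \<open>1\<close> at \<open>pt e\<close>, and restrict to the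
  determinants against \<open>pt e\<close> and \<open>ph e\<close> at the two ends of \<open>e\<close>; clearing denominators
  multiplies all forms by \<open>N\<close>.\<close>

lemma integral_forms:
  fixes A B :: "'v \<Rightarrow> 'i \<Rightarrow> rat" and src tgt :: "'e \<Rightarrow> 'v"
  assumes fin: "finite Ep" and nz: "\<And>e. e \<in> Ep \<Longrightarrow> pt e \<noteq> 0 \<and> ph e \<noteq> 0"
    and ind: "\<And>e. e \<in> Ep \<Longrightarrow> indep (A (src e)) (B (src e)) \<and> indep (A (tgt e)) (B (tgt e))"
    and \<tau>: "\<And>f. linear_form f \<Longrightarrow> linear_form (\<lambda>u. f (\<tau> u))"
    and edge: "\<And>e. e \<in> Ep \<Longrightarrow> \<not> sg e \<Longrightarrow> emb A B (src e) (pt e) = emb A B (tgt e) (ph e)"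
    and flip: "\<And>e. e \<in> Ep \<Longrightarrow> sg e \<Longrightarrow> \<tau> (emb A B (src e) (pt e)) = emb A B (tgt e) (ph e) \<and>
      \<tau> (emb A B (tgt e) (ph e)) = emb A B (src e) (pt e)"
  shows "\<exists>(F :: ('e \<times> nat) list) ea eb N. raag_target Ep src tgt pt ph F (\<lambda>e. (e, 0)) ea eb sg N"
proof -
  \<comment> \<open>The inner product with \<open>p\<close> divided by its squared length, hence 1
    at \<open>p\<close>.\<close>
  define ip where "ip p z = of_int (fst z * fst p + snd z * snd p) / (of_int (fst p * fst p + snd p * snd p) :: rat)" for p z
  define P where "P f g \<longleftrightarrow> linear_form g \<and>
    (snd f = 0 \<longrightarrow> (\<forall>z. g (emb A B (src (fst f)) z) = ip (pt (fst f)) z)) \<and>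
    (snd f = 1 \<longrightarrow> (\<forall>z. g (emb A B (src (fst f)) z) = of_int (det2 (pt (fst f)) z))) \<and>
    (snd f = 2 \<longrightarrow> (\<forall>z. g (emb A B (tgt (fst f)) z) = of_int (det2 (ph (fst f)) z)))" for f :: "'e \<times> nat" and g
  define FS where "FS = Ep \<times> {0, 1, 2 :: nat}"
  have lin: "g (emb A B v z) = of_int (fst z) * g (A v) + of_int (snd z) * g (B v)" if "linear_form g" for g v z
    unfolding emb_def by (rule linear_formD [OF that])
  have "\<exists>g. P f g" if FS: "f \<in> FS" for f
  proof -
    obtain e j where f: "f = (e, j)" "e \<in> Ep" "j \<in> {0, 1, 2}" using FS unfolding FS_def by blast
    define v where "v = (if j = 2 then tgt e else src e)"
    define p where "p = (if j = 2 then ph e else pt e)"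
    define n where "n = (of_int (fst p * fst p + snd p * snd p) :: rat)"
    define \<alpha> where "\<alpha> = (if j = 0 then of_int (fst p) / n else - of_int (snd p))"
    define \<beta> where "\<beta> = (if j = 0 then of_int (snd p) / n else of_int (fst p))"
    have "indep (A v) (B v)" using ind [OF f(2)] by (simp add: v_def)
    then obtain g where g: "linear_form g" "g (A v) = \<alpha>" "g (B v) = \<beta>" using linear_form_ex by blast
    have "P f g"
      using f(3) lin [OF g(1), of v] g
      by (auto simp: P_def f(1) v_def p_def n_def \<alpha>_def \<beta>_def ip_def det2_def add_divide_distrib)
    then show ?thesis by blast
  qed
  then obtain g where g: "\<And>f. f \<in> FS \<Longrightarrow> P f (g f)" by metis
  \<comment> \<open>The sheet \<open>True\<close> reads each form through the involution.\<close>
  define h where "h i = (if snd i then (\<lambda>u. g (fst i) (\<tau> u)) else g (fst i))" for i :: "('e \<times> nat) \<times> bool"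
  have h: "linear_form (h i)" if "fst i \<in> FS" for i
    using g [OF that] \<tau> by (auto simp: h_def P_def)
  define Q where "Q = (\<lambda>(i, v). h i (A v)) ` ((FS \<times> UNIV) \<times> (src ` Ep \<union> tgt ` Ep)) \<union>
    (\<lambda>(i, v). h i (B v)) ` ((FS \<times> UNIV) \<times> (src ` Ep \<union> tgt ` Ep))"
  have "finite Q" unfolding Q_def FS_def using fin by auto
  then obtain N where N: "N > 0" "\<And>q. q \<in> Q \<Longrightarrow> \<exists>n :: int. of_int N * q = of_int n"
    using common_denominator [OF \<open>finite Q\<close>] by blast
  \<comment> \<open>At endpoints of edges and for indices in \<open>FS\<close> the floor is exact,
    since \<open>N\<close> clears the denominators of all values in \<open>Q\<close>.\<close>
  define ea where "ea i v = \<lfloor>of_int N * h i (A v)\<rfloor>" for i v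
  define eb where "eb i v = \<lfloor>of_int N * h i (B v)\<rfloor>" for i v
  have ell: "of_int (ea i v * fst z + eb i v * snd z) = of_int N * h i (emb A B v z)"
    if i: "fst i \<in> FS" and v: "v \<in> src ` Ep \<union> tgt ` Ep" for i v z
  proof -
    have iv: "(i, v) \<in> (FS \<times> UNIV) \<times> (src ` Ep \<union> tgt ` Ep)" using i v by (cases i) auto
    have "h i (A v) \<in> Q" unfolding Q_def by (rule UnI1, rule image_eqI [OF _ iv]) simp
    moreover have "h i (B v) \<in> Q" unfolding Q_def by (rule UnI2, rule image_eqI [OF _ iv]) simp
    ultimately obtain m n where "of_int N * h i (A v) = of_int m" "of_int N * h i (B v) = of_int n"
      using N(2) by meson
    then have "of_int (ea i v) = of_int N * h i (A v)" "of_int (eb i v) = of_int N * h i (B v)"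
      by (simp_all add: ea_def eb_def)
    then show ?thesis by (simp add: lin [OF h [OF i]] algebra_simps)
  qed
  obtain F where F: "set F = FS" "distinct F"
    using finite_distinct_list [of FS] fin by (auto simp: FS_def)
  have eq: "ea i v * fst z + eb i v * snd z = ea j w * fst y + eb j w * snd y \<longleftrightarrow>
      h i (emb A B v z) = h j (emb A B w y)"
    if "fst i \<in> FS" "fst j \<in> FS" "v \<in> src ` Ep \<union> tgt ` Ep" "w \<in> src ` Ep \<union> tgt ` Ep" for i j v w z y
  proof -
    have "ea i v * fst z + eb i v * snd z = ea j w * fst y + eb j w * snd y \<longleftrightarrow>
      (of_int (ea i v * fst z + eb i v * snd z) :: rat) = of_int (ea j w * fst y + eb j w * snd y)"
      by (simp only: of_int_eq_iff)
    also have "\<dots> \<longleftrightarrow> h i (emb A B v z) = h j (emb A B w y)"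
      unfolding ell [OF that(1,3)] ell [OF that(2,4)] using N(1) by simp
    finally show ?thesis .
  qed
  have zero: "ea i v * fst z + eb i v * snd z = 0 \<longleftrightarrow> h i (emb A B v z) = 0"
    if "fst i \<in> FS" "v \<in> src ` Ep \<union> tgt ` Ep" for i v z
  proof -
    have "ea i v * fst z + eb i v * snd z = 0 \<longleftrightarrow> (of_int (ea i v * fst z + eb i v * snd z) :: rat) = 0"
      by (simp only: of_int_eq_0_iff)
    then show ?thesis unfolding ell [OF that] using N(1) by simp
  qed
  have "raag_target Ep src tgt pt ph F (\<lambda>e. (e, 0)) ea eb sg N"
  proof
    fix e assume e: "e \<in> Ep"
    have FS: "(e, 0) \<in> FS" "(e, 1) \<in> FS" "(e, 2) \<in> FS" using e by (auto simp: FS_def)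
    have ends: "src e \<in> src ` Ep \<union> tgt ` Ep" "tgt e \<in> src ` Ep \<union> tgt ` Ep" using e by auto
    show "(e, 0) \<in> set F" using FS F by simp
    have "fst (pt e) \<noteq> 0 \<or> snd (pt e) \<noteq> 0" using nz [OF e] by (auto simp: prod_eq_iff)
    then have "fst (pt e) * fst (pt e) + snd (pt e) * snd (pt e) \<noteq> 0"
      using sum_squares_eq_zero_iff by blast
    then have "ip (pt e) (pt e) = 1" unfolding ip_def by (simp flip: of_int_mult of_int_add)
    then have "h ((e, 0), False) (emb A B (src e) (pt e)) = 1"
      using g [OF FS(1)] unfolding P_def h_def fst_conv snd_conv if_False by metis
    then have "(of_int (ea ((e, 0), False) (src e) * fst (pt e) + eb ((e, 0), False) (src e) * snd (pt e)) :: rat) = of_int N"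
      using ell [of "((e, 0), False)" "src e" "pt e"] FS(1) ends by simp
    then show "ea ((e, 0), False) (src e) * fst (pt e) + eb ((e, 0), False) (src e) * snd (pt e) = N"
      by (simp only: of_int_eq_iff)
    show "pt e \<noteq> 0" "ph e \<noteq> 0" using nz [OF e] by auto
    show "\<exists>f\<in>set F. \<forall>z. (ea (f, False) (src e) * fst z + eb (f, False) (src e) * snd z = 0) = (det2 (pt e) z = 0)"
      using zero [of "((e, 1), False)" "src e"] FS(2) ends g [OF FS(2)] F(1)
      by (intro bexI [of _ "(e, 1)"]) (auto simp: P_def h_def)
    show "\<exists>f\<in>set F. \<forall>z. (ea (f, False) (tgt e) * fst z + eb (f, False) (tgt e) * snd z = 0) = (det2 (ph e) z = 0)"
      using zero [of "((e, 2), False)" "tgt e"] FS(3) ends g [OF FS(3)] F(1)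
      by (intro bexI [of _ "(e, 2)"]) (auto simp: P_def h_def)
    fix f b assume "f \<in> set F"
    then have f: "f \<in> FS" using F by simp
    \<comment> \<open>On an edge with \<open>sg e\<close> the involution exchanges the end vectors,
      so the change of sheet makes up for passing to the other end.\<close>
    have "h (f, b) (emb A B (src e) (pt e)) = h (f, b \<noteq> sg e) (emb A B (tgt e) (ph e))"
      using edge [OF e] flip [OF e] by (cases "sg e"; cases b) (auto simp: h_def)
    then show "ea (f, b) (src e) * fst (pt e) + eb (f, b) (src e) * snd (pt e) =
        ea (f, b \<noteq> sg e) (tgt e) * fst (ph e) + eb (f, b \<noteq> sg e) (tgt e) * snd (ph e)"
      using eq [of "(f, b)" "(f, b \<noteq> sg e)"] f ends by simp
  qed (use fin F N in auto)
  then show ?thesis by blast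
qed

section \<open>Passage to the presented fundamental group and the balanced case\<close>

section \<open>Transport along injective homomorphisms\<close>

lemma balanced_mon:
  assumes "group K" "group G" "f \<in> mon K G" "balanced G"
  shows "balanced K"
proof -
  interpret K: group K by fact
  interpret G: group G by fact
  interpret f: group_hom K G f using assms(3) by unfold_locales (simp add: mon_def)
  have inj: "x = y" if "f x = f y" "x \<in> carrier K" "y \<in> carrier K" for x y
    using assms(3) that by (auto simp: mon_def dest: inj_onD)
  show ?thesis
    unfolding balanced_def
  proof (intro ballI impI allI; elim bexE)
    fix g h and k l :: int
    assume g: "g \<in> carrier K" "K.ord g = 0" and kl: "k \<noteq> 0" "l \<noteq> 0" and h: "h \<in> carrier K"
      and eq: "h \<otimes>\<^bsub>K\<^esub> g [^]\<^bsub>K\<^esub> k \<otimes>\<^bsub>K\<^esub> inv\<^bsub>K\<^esub> h = g [^]\<^bsub>K\<^esub> l"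
    have "f g [^]\<^bsub>G\<^esub> n \<noteq> \<one>\<^bsub>G\<^esub>" if "n \<noteq> 0" for n :: nat
    proof
      assume "f g [^]\<^bsub>G\<^esub> n = \<one>\<^bsub>G\<^esub>"
      then have "f (g [^]\<^bsub>K\<^esub> n) = f \<one>\<^bsub>K\<^esub>" using g f.hom_nat_pow by simp
      then have "g [^]\<^bsub>K\<^esub> n = \<one>\<^bsub>K\<^esub>" using g by (intro inj) auto
      then show False using K.ord_eq_0 g that by auto
    qed
    then have "G.ord (f g) = 0" using G.ord_eq_0 g f.hom_closed by blast
    moreover have "f h \<otimes>\<^bsub>G\<^esub> f g [^]\<^bsub>G\<^esub> k \<otimes>\<^bsub>G\<^esub> inv\<^bsub>G\<^esub> (f h) = f g [^]\<^bsub>G\<^esub> l"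
      using arg_cong [OF eq, of f] g h f.hom_int_pow by simp
    ultimately show "l = k \<or> l = - k"
      using assms(4) kl g h f.hom_closed unfolding balanced_def by blast
  qed
qed

text \<open>Cosets of the preimage of \<open>H\<close> are preimages of cosets of \<open>H\<close>,
  so the index stays finite.\<close>

lemma virtually_special_mon:
  assumes "group G" "group K" "f \<in> mon G K" "virtually_special K"
  shows "virtually_special G"
proof -
  interpret G: group G by fact
  interpret K: group K by fact
  interpret f: group_hom G K f using assms(3) by unfold_locales (simp add: mon_def)
  have inj: "inj_on f (carrier G)" using assms(3) by (simp add: mon_def)
  obtain H X E \<phi> where H: "subgroup H K" "finite (rcosets\<^bsub>K\<^esub> H)" and X: "simplicial_graph (X :: nat set) E"
    "fin_gen_group (raag X E)" and \<phi>: "\<phi> \<in> mon (K\<lparr>carrier := H\<rparr>) (raag X E)"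
    using assms(4) unfolding virtually_special_def by blast
  define H' where "H' = {x \<in> carrier G. f x \<in> H}"
  have H': "subgroup H' G"
  proof (rule G.subgroupI)
    show "H' \<noteq> {}" using subgroup.one_closed [OF H(1)] f.hom_one by (auto simp: H'_def intro!: exI [of _ "\<one>\<^bsub>G\<^esub>"])
    show "inv\<^bsub>G\<^esub> x \<in> H'" if "x \<in> H'" for x
      using that subgroup.m_inv_closed [OF H(1)] by (auto simp: H'_def)
    show "x \<otimes>\<^bsub>G\<^esub> y \<in> H'" if "x \<in> H'" "y \<in> H'" for x y
      using that subgroup.m_closed [OF H(1)] by (auto simp: H'_def)
  qed (auto simp: H'_def)
  have coset: "H' #>\<^bsub>G\<^esub> x = {y \<in> carrier G. f y \<in> H #>\<^bsub>K\<^esub> f x}" if x: "x \<in> carrier G" for x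
  proof (intro equalityI subsetI)
    fix y assume "y \<in> H' #>\<^bsub>G\<^esub> x"
    then show "y \<in> {y \<in> carrier G. f y \<in> H #>\<^bsub>K\<^esub> f x}"
      using x by (auto simp: r_coset_def H'_def)
  next
    fix y assume "y \<in> {y \<in> carrier G. f y \<in> H #>\<^bsub>K\<^esub> f x}"
    then obtain h where y: "y \<in> carrier G" "h \<in> H" "f y = h \<otimes>\<^bsub>K\<^esub> f x" by (auto simp: r_coset_def)
    have hK: "h \<in> carrier K" using y(2) subgroup.mem_carrier [OF H(1)] by blast
    have "f (y \<otimes>\<^bsub>G\<^esub> inv\<^bsub>G\<^esub> x) = h" using x y hK by (simp add: K.m_assoc)
    then have "y \<otimes>\<^bsub>G\<^esub> inv\<^bsub>G\<^esub> x \<in> H'" using x y by (simp add: H'_def)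
    moreover have "y = y \<otimes>\<^bsub>G\<^esub> inv\<^bsub>G\<^esub> x \<otimes>\<^bsub>G\<^esub> x" using x y by (simp add: G.m_assoc)
    ultimately show "y \<in> H' #>\<^bsub>G\<^esub> x" unfolding r_coset_def by blast
  qed
  have "rcosets\<^bsub>G\<^esub> H' \<subseteq> (\<lambda>C. {y \<in> carrier G. f y \<in> C}) ` (rcosets\<^bsub>K\<^esub> H)"
  proof
    fix C assume "C \<in> rcosets\<^bsub>G\<^esub> H'"
    then obtain x where x: "x \<in> carrier G" "C = H' #>\<^bsub>G\<^esub> x" by (auto simp: RCOSETS_def)
    have "H #>\<^bsub>K\<^esub> f x \<in> rcosets\<^bsub>K\<^esub> H" using x(1) by (auto simp: RCOSETS_def)
    then show "C \<in> (\<lambda>C. {y \<in> carrier G. f y \<in> C}) ` (rcosets\<^bsub>K\<^esub> H)"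
      unfolding x(2) coset [OF x(1)] by (rule imageI)
  qed
  then have fin: "finite (rcosets\<^bsub>G\<^esub> H')" using H(2) by (meson finite_imageI finite_subset)
  have hom: "f \<in> hom (G\<lparr>carrier := H'\<rparr>) (K\<lparr>carrier := H\<rparr>)"
    by (rule homI) (auto simp: H'_def)
  have "\<phi> \<circ> f \<in> hom (G\<lparr>carrier := H'\<rparr>) (raag X E)"
    using hom_compose [OF hom, of \<phi> "raag X E"] \<phi> by (simp add: mon_def)
  moreover have "inj_on (\<phi> \<circ> f) H'"
  proof (rule comp_inj_on)
    show "inj_on f H'" using inj by (rule inj_on_subset) (auto simp: H'_def)
    have "inj_on \<phi> H" using \<phi> by (simp add: mon_def)
    then show "inj_on \<phi> (f ` H')" by (rule inj_on_subset) (auto simp: H'_def)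
  qed
  ultimately have "\<phi> \<circ> f \<in> mon (G\<lparr>carrier := H'\<rparr>) (raag X E)" by (simp add: mon_def)
  then show ?thesis unfolding virtually_special_def using H' fin X by blast
qed


section \<open>The fundamental group of a tubular graph of groups\<close>

context lattice_graph_group
begin

definition connects :: "'v \<Rightarrow> 'g \<Rightarrow> 'v \<Rightarrow> bool" where
  "connects v g w \<longleftrightarrow> (\<exists>p z. is_path v p w \<and> path_val v p z = g)"

lemma connects_mult:
  "connects u g v \<Longrightarrow> connects v h w \<Longrightarrow> u \<in> Vs \<Longrightarrow> connects u (g \<otimes> h) w"
  unfolding connects_def using path_val_append by metis

lemma connects_vx: "connects v (vx v z) v"
  unfolding connects_def by (rule exI [of _ "[]"], rule exI [of _ z]) simp

lemma connects_one: "v \<in> Vs \<Longrightarrow> connects v \<one> v"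
  using connects_vx [of v 0] by (simp add: vx_zero)

lemma connects_arc:
  assumes "fst a \<in> Ep" shows "connects (arc_src a) (arc_val a) (arc_tgt a)"
  unfolding connects_def
  by (rule exI [of _ "[(0, a)]"], rule exI [of _ 0]) (use assms arc_ends in \<open>simp add: vx_zero\<close>)

text \<open>Crossing a tree edge contributes a trivial stable letter, so moving between a vertex and
  the root inside the tree costs nothing.\<close>

lemma connects_tree:
  assumes "grown T src tgt r S U" "T \<subseteq> Ep" "\<And>e. e \<in> T \<Longrightarrow> st e = \<one>" "r \<in> Vs"
  shows "\<forall>v\<in>S. v \<in> Vs \<and> connects r \<one> v \<and> connects v \<one> r"
  using assms(1)
proof (induction rule: grown.induct)
  case root
  then show ?case using assms(4) connects_one by auto
next
  case (attach S U a)
  let ?u = "osrc src tgt a" and ?w = "osrc tgt src a"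
  have a: "fst a \<in> Ep" "arc_src a = ?u" "arc_tgt a = ?w" "arc_val a = \<one>" "arc_val (arc_rev a) = \<one>"
    using attach(2) assms(2,3) by (auto simp: arc_src_def arc_tgt_def osrc_def arc_val_def arc_rev_def)
  have uw: "connects ?u \<one> ?w" "connects ?w \<one> ?u"
    using connects_arc [of a] connects_arc [of "arc_rev a"] a by auto
  have "?w \<in> Vs" using a arc_ends [of a] by simp
  moreover have "connects r \<one> ?u" "connects ?u \<one> r" using attach by auto
  ultimately show ?case
    using attach uw connects_mult [of r \<one> ?u \<one> ?w] connects_mult [of ?w \<one> ?u \<one> r] assms(4) by auto
qed

end

lemma free_Abelian_group_2:
  assumes "group G" "G \<cong> free_Abelian_group {..<2 :: nat}"
  shows "\<exists>f. bij_betw f (UNIV :: (int \<times> int) set) (carrier G) \<and> (\<forall>z z'. f (z + z') = f z \<otimes>\<^bsub>G\<^esub> f z')"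
proof -
  let ?F = "free_Abelian_group {..<2 :: nat}"
  obtain h where h: "h \<in> hom G ?F" "bij_betw h (carrier G) (carrier ?F)"
    using assms(2) by (auto simp: is_iso_def iso_def)
  define c where "c x = (Poly_Mapping.lookup (h x) 0, Poly_Mapping.lookup (h x) 1)" for x
  have add: "c (x \<otimes>\<^bsub>G\<^esub> y) = c x + c y" if "x \<in> carrier G" "y \<in> carrier G" for x y
    using h(1) that by (simp add: c_def hom_def lookup_add)
  have "inj_on c (carrier G)"
  proof (rule inj_onI)
    fix x y assume xy: "x \<in> carrier G" "y \<in> carrier G" "c x = c y"
    have zero: "Poly_Mapping.lookup (h x) i = 0" if "x \<in> carrier G" "2 \<le> i" for x i
    proof -
      have "h x \<in> carrier ?F" using bij_betwE [OF h(2)] that(1) by blast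
      then have "Poly_Mapping.keys (h x) \<subseteq> {..<2}" by simp
      then have "i \<notin> Poly_Mapping.keys (h x)" using that(2) by (meson lessThan_iff not_le subsetD)
      then show ?thesis by (simp add: in_keys_iff)
    qed
    have "Poly_Mapping.lookup (h x) i = Poly_Mapping.lookup (h y) i" for i
    proof -
      consider "i = 0" | "i = 1" | "2 \<le> i" by linarith
      then show ?thesis using zero xy by cases (simp_all add: c_def)
    qed
    then have "h x = h y" by (rule poly_mapping_eqI)
    then show "x = y" using inj_onD [OF bij_betw_imp_inj_on [OF h(2)]] xy(1,2) by blast
  qed
  moreover have "z \<in> c ` carrier G" for z
  proof -
    define m where "m = Poly_Mapping.single (0 :: nat) (fst z) + Poly_Mapping.single 1 (snd z)"
    have "m \<in> carrier ?F"
      unfolding m_def using keys_add [of "Poly_Mapping.single (0 :: nat) (fst z)" "Poly_Mapping.single 1 (snd z)"]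
      by (auto split: if_splits)
    then have "m \<in> h ` carrier G" using bij_betw_imp_surj_on [OF h(2)] by simp
    then obtain x where x: "x \<in> carrier G" "h x = m" by blast
    then have "c x = z" by (simp add: c_def m_def lookup_add lookup_single when_def prod_eq_iff)
    then show ?thesis using x by blast
  qed
  ultimately have c: "bij_betw c (carrier G) UNIV" by (auto simp: bij_betw_def)
  define f where "f = inv_into (carrier G) c"
  have f: "f z \<in> carrier G" "c (f z) = z" for z
    using c by (auto simp: f_def bij_betw_def inv_into_into f_inv_into_f)
  have "bij_betw f UNIV (carrier G)" unfolding f_def using c by (rule bij_betw_inv_into)
  moreover have "f (z + z') = f z \<otimes>\<^bsub>G\<^esub> f z'" for z z'
  proof -
    have "f z \<otimes>\<^bsub>G\<^esub> f z' \<in> carrier G" using f(1) group.is_monoid [OF assms(1)] by (intro monoid.m_closed) auto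
    moreover have "c (f z \<otimes>\<^bsub>G\<^esub> f z') = c (f (z + z'))" using f add by simp
    ultimately show ?thesis using inj_onD [OF \<open>inj_on c (carrier G)\<close>] f(1) by metis
  qed
  ultimately show ?thesis by (intro exI [of _ f] conjI allI)
qed

locale tubular_graph =
  fixes \<G> :: "('v, 'e, 'a, 'b) graph_of_groups" and T :: "('v, 'e) pre_digraph" and Ep :: "'e set"
  assumes tubular: "tubular_graph_of_groups \<G>"
    and max_tree: "maximal_tree (ugraph \<G>) (einv \<G>) T"
    and orient': "orientation (ugraph \<G>) (einv \<G>) Ep"
begin

abbreviation "D \<equiv> ugraph \<G>"

lemma fgog: "finite_graph_of_groups \<G>"
  using tubular by (simp add: tubular_graph_of_groups_def)

sublocale oriented_graph D "einv \<G>" Ep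
  using fgog orient' by (simp add: oriented_graph_def oriented_graph_axioms_def finite_graph_of_groups_def)

lemma conn: "connected D"
  using fgog by (simp add: finite_graph_of_groups_def)

lemma group_vgroup: "v \<in> verts D \<Longrightarrow> group (vgroup \<G> v)"
  using fgog by (simp add: finite_graph_of_groups_def)

definition lv :: "'v \<Rightarrow> int \<times> int \<Rightarrow> 'a" where
  "lv v = (SOME f. bij_betw f UNIV (carrier (vgroup \<G> v)) \<and> (\<forall>z z'. f (z + z') = f z \<otimes>\<^bsub>vgroup \<G> v\<^esub> f z'))"

lemma lv:
  assumes "v \<in> verts D"
  shows "bij_betw (lv v) UNIV (carrier (vgroup \<G> v))" and "lv v (z + z') = lv v z \<otimes>\<^bsub>vgroup \<G> v\<^esub> lv v z'"
proof -
  have "vgroup \<G> v \<cong> free_Abelian_group {..<2 :: nat}"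
    using tubular assms by (simp add: tubular_graph_of_groups_def)
  note * = someI_ex [OF free_Abelian_group_2 [OF group_vgroup [OF assms] this], folded lv_def]
  show "bij_betw (lv v) UNIV (carrier (vgroup \<G> v))" by (rule conjunct1 [OF *])
  show "lv v (z + z') = lv v z \<otimes>\<^bsub>vgroup \<G> v\<^esub> lv v z'" by (rule conjunct2 [OF *, rule_format])
qed

lemma lv_closed: "v \<in> verts D \<Longrightarrow> lv v z \<in> carrier (vgroup \<G> v)"
  using lv(1) [of v] by (auto simp: bij_betw_def)

lemma lv_inv: "v \<in> verts D \<Longrightarrow> inv_into UNIV (lv v) (lv v z) = z"
  using lv(1) [of v] by (simp add: bij_betw_def)

lemma lv_cases:
  assumes "v \<in> verts D" "g \<in> carrier (vgroup \<G> v)"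
  obtains z where "g = lv v z"
proof -
  have "g \<in> range (lv v)" using lv(1) [OF assms(1)] assms(2) by (simp add: bij_betw_def)
  then show ?thesis using that by blast
qed

lemma lv_zmult: "v \<in> verts D \<Longrightarrow> lv v (zmult k z) = lv v z [^]\<^bsub>vgroup \<G> v\<^esub> k"
  by (rule group.additive_zmult [OF group_vgroup]) (auto simp: lv_closed lv(2))

text \<open>The generator depends on the group, not on the edge. As an edge and its inverse share
  their edge group, \<open>vec\<close> uses the same generator at both ends.\<close>

definition eg :: "'b monoid \<Rightarrow> 'b" where
  "eg C = (SOME x. x \<in> carrier C \<and> carrier C = range (\<lambda>n :: int. x [^]\<^bsub>C\<^esub> n))"

lemma eg:
  assumes "e \<in> arcs D"
  shows "eg (egroup \<G> e) \<in> carrier (egroup \<G> e)"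
    and "carrier (egroup \<G> e) = range (\<lambda>n :: int. eg (egroup \<G> e) [^]\<^bsub>egroup \<G> e\<^esub> n)"
proof -
  have "group (egroup \<G> e)" using fgog assms by (simp add: finite_graph_of_groups_def)
  moreover have "cyclic_group (egroup \<G> e)" using tubular assms by (simp add: tubular_graph_of_groups_def)
  ultimately have "\<exists>x. x \<in> carrier (egroup \<G> e) \<and> carrier (egroup \<G> e) = range (\<lambda>n :: int. x [^]\<^bsub>egroup \<G> e\<^esub> n)"
    using group.cyclic_group by blast
  from someI_ex [OF this, folded eg_def] show "eg (egroup \<G> e) \<in> carrier (egroup \<G> e)"
    "carrier (egroup \<G> e) = range (\<lambda>n :: int. eg (egroup \<G> e) [^]\<^bsub>egroup \<G> e\<^esub> n)" by auto
qed

definition vec :: "'e \<Rightarrow> int \<times> int" where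
  "vec e = inv_into UNIV (lv (tail D e)) (emono \<G> e (eg (egroup \<G> e)))"

lemma emono_mon: "e \<in> arcs D \<Longrightarrow> emono \<G> e \<in> mon (egroup \<G> e) (vgroup \<G> (tail D e))"
  using fgog by (simp add: finite_graph_of_groups_def)

lemma group_egroup: "e \<in> arcs D \<Longrightarrow> group (egroup \<G> e)"
  using fgog by (simp add: finite_graph_of_groups_def)

lemma emono_pow:
  assumes e: "e \<in> arcs D"
  shows "emono \<G> e (eg (egroup \<G> e) [^]\<^bsub>egroup \<G> e\<^esub> k) = lv (tail D e) (zmult k (vec e))"
proof -
  have hom: "emono \<G> e \<in> hom (egroup \<G> e) (vgroup \<G> (tail D e))"
    using emono_mon [OF e] by (simp add: mon_def)
  have v: "tail D e \<in> verts D" using e by simp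
  have "emono \<G> e (eg (egroup \<G> e)) \<in> carrier (vgroup \<G> (tail D e))"
    using hom_in_carrier [OF hom eg(1) [OF e]] .
  then have "lv (tail D e) (vec e) = emono \<G> e (eg (egroup \<G> e))"
    unfolding vec_def by (rule lv_cases [OF v]) (simp only: lv_inv [OF v])
  moreover have "emono \<G> e (eg (egroup \<G> e) [^]\<^bsub>egroup \<G> e\<^esub> k) = emono \<G> e (eg (egroup \<G> e)) [^]\<^bsub>vgroup \<G> (tail D e)\<^esub> k"
    by (rule hom_int_pow) (use hom eg(1) [OF e] group_egroup [OF e] group_vgroup [OF v] in auto)
  ultimately show ?thesis by (simp add: lv_zmult [OF v])
qed

text \<open>A zero vector would make the edge monomorphism constant, although the edge group is
  infinite.\<close>

lemma vec_nz:
  assumes e: "e \<in> arcs D" shows "vec e \<noteq> 0"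
proof
  assume "vec e = 0"
  then have *: "emono \<G> e (eg (egroup \<G> e) [^]\<^bsub>egroup \<G> e\<^esub> k) = lv (tail D e) 0" for k :: int
    using emono_pow [OF e, of k] by (simp add: zmult_def zero_prod_def)
  note mon = emono_mon [OF e]
  have "x = y" if "x \<in> carrier (egroup \<G> e)" "y \<in> carrier (egroup \<G> e)" for x y
  proof -
    have "emono \<G> e x = emono \<G> e y" using that * unfolding eg(2) [OF e] by auto
    then show ?thesis using mon that by (auto simp: mon_def dest: inj_onD)
  qed
  then have "carrier (egroup \<G> e) \<subseteq> {eg (egroup \<G> e)}" using eg(1) [OF e] by auto
  moreover have "infinite (carrier (egroup \<G> e))"
    using tubular e by (simp add: tubular_graph_of_groups_def)
  ultimately show False using finite_subset by blast
qed

definition pt :: "'e \<Rightarrow> int \<times> int" where "pt e = vec e"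
definition ph :: "'e \<Rightarrow> int \<times> int" where "ph e = vec (einv \<G> e)"

lemma egroup_einv: "e \<in> arcs D \<Longrightarrow> egroup \<G> (einv \<G> e) = egroup \<G> e"
  using fgog by (simp add: finite_graph_of_groups_def)

definition fg_gens :: "('v, 'e, 'a) gog_generator set" where
  "fg_gens = {VertexElt v g | v g. v \<in> verts D \<and> g \<in> carrier (vgroup \<G> v)} \<union> StableLetter ` Ep"

definition fg_rels :: "(('v, 'e, 'a) gog_generator gword \<times> ('v, 'e, 'a) gog_generator gword) set" where
  "fg_rels = {([(VertexElt v g, True), (VertexElt v h, True)], [(VertexElt v (g \<otimes>\<^bsub>vgroup \<G> v\<^esub> h), True)])
        | v g h. v \<in> verts D \<and> g \<in> carrier (vgroup \<G> v) \<and> h \<in> carrier (vgroup \<G> v)} \<union>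
      {([(StableLetter e, True), (VertexElt (head D e) (emono \<G> (einv \<G> e) a), True),
           (StableLetter e, False)],
         [(VertexElt (tail D e) (emono \<G> e a), True)])
        | e a. e \<in> Ep \<and> a \<in> carrier (egroup \<G> e)} \<union>
      {([(StableLetter e, True)], []) | e. e \<in> arcs T \<inter> Ep}"

definition "FG = fundamental_group \<G> T Ep"

lemma FG_altdef: "FG = presented_group fg_gens fg_rels"
  by (simp add: FG_def fundamental_group_def fg_gens_def fg_rels_def)

sublocale FG: group FG
  unfolding FG_altdef by (rule group_presented_group)

definition vx :: "'v \<Rightarrow> int \<times> int \<Rightarrow> ('v, 'e, 'a) gog_generator gword set" where
  "vx v z = pres_class fg_gens fg_rels [(VertexElt v (lv v z), True)]"

definition st :: "'e \<Rightarrow> ('v, 'e, 'a) gog_generator gword set" where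
  "st e = pres_class fg_gens fg_rels [(StableLetter e, True)]"

lemma rel_eq:
  assumes "(r, s) \<in> fg_rels" "r \<in> gwords fg_gens" "s \<in> gwords fg_gens"
  shows "pres_class fg_gens fg_rels r = pres_class fg_gens fg_rels s"
  using pres_eq.relation [of "[]" fg_gens "[]" r s fg_rels] assms by (simp add: pres_class_eq_iff)

lemma VertexElt_gens: "v \<in> verts D \<Longrightarrow> g \<in> carrier (vgroup \<G> v) \<Longrightarrow> VertexElt v g \<in> fg_gens"
  by (simp add: fg_gens_def)

lemma StableLetter_gens: "e \<in> Ep \<Longrightarrow> StableLetter e \<in> fg_gens"
  by (simp add: fg_gens_def)

sublocale L: lattice_graph_group FG "verts D" Ep "tail D" "head D" pt ph vx st
proof
  fix e assume e: "e \<in> Ep"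
  then have eD: "e \<in> arcs D" using Ep_arcs by auto
  then show "tail D e \<in> verts D" "head D e \<in> verts D" by auto
  show "st e \<in> carrier FG"
    using e by (auto simp: st_def FG_altdef presented_group_carrier StableLetter_gens)
  let ?x = "lv (head D e) (ph e)" and ?y = "lv (tail D e) (pt e)"
  have fg_gens: "VertexElt (head D e) ?x \<in> fg_gens" "VertexElt (tail D e) ?y \<in> fg_gens" "StableLetter e \<in> fg_gens"
    using eD e by (auto intro!: VertexElt_gens StableLetter_gens lv_closed)
  have one: "zmult 1 z = z" for z by (simp add: zmult_def)
  let ?a = "eg (egroup \<G> e) [^]\<^bsub>egroup \<G> e\<^esub> (1 :: int)"
  have "?x = emono \<G> (einv \<G> e) ?a" "?y = emono \<G> e ?a"
    using emono_pow [of "einv \<G> e" 1] emono_pow [of e 1] eD by (simp_all add: pt_def ph_def egroup_einv one)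
  moreover have "?a \<in> carrier (egroup \<G> e)" unfolding eg(2) [OF eD] by blast
  ultimately have "([(StableLetter e, True), (VertexElt (head D e) ?x, True), (StableLetter e, False)],
      [(VertexElt (tail D e) ?y, True)]) \<in> fg_rels"
    unfolding fg_rels_def using e by blast
  then have "pres_class fg_gens fg_rels [(StableLetter e, True), (VertexElt (head D e) ?x, True), (StableLetter e, False)] =
      pres_class fg_gens fg_rels [(VertexElt (tail D e) ?y, True)]"
    by (rule rel_eq) (use fg_gens in simp_all)
  then have "st e \<otimes>\<^bsub>FG\<^esub> (vx (head D e) (ph e) \<otimes>\<^bsub>FG\<^esub> inv\<^bsub>FG\<^esub> (st e)) = vx (tail D e) (pt e)"
    using fg_gens by (simp add: FG_altdef st_def vx_def presented_group_letter_inv presented_group_mult)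
  moreover have "vx (head D e) (ph e) \<in> carrier FG" "vx (tail D e) (pt e) \<in> carrier FG" "st e \<in> carrier FG"
    using fg_gens by (auto simp: st_def vx_def FG_altdef presented_group_carrier)
  ultimately show "st e \<otimes>\<^bsub>FG\<^esub> vx (head D e) (ph e) = vx (tail D e) (pt e) \<otimes>\<^bsub>FG\<^esub> st e"
    by (simp add: FG.m_assoc [symmetric] FG.inv_solve_right')
next
  fix v z z' assume v: "v \<in> verts D"
  have fg_gens: "VertexElt v (lv v z) \<in> fg_gens" for z using v by (intro VertexElt_gens lv_closed)
  then show "vx v z \<in> carrier FG"
    by (auto simp: vx_def FG_altdef presented_group_carrier)
  have "([(VertexElt v (lv v z), True), (VertexElt v (lv v z'), True)],
      [(VertexElt v (lv v z \<otimes>\<^bsub>vgroup \<G> v\<^esub> lv v z'), True)]) \<in> fg_rels"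
    unfolding fg_rels_def using v lv_closed [OF v] by blast
  then have "([(VertexElt v (lv v z), True), (VertexElt v (lv v z'), True)],
      [(VertexElt v (lv v (z + z')), True)]) \<in> fg_rels"
    using lv(2) [OF v] by simp
  then have "pres_class fg_gens fg_rels [(VertexElt v (lv v z), True), (VertexElt v (lv v z'), True)] =
    pres_class fg_gens fg_rels [(VertexElt v (lv v (z + z')), True)]"
    by (rule rel_eq) (use fg_gens in simp_all)
  then show "vx v (z + z') = vx v z \<otimes>\<^bsub>FG\<^esub> vx v z'"
    using fg_gens by (simp add: vx_def FG_altdef presented_group_mult)
qed

lemma st_tree: "e \<in> arcs T \<inter> Ep \<Longrightarrow> st e = \<one>\<^bsub>FG\<^esub>"
  unfolding st_def FG_altdef presented_group_one
  by (rule rel_eq) (auto simp: fg_rels_def StableLetter_gens)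

lemma tree_grown:
  assumes "r \<in> verts D"
  shows "grown (arcs T \<inter> Ep) (tail D) (head D) r (verts D) (arcs T \<inter> Ep)"
  using maximal_tree_grown [OF conn max_tree assms] .

text \<open>A generator is turned into a loop at \<open>r\<close> by travelling through the tree to
  its place and back; loops are closed under products.\<close>

lemma paths:
  assumes r: "r \<in> verts D" and g: "g \<in> carrier FG"
  shows "\<exists>p z. L.is_path r p r \<and> L.path_val r p z = g"
proof -
  have tree: "L.connects r \<one>\<^bsub>FG\<^esub> v" "L.connects v \<one>\<^bsub>FG\<^esub> r" if "v \<in> verts D" for v
    using L.connects_tree [OF tree_grown [OF r] _ st_tree r] that by auto
  have via: "L.connects r a r" if "L.connects v a w" "v \<in> verts D" "w \<in> verts D" "a \<in> carrier FG" for v w a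
    using L.connects_mult [OF L.connects_mult [OF tree(1) that(1)] tree(2)] that r by simp
  have gens: "L.connects r (pres_class fg_gens fg_rels [(x, True)]) r \<and>
      L.connects r (inv\<^bsub>FG\<^esub> (pres_class fg_gens fg_rels [(x, True)])) r" if x: "x \<in> fg_gens" for x
  proof (cases x)
    case (VertexElt v a)
    then have v: "v \<in> verts D" "a \<in> carrier (vgroup \<G> v)" using x by (auto simp: fg_gens_def)
    obtain z where z: "a = lv v z" by (rule lv_cases [OF v])
    have "vx v (- z) \<otimes>\<^bsub>FG\<^esub> vx v z = \<one>\<^bsub>FG\<^esub>"
      using L.vx_add [OF v(1), of "- z" z] L.vx_zero [OF v(1)] by simp
    then have "inv\<^bsub>FG\<^esub> (vx v z) = vx v (- z)" using v by (intro FG.inv_equality) auto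
    then show ?thesis
      using via [OF L.connects_vx v(1,1), of z] via [OF L.connects_vx v(1,1), of "- z"] v
      by (simp add: VertexElt z vx_def [symmetric])
  next
    case (StableLetter e)
    then have e: "e \<in> Ep" using x by (auto simp: fg_gens_def)
    have "tail D e \<in> verts D" "head D e \<in> verts D" using e Ep_arcs by auto
    then show ?thesis
      using via [OF L.connects_arc [of "(e, True)"]] via [OF L.connects_arc [of "(e, False)"]] e
      by (simp add: StableLetter st_def [symmetric] L.arc_val_def L.arc_src_def L.arc_tgt_def)
  qed
  have "g \<in> carrier (presented_group fg_gens fg_rels)" using g by (simp add: FG_altdef)
  then have "L.connects r g r"
  proof (induction rule: presented_group_induct)
    case one
    then show ?case using L.connects_one [OF r] by (simp add: FG_altdef)
  next
    case (gen x a)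
    then show ?case using L.connects_mult [OF _ gen(3) r] gens [OF gen(1)] by (simp add: FG_altdef)
  next
    case (inv_gen x a)
    then show ?case using L.connects_mult [OF _ inv_gen(3) r] gens [OF inv_gen(1)] by (simp add: FG_altdef)
  qed
  then show ?thesis by (simp add: L.connects_def)
qed

text \<open>The relation for one generator of each edge group implies those for all its elements, by
  \<open>arc_rel\<close>; so every model with trivial tree letters receives a homomorphism.\<close>

lemma universal:
  assumes K: "lattice_graph_group K (verts D) Ep (tail D) (head D) pt ph vx' st'"
    and tree: "\<And>e. e \<in> arcs T \<inter> Ep \<Longrightarrow> st' e = \<one>\<^bsub>K\<^esub>"
  shows "\<exists>\<Phi>\<in>hom FG K. (\<forall>v\<in>verts D. \<forall>z. \<Phi> (vx v z) = vx' v z) \<and> (\<forall>e\<in>Ep. \<Phi> (st e) = st' e)"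
proof -
  interpret K: lattice_graph_group K "verts D" Ep "tail D" "head D" pt ph vx' st' by fact
  define h where "h x = (case x of VertexElt v g \<Rightarrow> vx' v (inv_into UNIV (lv v) g) | StableLetter e \<Rightarrow> st' e)"
    for x :: "('v, 'e, 'a) gog_generator"
  have hv: "h (VertexElt v (lv v z)) = vx' v z" if "v \<in> verts D" for v z
    using that by (simp add: h_def lv_inv)
  have h: "h \<in> fg_gens \<rightarrow> carrier K" by (auto simp: fg_gens_def h_def)
  have rel: "word_eval K h r = word_eval K h s" if rs: "(r, s) \<in> fg_rels" "r \<in> gwords fg_gens" "s \<in> gwords fg_gens" for r s
  proof -
    from rs(1) consider
      (vert) v g g' where "r = [(VertexElt v g, True), (VertexElt v g', True)]"
        "s = [(VertexElt v (g \<otimes>\<^bsub>vgroup \<G> v\<^esub> g'), True)]" "v \<in> verts D"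
        "g \<in> carrier (vgroup \<G> v)" "g' \<in> carrier (vgroup \<G> v)"
      | (edge) e a where "r = [(StableLetter e, True), (VertexElt (head D e) (emono \<G> (einv \<G> e) a), True),
           (StableLetter e, False)]" "s = [(VertexElt (tail D e) (emono \<G> e a), True)]" "e \<in> Ep"
           "a \<in> carrier (egroup \<G> e)"
      | (tree) e where "r = [(StableLetter e, True)]" "s = []" "e \<in> arcs T \<inter> Ep"
      unfolding fg_rels_def by blast
    then show ?thesis
    proof cases
      case vert
      obtain z where "g = lv v z" by (rule lv_cases [OF vert(3,4)])
      moreover obtain z' where "g' = lv v z'" by (rule lv_cases [OF vert(3,5)])
      ultimately show ?thesis using vert by (simp add: hv lv(2) [symmetric] K.vx_add)
    next
      case edge
      then have e: "e \<in> arcs D" "einv \<G> e \<in> arcs D" using subsetD [OF Ep_arcs] by simp_all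
      obtain k :: int where a: "a = eg (egroup \<G> e) [^]\<^bsub>egroup \<G> e\<^esub> k"
        using edge(4) unfolding eg(2) [OF e(1)] by (rule rangeE)
      have "emono \<G> (einv \<G> e) a = lv (head D e) (zmult k (ph e))" "emono \<G> e a = lv (tail D e) (zmult k (pt e))"
        using emono_pow [OF e(2), of k] emono_pow [OF e(1), of k] e
        by (simp_all add: a ph_def pt_def egroup_einv)
      then have "word_eval K h r = st' e \<otimes>\<^bsub>K\<^esub> (vx' (head D e) (zmult k (ph e)) \<otimes>\<^bsub>K\<^esub> inv\<^bsub>K\<^esub> (st' e))"
        "word_eval K h s = vx' (tail D e) (zmult k (pt e))"
        using edge e by (simp_all add: hv) (simp_all add: h_def)
      then show ?thesis
        using K.arc_rel [of "(e, True)" k] edge(3) e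
        by (simp add: K.arc_val_def K.arc_tgt_def K.arc_src_def K.arc_vec_def K.arc_rev_def K.m_assoc)
    next
      case tree
      then show ?thesis using assms(2) by (simp add: h_def)
    qed
  qed
  obtain \<Phi> where \<Phi>: "\<Phi> \<in> hom (presented_group fg_gens fg_rels) K"
    "\<And>w. w \<in> gwords fg_gens \<Longrightarrow> \<Phi> (pres_class fg_gens fg_rels w) = word_eval K h w"
    using K.presented_group_hom [OF h rel] by blast
  show ?thesis
  proof (intro bexI conjI ballI allI)
    show "\<Phi> \<in> hom FG K" using \<Phi>(1) by (simp add: FG_altdef)
    show "\<Phi> (vx v z) = vx' v z" if "v \<in> verts D" for v z
      using that \<Phi>(2) [of "[(VertexElt v (lv v z), True)]"]
      by (simp add: vx_def VertexElt_gens lv_closed hv)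
    show "\<Phi> (st e) = st' e" if "e \<in> Ep" for e
      using that \<Phi>(2) [of "[(StableLetter e, True)]"] by (simp add: st_def StableLetter_gens h_def)
  qed
qed

end

text \<open>A potential with prescribed increments can be extended over each attached leaf, as the
  leaf has a single edge to the earlier vertices.\<close>

lemma (in group) tree_potential:
  assumes "grown E src tgt r S U" and w: "\<And>e. e \<in> E \<Longrightarrow> w e \<in> carrier G"
  shows "\<exists>s. s r = \<one> \<and> (\<forall>v\<in>S. s v \<in> carrier G) \<and> (\<forall>e\<in>U. s (tgt e) = s (src e) \<otimes> w e)"
  using assms(1)
proof (induction rule: grown.induct)
  case root
  show ?case by (intro exI [of _ "\<lambda>_. \<one>"]) simp
next
  case (attach S U a)
  then obtain s where s: "s r = \<one>" "\<And>v. v \<in> S \<Longrightarrow> s v \<in> carrier G"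
    "\<And>e. e \<in> U \<Longrightarrow> s (tgt e) = s (src e) \<otimes> w e" by blast
  define v where "v = osrc tgt src a"
  define s' where "s' = s(v := s (osrc src tgt a) \<otimes> (if snd a then w (fst a) else inv (w (fst a))))"
  note ends = grown_ends [OF attach(1)]
  have v: "v \<notin> S" using attach(4) by (simp add: v_def)
  have we: "w (fst a) \<in> carrier G" using w attach(2) by blast
  have su: "s (osrc src tgt a) \<in> carrier G" using s(2) attach(3) by blast
  have old: "s' u = s u" if "u \<in> S" for u using that v by (auto simp: s'_def)
  have new: "s' v = s (osrc src tgt a) \<otimes> (if snd a then w (fst a) else inv (w (fst a)))"
    by (simp add: s'_def)
  have "s' (tgt (fst a)) = s' (src (fst a)) \<otimes> w (fst a)"
  proof (cases "snd a")
    case True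
    then have "tgt (fst a) = v" "osrc src tgt a = src (fst a)" "src (fst a) \<in> S"
      using attach(3) by (simp_all add: v_def osrc_def)
    then show ?thesis using new old True by simp
  next
    case False
    then have *: "src (fst a) = v" "osrc src tgt a = tgt (fst a)" "tgt (fst a) \<in> S"
      using attach(3) by (simp_all add: v_def osrc_def)
    then have "s' (src (fst a)) = s (tgt (fst a)) \<otimes> inv (w (fst a))" using new False by simp
    then show ?thesis using old [OF *(3)] su we * by (simp add: m_assoc)
  qed
  moreover have "s' (tgt e) = s' (src e) \<otimes> w e" if "e \<in> U" for e
    using s(3) [OF that] old ends that by simp
  moreover have "s' u \<in> carrier G" if "u \<in> insert v S" for u
    using that old s(2) new su we by (cases "u = v") auto
  moreover have "s' r = \<one>" using old [of r] ends s(1) by simp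
  ultimately show ?case unfolding v_def [symmetric] by (intro exI [of _ s'] conjI ballI) auto
qed

definition perm_group :: "('x \<Rightarrow> 'x) monoid" where
  "perm_group = \<lparr>carrier = {f. bij f}, monoid.mult = (\<circ>), one = id\<rparr>"

lemma perm_group_simps [simp]:
  "carrier perm_group = {f. bij f}" "f \<otimes>\<^bsub>perm_group\<^esub> g = f \<circ> g" "\<one>\<^bsub>perm_group\<^esub> = id"
  by (simp_all add: perm_group_def)

lemma group_perm_group: "group perm_group"
proof (rule groupI)
  fix f :: "'x \<Rightarrow> 'x" assume "f \<in> carrier perm_group"
  then have "inv_into UNIV f \<in> carrier perm_group" "inv_into UNIV f \<otimes>\<^bsub>perm_group\<^esub> f = \<one>\<^bsub>perm_group\<^esub>"
    by (simp_all add: bij_imp_bij_inv bij_is_inj)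
  then show "\<exists>g\<in>carrier perm_group. g \<otimes>\<^bsub>perm_group\<^esub> f = \<one>\<^bsub>perm_group\<^esub>" by blast
qed (auto simp: bij_comp comp_assoc)

context tubular_graph
begin

text \<open>Characteristic 0 gives as many positive edges as vertices, and the tree has one positive
  edge fewer than vertices.\<close>

lemma euler_char_zero:
  assumes "euler_char D = 0"
  obtains e0 where "e0 \<in> Ep" "e0 \<notin> arcs T" "Ep = insert e0 (arcs T \<inter> Ep)"
proof -
  have fin: "finite Ep" using Ep_arcs finite_arcs by (rule finite_subset)
  have "card (arcs D) = card (Ep \<union> einv \<G> ` Ep)" using orient by (simp add: orientation_def)
  also have "\<dots> = card Ep + card (einv \<G> ` Ep)"
    using orient fin by (intro card_Un_disjoint) (auto simp: orientation_def)
  also have "card (einv \<G> ` Ep) = card Ep" by (intro card_image inj_on_arev)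
  finally have "card (arcs D) = 2 * card Ep" by simp
  then have V: "card (verts D) = card Ep" using assms by (simp add: euler_char_def)
  obtain r where "r \<in> verts D" using conn by (auto simp: connected_def strongly_connected_def)
  from grown_card [OF tree_grown [OF this]] have "card Ep = Suc (card (arcs T \<inter> Ep))" using V by simp
  then have "card (Ep - arcs T \<inter> Ep) = 1" using fin by (subst card_Diff_subset) auto
  then obtain e0 where "Ep - arcs T \<inter> Ep = {e0}" by (rule card_1_singletonE)
  then show ?thesis using that [of e0] by blast
qed

text \<open>If the two end vectors of \<open>e0\<close> are proportional, then the group acts on the affine line: vertex groups
  by translations, the stable letter of \<open>e0\<close> by scaling.\<close>

lemma vx_infinite_order:
  fixes A B :: "'v \<Rightarrow> 'i \<Rightarrow> rat"
  assumes e0: "Ep = insert e0 (arcs T \<inter> Ep)" "e0 \<notin> arcs T"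
    and tree: "\<And>e. e \<in> arcs T \<inter> Ep \<Longrightarrow> emb A B (tail D e) (pt e) = emb A B (head D e) (ph e)"
    and \<rho>: "\<rho> \<noteq> 0" "\<And>i. emb A B (tail D e0) (pt e0) i = \<rho> * emb A B (head D e0) (ph e0) i"
    and nz: "emb A B (head D e0) (ph e0) j \<noteq> 0"
  shows "FG.ord (vx (head D e0) (ph e0)) = 0"
proof -
  \<comment> \<open>Only the coordinate \<open>j\<close> is read, where the vector at the head of
    \<open>e0\<close> is nonzero; its generator thus becomes a nontrivial translation.\<close>
  define vx' where "vx' v z = (\<lambda>q. q + emb A B v z j)" for v z
  define st' where "st' e = (if e = e0 then (\<lambda>q. \<rho> * q) else id)" for e
  have bij_add: "bij (\<lambda>q :: rat. q + c)" for c
    by (rule bij_betw_byWitness [where f' = "\<lambda>q. q - c"]) auto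
  have bij_mult: "bij (\<lambda>q :: rat. \<rho> * q)"
    by (rule bij_betw_byWitness [where f' = "\<lambda>q. q / \<rho>"]) (use \<rho>(1) in auto)
  have K: "lattice_graph_group perm_group (verts D) Ep (tail D) (head D) pt ph vx' st'"
  proof (intro lattice_graph_group.intro lattice_graph_group_axioms.intro group_perm_group)
    fix e assume e: "e \<in> Ep"
    show "tail D e \<in> verts D" "head D e \<in> verts D" using L.ends e by auto
    show "st' e \<in> carrier perm_group" using bij_mult by (simp add: st'_def)
    show "st' e \<otimes>\<^bsub>perm_group\<^esub> vx' (head D e) (ph e) = vx' (tail D e) (pt e) \<otimes>\<^bsub>perm_group\<^esub> st' e"
    proof (cases "e = e0")
      case True
      then show ?thesis by (simp add: st'_def vx'_def fun_eq_iff \<rho>(2) algebra_simps)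
    next
      case False
      then have "e \<in> arcs T \<inter> Ep" using e e0(1) by blast
      from tree [OF this] show ?thesis using False by (simp add: st'_def vx'_def fun_eq_iff)
    qed
  next
    fix v z z'
    show "vx' v z \<in> carrier perm_group" using bij_add by (simp add: vx'_def)
    show "vx' v (z + z') = vx' v z \<otimes>\<^bsub>perm_group\<^esub> vx' v z'"
      by (simp add: vx'_def emb_def fun_eq_iff algebra_simps)
  qed
  have st'_one: "st' e = \<one>\<^bsub>perm_group\<^esub>" if "e \<in> arcs T \<inter> Ep" for e
    using that e0(2) by (auto simp: st'_def)
  have "\<exists>\<Phi>\<in>hom FG perm_group. (\<forall>v\<in>verts D. \<forall>z. \<Phi> (vx v z) = vx' v z) \<and> (\<forall>e\<in>Ep. \<Phi> (st e) = st' e)"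
    by (rule universal [OF K]) (rule st'_one)
  then obtain \<Phi> where \<Phi>': "\<Phi> \<in> hom FG perm_group" "\<forall>v\<in>verts D. \<forall>z. \<Phi> (vx v z) = vx' v z"
    "\<forall>e\<in>Ep. \<Phi> (st e) = st' e"
    by (elim bexE conjE) (rule that)
  note \<Phi> = \<Phi>'(1) \<Phi>'(2,3) [rule_format]
  define g where "g = vx (head D e0) (ph e0)"
  define c where "c = emb A B (head D e0) (ph e0) j"
  have v: "head D e0 \<in> verts D" using L.ends e0(1) by blast
  then have g: "g \<in> carrier FG" by (simp add: g_def)
  interpret \<Phi>: group_hom FG perm_group \<Phi>
    using \<Phi>(1) group_perm_group by (simp add: group_hom_def group_hom_axioms_def)
  have \<Phi>g: "\<Phi> g = (\<lambda>q. q + c)" using \<Phi>(2) [OF v] by (simp add: g_def vx'_def c_def)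
  have pow: "\<Phi> (g [^]\<^bsub>FG\<^esub> n) = (\<lambda>q. q + of_nat n * c)" for n :: nat
  proof (induction n)
    case 0
    then show ?case using \<Phi>.hom_one by (simp add: fun_eq_iff)
  next
    case (Suc n)
    have "\<Phi> (g [^]\<^bsub>FG\<^esub> Suc n) = \<Phi> (g [^]\<^bsub>FG\<^esub> n) \<circ> \<Phi> g"
      using g \<Phi>.hom_mult [of "g [^]\<^bsub>FG\<^esub> n" g] by simp
    then show ?case by (simp add: Suc \<Phi>g fun_eq_iff algebra_simps)
  qed
  have "g [^]\<^bsub>FG\<^esub> n \<noteq> \<one>\<^bsub>FG\<^esub>" if "n \<noteq> 0" for n :: nat
  proof
    assume "g [^]\<^bsub>FG\<^esub> n = \<one>\<^bsub>FG\<^esub>"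
    then have "\<Phi> (g [^]\<^bsub>FG\<^esub> n) = id" using \<Phi>.hom_one by simp
    then have "(\<lambda>q. q + of_nat n * c) 0 = id 0" unfolding pow by (rule fun_cong)
    then show False using that nz by (simp add: c_def)
  qed
  then show ?thesis using FG.ord_eq_0 [OF g] by (simp add: g_def)
qed

text \<open>A linear dependence between the end vectors, with denominators cleared, becomes by
  \<open>rel\<close> an equality of powers in the group. Conjugation by the stable letter of
  \<open>e0\<close> then relates two powers of one element of infinite order, and balancedness
  forces the ratio to be 1 or -1.\<close>

lemma balanced_end_vectors:
  fixes A B :: "'v \<Rightarrow> 'i \<Rightarrow> rat"
  assumes bal: "balanced FG" and e0: "Ep = insert e0 (arcs T \<inter> Ep)" "e0 \<notin> arcs T"
    and tree: "\<And>e. e \<in> arcs T \<inter> Ep \<Longrightarrow> emb A B (tail D e) (pt e) = emb A B (head D e) (ph e)"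
    and ind: "\<And>v. v \<in> verts D \<Longrightarrow> indep (A v) (B v)"
    and rel: "\<And>v w z z'. v \<in> verts D \<Longrightarrow> w \<in> verts D \<Longrightarrow> emb A B v z = emb A B w z' \<Longrightarrow>
      \<exists>k>0. vx v (zmult k z) = vx w (zmult k z')"
  defines "x \<equiv> emb A B (tail D e0) (pt e0)" and "y \<equiv> emb A B (head D e0) (ph e0)"
  shows "indep x y \<or> x = y \<or> x = (\<lambda>i. - y i)"
proof (rule disjCI)
  assume "\<not> (x = y \<or> x = (\<lambda>i. - y i))"
  then have neq: "x \<noteq> y" "x \<noteq> (\<lambda>i. - y i)" by auto
  have e: "e0 \<in> Ep" using e0(1) by blast
  then have eD: "e0 \<in> arcs D" using Ep_arcs by blast
  have V: "tail D e0 \<in> verts D" "head D e0 \<in> verts D" using L.ends e by auto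
  have nz: "\<exists>i. emb A B v z i \<noteq> 0" if "v \<in> verts D" "z \<noteq> 0" for v z
  proof (rule ccontr)
    assume "\<not> ?thesis"
    then have "emb A B v z = emb A B v 0" by (auto simp: emb_def fun_eq_iff)
    then show False using emb_inj [of A v B z 0] ind [OF that(1)] that(2) by blast
  qed
  obtain i where i: "x i \<noteq> 0" using nz [OF V(1) vec_nz [OF eD, folded pt_def]] by (auto simp: x_def)
  have "einv \<G> e0 \<in> arcs D" using eD by simp
  then obtain j where j: "y j \<noteq> 0" using nz [OF V(2) vec_nz [of "einv \<G> e0", folded ph_def]] by (auto simp: y_def)
  show "indep x y"
  proof (rule ccontr)
    assume "\<not> indep x y"
    then obtain a b where ab: "\<And>k. a * x k + b * y k = 0" "a \<noteq> 0 \<or> b \<noteq> 0" by (auto simp: indep_def)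
    have a: "a \<noteq> 0" using ab(1) [of j] ab(2) j by auto
    have b: "b \<noteq> 0" using ab(1) [of i] ab(2) i by auto
    obtain N where N: "N > 0" "\<And>q. q \<in> {a, b} \<Longrightarrow> \<exists>n :: int. of_int N * q = of_int n"
      using common_denominator [of "{a, b}"] by auto
    obtain m where m: "of_int N * a = of_int m" using N(2) [of a] by auto
    obtain n where n: "of_int N * b = of_int n" using N(2) [of b] by auto
    have mn: "m \<noteq> 0" "n \<noteq> 0"
    proof -
      have "(of_int m :: rat) \<noteq> 0" "(of_int n :: rat) \<noteq> 0" unfolding m [symmetric] n [symmetric] using N(1) a b by auto
      then show "m \<noteq> 0" "n \<noteq> 0" by auto
    qed
    have lin: "of_int m * x k = - of_int n * y k" for k
    proof -
      have "of_int m * x k + of_int n * y k = of_int N * (a * x k + b * y k)"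
        unfolding m [symmetric] n [symmetric] by (simp add: algebra_simps)
      then show ?thesis unfolding ab(1) by (simp add: eq_neg_iff_add_eq_0)
    qed
    have "emb A B (tail D e0) (zmult m (pt e0)) = emb A B (head D e0) (zmult (- n) (ph e0))"
      using lin by (auto simp: emb_zmult x_def y_def fun_eq_iff)
    then obtain k where k: "k > 0" "vx (tail D e0) (zmult k (zmult m (pt e0))) = vx (head D e0) (zmult k (zmult (- n) (ph e0)))"
      using rel [OF V] by blast
    define g where "g = vx (head D e0) (ph e0)"
    have g: "g \<in> carrier FG" using V by (simp add: g_def)
    have assoc: "zmult k (zmult l z) = zmult (k * l) z" for k l z by (simp add: zmult_def mult.assoc)
    \<comment> \<open>The stable letter moves the power of \<open>g\<close> to the tail of
      \<open>e0\<close>, where the equality of powers turns it into another power of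
      \<open>g\<close>.\<close>
    have "st e0 \<otimes>\<^bsub>FG\<^esub> vx (head D e0) (zmult (k * m) (ph e0)) \<otimes>\<^bsub>FG\<^esub> inv\<^bsub>FG\<^esub> (st e0) = vx (tail D e0) (zmult (k * m) (pt e0))"
      using L.arc_rel [of "(e0, True)" "k * m"] e
      by (simp add: L.arc_val_def L.arc_tgt_def L.arc_src_def L.arc_vec_def L.arc_rev_def)
    also have "\<dots> = vx (head D e0) (zmult (k * (- n)) (ph e0))" using k(2) unfolding assoc .
    finally have conj: "st e0 \<otimes>\<^bsub>FG\<^esub> g [^]\<^bsub>FG\<^esub> (k * m) \<otimes>\<^bsub>FG\<^esub> inv\<^bsub>FG\<^esub> (st e0) = g [^]\<^bsub>FG\<^esub> (k * (- n))"
      by (simp only: L.vx_zmult V g_def)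
    have "FG.ord g = 0"
      unfolding g_def
    proof (rule vx_infinite_order [OF e0 tree])
      show "- of_int n / of_int m \<noteq> (0 :: rat)" using mn by simp
      show "emb A B (tail D e0) (pt e0) i = - of_int n / of_int m * emb A B (head D e0) (ph e0) i" for i
        using lin [of i] mn by (simp add: x_def y_def field_simps)
      show "emb A B (head D e0) (ph e0) j \<noteq> 0" using j by (simp add: y_def)
    qed
    moreover have "k * m \<noteq> 0" "k * (- n) \<noteq> 0" using k(1) mn by auto
    moreover have "st e0 \<in> carrier FG" using e by simp
    ultimately have "k * (- n) = k * m \<or> k * (- n) = - (k * m)"
      using bal g conj unfolding balanced_def by blast
    then have "k * (- n) = k * m \<or> k * (- n) = k * (- m)" by simp
    then have "- n = m \<or> - n = - m" using k(1) unfolding mult_cancel_left by simp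
    then have "n = - m \<or> n = m" by auto
    then show False
    proof
      assume "n = - m"
      then have "x i = y i" for i using lin [of i] mn by simp
      then show False using neq by auto
    next
      assume "n = m"
      then have "of_int m * x i = of_int m * (- y i)" for i using lin [of i] by simp
      then have "x i = - y i" for i using mn unfolding mult_cancel_left by simp
      then show False using neq by auto
    qed
  qed
qed

theorem balanced_imp_virtually_special:
  assumes chi: "euler_char D = 0" and bal: "balanced FG"
  shows "virtually_special FG"
proof -
  obtain e0 where e0: "e0 \<in> Ep" "e0 \<notin> arcs T" "Ep = insert e0 (arcs T \<inter> Ep)"
    using euler_char_zero [OF chi] .
  define r where "r = tail D e0"
  have r: "r \<in> verts D" using L.ends e0(1) by (simp add: r_def)
  have nz: "pt e \<noteq> 0 \<and> ph e \<noteq> 0" if "e \<in> Ep" for e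
    using vec_nz that Ep_arcs by (auto simp: pt_def ph_def)
  have "\<exists>A B :: 'v \<Rightarrow> 'v option \<Rightarrow> rat.
    (\<forall>e\<in>arcs T \<inter> Ep. emb A B (tail D e) (pt e) = emb A B (head D e) (ph e)) \<and>
    (\<forall>v\<in>verts D. v \<in> verts D \<and> indep (A v) (B v) \<and> (\<forall>w. w \<notin> verts D \<longrightarrow> A v (Some w) = 0 \<and> B v (Some w) = 0)) \<and>
    (\<forall>v\<in>verts D. \<forall>w\<in>verts D. \<forall>z z'. emb A B v z = emb A B w z' \<longrightarrow> (\<exists>k>0. vx v (zmult k z) = vx w (zmult k z')))"
    by (rule L.tree_embedding [OF tree_grown [OF r] inf_le2 _ _ r]) (use st_tree nz in auto)
  then obtain A B :: "'v \<Rightarrow> 'v option \<Rightarrow> rat" where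
    AB: "\<forall>e\<in>arcs T \<inter> Ep. emb A B (tail D e) (pt e) = emb A B (head D e) (ph e)"
    "\<forall>v\<in>verts D. v \<in> verts D \<and> indep (A v) (B v) \<and> (\<forall>w. w \<notin> verts D \<longrightarrow> A v (Some w) = 0 \<and> B v (Some w) = 0)"
    "\<forall>v\<in>verts D. \<forall>w\<in>verts D. \<forall>z z'. emb A B v z = emb A B w z' \<longrightarrow> (\<exists>k>0. vx v (zmult k z) = vx w (zmult k z'))"
    by (elim exE conjE) (rule that)
  note tree = AB(1) [rule_format] and rel = AB(3) [rule_format]
  have ind: "indep (A v) (B v)" if "v \<in> verts D" for v using AB(2) that by blast
  define x y where "x = emb A B (tail D e0) (pt e0)" and "y = emb A B (head D e0) (ph e0)"
  have "indep x y \<or> x = y \<or> x = (\<lambda>i. - y i)"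
    unfolding x_def y_def by (rule balanced_end_vectors [OF bal e0(3,2)]; (rule tree ind rel)?; assumption?)
  from swap_ex [OF this] obtain \<tau> where \<tau>': "\<forall>f. linear_form f \<longrightarrow> linear_form (\<lambda>u. f (\<tau> u))" "\<tau> x = y" "\<tau> y = x"
    by (elim exE conjE) (rule that)
  note \<tau> = \<tau>'(1) [rule_format] \<tau>'(2,3)
  \<comment> \<open>Tree edges identify equal vectors and keep the sheet; only \<open>e0\<close>
    calls for the involution.\<close>
  define sg where "sg e \<longleftrightarrow> e = e0" for e
  have "finite Ep" using Ep_arcs finite_arcs by (rule finite_subset)
  then have "\<exists>(F :: ('e \<times> nat) list) ea eb N. raag_target Ep (tail D) (head D) pt ph F (\<lambda>e. (e, 0)) ea eb sg N"
  proof (rule integral_forms)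
    fix e assume e: "e \<in> Ep"
    show "pt e \<noteq> 0 \<and> ph e \<noteq> 0" using nz [OF e] .
    show "indep (A (tail D e)) (B (tail D e)) \<and> indep (A (head D e)) (B (head D e))"
      using ind L.ends e by blast
    show "emb A B (tail D e) (pt e) = emb A B (head D e) (ph e)" if "\<not> sg e"
      using that e e0(3) by (intro tree) (auto simp: sg_def)
    show "\<tau> (emb A B (tail D e) (pt e)) = emb A B (head D e) (ph e) \<and>
      \<tau> (emb A B (head D e) (ph e)) = emb A B (tail D e) (pt e)" if "sg e"
      using that \<tau>(2,3) by (simp add: sg_def x_def y_def)
  qed (rule \<tau>(1))
  then obtain F :: "('e \<times> nat) list" and ea eb N where
    target: "raag_target Ep (tail D) (head D) pt ph F (\<lambda>e. (e, 0)) ea eb sg N"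
    by (elim exE) (rule that)
  from target interpret raag_target Ep "tail D" "head D" pt ph F "\<lambda>e. (e, 0)" ea eb sg N
    "\<lambda>i v z. ea i v * fst z + eb i v * snd z" .
  \<comment> \<open>The increments \<open>Tw e\<close> along the tree are chosen so that the
    conjugated stable letters \<open>st' e\<close> become trivial there.\<close>
  obtain S where S: "S r = \<one>\<^bsub>W\<^esub>" "\<And>v. v \<in> verts D \<Longrightarrow> S v \<in> carrier W"
    "\<And>e. e \<in> arcs T \<inter> Ep \<Longrightarrow> S (head D e) = S (tail D e) \<otimes>\<^bsub>W\<^esub> Tw e"
    using W.tree_potential [OF tree_grown [OF r], of Tw] Tw_closed by auto
  define vx' where "vx' v z = S v \<otimes>\<^bsub>W\<^esub> Lw v z \<otimes>\<^bsub>W\<^esub> inv\<^bsub>W\<^esub> (S v)" for v z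
  define st' where "st' e = S (tail D e) \<otimes>\<^bsub>W\<^esub> Tw e \<otimes>\<^bsub>W\<^esub> inv\<^bsub>W\<^esub> (S (head D e))" for e
  have canc: "inv\<^bsub>W\<^esub> a \<otimes>\<^bsub>W\<^esub> (a \<otimes>\<^bsub>W\<^esub> b) = b" if "a \<in> carrier W" "b \<in> carrier W" for a b
    using that by (simp add: W.m_assoc [symmetric] del: W_simps)
  have K: "lattice_graph_group W (verts D) Ep (tail D) (head D) pt ph vx' st'"
  proof (intro lattice_graph_group.intro lattice_graph_group_axioms.intro W.is_group)
    fix e assume e: "e \<in> Ep"
    show V: "tail D e \<in> verts D" "head D e \<in> verts D" using L.ends e by auto
    note c = S(2) [OF V(1)] S(2) [OF V(2)] Tw_closed [OF e] Lw_closed [of "head D e" "ph e"] Lw_closed [of "tail D e" "pt e"]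
    show "st' e \<in> carrier W" unfolding st'_def using c by (intro W.m_closed W.inv_closed)
    have "st' e \<otimes>\<^bsub>W\<^esub> vx' (head D e) (ph e) = S (tail D e) \<otimes>\<^bsub>W\<^esub> (Tw e \<otimes>\<^bsub>W\<^esub> Lw (head D e) (ph e)) \<otimes>\<^bsub>W\<^esub> inv\<^bsub>W\<^esub> (S (head D e))"
      unfolding st'_def vx'_def using c by (simp add: W.m_assoc canc del: W_simps)
    also have "\<dots> = vx' (tail D e) (pt e) \<otimes>\<^bsub>W\<^esub> st' e"
      unfolding st'_def vx'_def Tw_rel [OF e] using c by (simp add: W.m_assoc canc del: W_simps)
    finally show "st' e \<otimes>\<^bsub>W\<^esub> vx' (head D e) (ph e) = vx' (tail D e) (pt e) \<otimes>\<^bsub>W\<^esub> st' e" .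
  next
    fix v z z' assume v: "v \<in> verts D"
    note c = S(2) [OF v] Lw_closed [of v z] Lw_closed [of v z']
    show "vx' v z \<in> carrier W" unfolding vx'_def using c by (intro W.m_closed W.inv_closed)
    show "vx' v (z + z') = vx' v z \<otimes>\<^bsub>W\<^esub> vx' v z'"
      unfolding vx'_def Lw_add using c by (simp add: W.m_assoc canc del: W_simps)
  qed
  have st'_one: "st' e = \<one>\<^bsub>W\<^esub>" if e: "e \<in> arcs T \<inter> Ep" for e
  proof -
    have "S (head D e) \<in> carrier W" using S(2) L.ends e by blast
    then show ?thesis unfolding st'_def S(3) [OF e, symmetric] by (rule W.r_inv)
  qed
  have "\<exists>\<Phi>\<in>hom FG W. (\<forall>v\<in>verts D. \<forall>z. \<Phi> (vx v z) = vx' v z) \<and> (\<forall>e\<in>Ep. \<Phi> (st e) = st' e)"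
    by (rule universal [OF K]) (rule st'_one)
  then obtain \<Phi> where \<Phi>': "\<Phi> \<in> hom FG W" "\<forall>v\<in>verts D. \<forall>z. \<Phi> (vx v z) = vx' v z"
    "\<forall>e\<in>Ep. \<Phi> (st e) = st' e"
    by (elim bexE conjE) (rule that)
  note \<Phi> = \<Phi>'(1) \<Phi>'(2,3) [rule_format]
  show ?thesis
  proof (rule virtually_special_of_hom [OF L.lattice_graph_group_axioms \<Phi>(1)])
    show "S (tail D e0) = \<one>\<^bsub>W\<^esub>" using S(1) by (simp add: r_def)
    show "\<exists>p z. lattice_graph_group.is_path Ep (tail D) (head D) (tail D e0) p (tail D e0) \<and>
      L.path_val (tail D e0) p z = g" if "g \<in> carrier FG" for g
      using paths [OF r that] by (simp add: r_def)
  qed (use S(2) \<Phi>(2,3) e0(1) in \<open>auto simp: vx'_def st'_def simp del: W_simps\<close>)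
qed

end

text \<open>The converse is proved for the presented group; balancedness is carried there along
  \<open>h\<close>, and virtual specialness back to \<open>G\<close> along \<open>f\<close>.\<close>

theorem corollary1p11:
  fixes G :: "'g monoid" and \<G> :: "('v, 'e, 'a, 'b) graph_of_groups"
  assumes "is_tubular_group G \<G>"
    and "euler_char (ugraph \<G>) = 0"
  shows "virtually_special G \<longleftrightarrow> balanced G"
proof
  have G: "group G" using assms(1) by (simp add: is_tubular_group_def)
  assume "virtually_special G"
  with G show "balanced G" by (rule virtually_special_imp_balanced)
next
  have G: "group G" using assms(1) by (simp add: is_tubular_group_def)
  assume bal: "balanced G"
  obtain T Ep where "tubular_graph \<G> T Ep" and iso: "G \<cong> fundamental_group \<G> T Ep"
    using assms(1) by (auto simp: is_tubular_group_def tubular_graph_def)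
  then interpret tubular_graph \<G> T Ep by simp
  have iso': "G \<cong> FG" "FG \<cong> G" using iso group.iso_sym [OF G] by (auto simp: FG_def)
  then obtain f h where "f \<in> mon G FG" "h \<in> mon FG G"
    by (auto simp: is_iso_def iso_iff_mon_epi)
  have "balanced FG" using balanced_mon [OF FG.is_group G \<open>h \<in> mon FG G\<close> bal] .
  then have "virtually_special FG" by (rule balanced_imp_virtually_special [OF assms(2)])
  then show "virtually_special G" by (rule virtually_special_mon [OF G FG.is_group \<open>f \<in> mon G FG\<close>])
qed

end
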